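(* Let $V=\mathbb R[x,y,z]_4$ be the space of real ternary quartics. The classification of the distinguished orbits in the null cone of $V$ for the natural action of $\mathrm{SL}_3(\mathbb R)$ is given in the following table. Each row gives the notation of the stratum, its type, the form that a critical point of that type must take (with real coefficients), and then the critical point(s) listed for that type. - $\beta_0$; type $(\frac43,\frac43,\frac43)$; form $\sum_{\alpha}a_\alpha\mathbf x^\alpha$ (sum over all monomials of degree 4); minimal. - $\beta_1$; type $(\frac87,\frac97,\frac{11}7)$; form $ax^2z^2+by^3z$; critical points: $a=\pm\sqrt{1/7}$, $b=\sqrt{1/14}$. - $\beta_2$; type $(1,\frac32,\frac32)$; form $x(az^3+bz^2y+czy^2+dy^3)$; critical points: $x[y^3+yz^2]$; $x[y^3-yz^2]$. - $\beta_3$; type $(\frac67,\frac{10}7,\frac{12}7)$; form $axyz^2+by^4$; critical points: $a=\sqrt{3/7}$, $b=\pm\sqrt{1/168}$. - $\beta_4$; type $(\frac56,\frac86,\frac{11}6)$; form $axyz^2+by^3z$; critical point: $a=\sqrt{5/12}$, $b=\sqrt{1/36}$. - $\alpha_{xyz^2}$; type $(1,1,2)$; form $z^2(ax^2+bxy+cy^2)$; critical points: $z^2[x^2+y^2]$; $-z^2[x^2+y^2]$; $z^2[x^2-y^2]$. - $\beta_5$; type $(\frac8{13},\frac{20}{13},\frac{24}{13})$; form $axz^3+by^4$; critical points: $a=\sqrt{4/39}$, $b=\pm\sqrt{5/312}$. - $\beta_6$; type $(\frac12,\frac32,2)$; form $axz^3+by^3z$; critical point: $a=\sqrt{1/12}$,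 $b=\sqrt{1/12}$. - $\beta_7$; type $(\frac13,\frac43,\frac73)$; form $axz^3+by^2z^2$; critical points: $a=\sqrt{1/18}$, $b=\pm\sqrt{1/6}$. - $\alpha_{y^2z^2}$; type $(0,2,2)$; form $\sum_{i=0}^4a_iy^{4-i}z^i$; critical points: $y^4+2ty^2z^2+z^4$ ($t\in\mathbb R$); $-[y^4+2ty^2z^2+z^4]$ ($-1\le t$); $y^4+2ty^2z^2-z^4$ ($t\in\mathbb R$). - $\beta_8$; type $(\frac12,\frac12,3)$; form $axz^3+byz^3$; empty (no critical points). - $\alpha_{yz^3}$; type $(0,1,3)$; form $ayz^3$; critical point: $a=\sqrt{1/6}$. - $\alpha_{z^4}$; type $(0,0,4)$; form $az^4$; critical points: $a=\pm\sqrt{1/24}$.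
   Context: $\mathrm{GL}_3(\mathbb R)$, and hence $\mathrm{SL}_3(\mathbb R)$, acts on $V$ by $(g\cdot p)(u)=p(g^{-1}u)$, $u\in\mathbb R^3$; $\pi$ denotes the differential of the action. The null cone is the set of $p\in V$ with $0\in\overline{\mathrm{SL}_3(\mathbb R)\cdot p}$. The inner product on $V$ makes monomials orthogonal, with $\|x^{d_1}y^{d_2}z^{d_3}\|^2=d_1!\,d_2!\,d_3!$. For $\mathfrak g=\mathfrak{gl}_3(\mathbb R)$ or $\mathfrak{sl}_3(\mathbb R)$ use the inner product $\langle\!\langle X,Y\rangle\!\rangle=\operatorname{tr}(XY^T)$, and let $\mathfrak p$ be the symmetric matrices in $\mathfrak g$. The moment map $m_{\mathfrak g}:V\smallsetminus\{0\}\to\mathfrak p$ is defined by $\langle\!\langle m_{\mathfrak g}(p),X\rangle\!\rangle=\frac1{\|p\|^2}\langle\pi(X)p,p\rangle$ for all $X\in\mathfrak p$, and $F_{\mathfrak g}=\|m_{\mathfrak g}\|^2$. An orbit of a nonzero element is distinguished if it contains a critical point of $F_{\mathfrak g}$. The critical points of $F_{\mathfrak{gl}_3(\mathbb R)}$ and $F_{\mathfrak{sl}_3(\mathbb R)}$ are the same. For a diagonal matrix $\beta$, let $\mathscr C(\beta)$ be the set of critical points $p$ of $F_{\mathfrak{gl}_3(\mathbb R)}$ such that $m_{\mathfrak{gl}_3(\mathbb R)}(p)$ is conjugate to $\beta$ under the orthogonal group. The stratum of $\beta$ is the set of nonzero $p\in V$ whose trajectory under the negative gradient flow of $F_{\mathfrak{gl}_3(\mathbb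 R)}$ has its limit in $\mathscr C(\beta)$. The row with type $(b_1,b_2,b_3)$ concerns the stratum of $\beta=-\mathrm{diag}(b_1,b_2,b_3)$. "Minimal" means that the critical points in that stratum are the global minima of $F_{\mathfrak{gl}_3(\mathbb R)}$, which correspond to the closed $\mathrm{SL}_3(\mathbb R)$-orbits of nonzero elements; these do not lie in the null cone and are not classified in the table.
   Formalization: In row β₂ the listed x[y³±yz²] are not themselves critical points (the moment map at both is −diag(1,5/2,1/2)); they are read as orbit representatives: each listed orbit contains a critical point with moment map −diag(1,3/2,3/2). *)

theory Defs
  imports "HOL-Analysis.Analysis"
begin

section \<open>Real ternary quartics\<close>

text \<open>A ternary quartic is given by its coefficients: the exponent \<open>(i, j, k)\<close> stands for
  the monomial \<open>x^i y^j z^k\<close>.\<close>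

definition expos :: "nat \<Rightarrow> (nat \<times> nat \<times> nat) set" where
  "expos n = {(i, j, k). i + j + k = n}"

lemma finite_expos [simp]: "finite (expos n)"
proof (rule finite_subset)
  show "expos n \<subseteq> {..n} \<times> {..n} \<times> {..n}"
    by (auto simp: expos_def)
qed auto

typedef quartic = "{c :: nat \<times> nat \<times> nat \<Rightarrow> real. \<forall>d. d \<notin> expos 4 \<longrightarrow> c d = 0}"
  morphisms coeff Quartic
  by (rule exI [of _ "\<lambda>_. 0"]) simp

lemma coeff_outside [simp]: "d \<notin> expos 4 \<Longrightarrow> coeff p d = 0"
  using coeff [of p] by blast

lemma quartic_eqI: "(\<And>d. d \<in> expos 4 \<Longrightarrow> coeff p d = coeff q d) \<Longrightarrow> p = q"
  by (metis coeff_inject coeff_outside ext)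

definition eval :: "quartic \<Rightarrow> real^3 \<Rightarrow> real" where
  "eval p u = (\<Sum>(i, j, k)\<in>expos 4. coeff p (i, j, k) * (u$1)^i * (u$2)^j * (u$3)^k)"

definition mon :: "nat \<Rightarrow> nat \<Rightarrow> nat \<Rightarrow> quartic" where
  "mon i j k = Quartic (\<lambda>d. if d = (i, j, k) \<and> d \<in> expos 4 then 1 else 0)"

lemma coeff_mon: "coeff (mon i j k) d = (if d = (i, j, k) \<and> d \<in> expos 4 then 1 else 0)"
  unfolding mon_def by (subst Quartic_inverse) auto

text \<open>The inner product makes the monomials orthogonal, with
  \<open>\<parallel>x^i y^j z^k\<parallel>^2 = i! j! k!\<close>.\<close>

instantiation quartic :: real_normed_vector
begin

definition "0 = Quartic (\<lambda>_. 0)"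
definition "p + q = Quartic (\<lambda>d. coeff p d + coeff q d)"
definition "p - q = Quartic (\<lambda>d. coeff p d - coeff q d)"
definition "- p = Quartic (\<lambda>d. - coeff p d)"
definition "r *\<^sub>R p = Quartic (\<lambda>d. r * coeff p d)"
definition norm_quartic :: "quartic \<Rightarrow> real" where
  "norm_quartic p = sqrt (\<Sum>(i, j, k)\<in>expos 4. fact i * fact j * fact k * (coeff p (i, j, k))\<^sup>2)"
definition sgn_quartic :: "quartic \<Rightarrow> quartic" where
  "sgn_quartic p = inverse (norm p) *\<^sub>R p"
definition dist_quartic :: "quartic \<Rightarrow> quartic \<Rightarrow> real" where
  "dist_quartic p q = norm (p - q)"
definition uniformity_quartic :: "(quartic \<times> quartic) filter" where
  "uniformity_quartic = (INF e\<in>{0<..}. principal {(p, q). dist p q < e})"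
definition open_quartic :: "quartic set \<Rightarrow> bool" where
  "open_quartic U \<longleftrightarrow> (\<forall>p\<in>U. eventually (\<lambda>(p', q). p' = p \<longrightarrow> q \<in> U) uniformity)"

lemma coeff_ops [simp]:
  "coeff 0 d = 0" "coeff (p + q) d = coeff p d + coeff q d"
  "coeff (p - q) d = coeff p d - coeff q d" "coeff (- p) d = - coeff p d"
  "coeff (r *\<^sub>R p) d = r * coeff p d"
  unfolding zero_quartic_def plus_quartic_def minus_quartic_def uminus_quartic_def
    scaleR_quartic_def
  by (subst Quartic_inverse; simp)+

lemma norm_quartic_L2:
  "norm p = L2_set (\<lambda>(i, j, k). sqrt (fact i * fact j * fact k) * coeff p (i, j, k)) (expos 4)"
  unfolding norm_quartic_def L2_set_def
  by (auto simp: power_mult_distrib intro!: sum.cong)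

instance
proof
  fix p q r :: quartic and a b :: real
  show "p + q + r = p + (q + r)" "p + q = q + p" "0 + p = p" "- p + p = 0" "p - q = p + - q"
    "a *\<^sub>R (p + q) = a *\<^sub>R p + a *\<^sub>R q" "(a + b) *\<^sub>R p = a *\<^sub>R p + b *\<^sub>R p"
    "a *\<^sub>R b *\<^sub>R p = (a * b) *\<^sub>R p" "1 *\<^sub>R p = p"
    by (rule quartic_eqI, simp add: algebra_simps)+
  show "norm p = 0 \<longleftrightarrow> p = 0"
  proof
    assume "norm p = 0"
    then show "p = 0"
      unfolding norm_quartic_L2 by (subst (asm) L2_set_eq_0_iff) (auto intro!: quartic_eqI)
  qed (auto simp: norm_quartic_def intro!: sum.neutral)
  have "norm (p + q) = L2_set
      (\<lambda>d. (\<lambda>(i, j, k). sqrt (fact i * fact j * fact k) * coeff p (i, j, k)) d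
         + (\<lambda>(i, j, k). sqrt (fact i * fact j * fact k) * coeff q (i, j, k)) d) (expos 4)"
    unfolding norm_quartic_L2 by (rule L2_set_cong) (auto simp: algebra_simps)
  also have "\<dots> \<le> norm p + norm q"
    unfolding norm_quartic_L2 by (rule L2_set_triangle_ineq)
  finally show "norm (p + q) \<le> norm p + norm q" .
  show "norm (a *\<^sub>R p) = \<bar>a\<bar> * norm p"
    unfolding norm_quartic_def
    by (simp add: power_mult_distrib mult.left_commute case_prod_unfold flip: sum_distrib_left)
      (simp add: real_sqrt_mult)
qed (simp_all add: sgn_quartic_def dist_quartic_def uniformity_quartic_def open_quartic_def)

end

instantiation quartic :: real_inner
begin

definition inner_quartic :: "quartic \<Rightarrow> quartic \<Rightarrow> real" where
  "inner_quartic p q =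
    (\<Sum>(i, j, k)\<in>expos 4. fact i * fact j * fact k * coeff p (i, j, k) * coeff q (i, j, k))"

instance
proof
  fix p q r :: quartic and a :: real
  show "p \<bullet> q = q \<bullet> p"
    unfolding inner_quartic_def by (rule sum.cong) (auto simp: mult_ac)
  show "(p + q) \<bullet> r = p \<bullet> r + q \<bullet> r"
    unfolding inner_quartic_def sum.distrib [symmetric]
    by (rule sum.cong) (auto simp: algebra_simps)
  show "(a *\<^sub>R p) \<bullet> q = a * (p \<bullet> q)"
    unfolding inner_quartic_def sum_distrib_left by (rule sum.cong) (auto simp: algebra_simps)
  show norm: "norm p = sqrt (p \<bullet> p)"
    unfolding norm_quartic_def inner_quartic_def by (simp add: power2_eq_square mult.assoc)
  show nonneg: "0 \<le> p \<bullet> p"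
    unfolding inner_quartic_def by (rule sum_nonneg) (auto simp: mult.assoc)
  show "p \<bullet> p = 0 \<longleftrightarrow> p = 0"
    using norm norm_eq_zero [of p] by simp
qed

end

lemma inner_mon:
  assumes "(i, j, k) \<in> expos 4"
  shows "p \<bullet> mon i j k = fact i * fact j * fact k * coeff p (i, j, k)"
proof -
  have "p \<bullet> mon i j k = (\<Sum>d\<in>expos 4. if d = (i, j, k)
      then fact i * fact j * fact k * coeff p (i, j, k) else 0)"
    unfolding inner_quartic_def by (rule sum.cong) (auto simp: coeff_mon split: if_splits)
  then show ?thesis
    using assms by simp
qed

instantiation quartic :: euclidean_space
begin

definition Basis_quartic :: "quartic set" where
  "Basis_quartic =
    (\<lambda>(i, j, k). (1 / sqrt (fact i * fact j * fact k)) *\<^sub>R mon i j k) ` expos 4"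

instance
proof
  have "(4, 0, 0) \<in> expos 4"
    by (simp add: expos_def)
  then show "(Basis :: quartic set) \<noteq> {}"
    unfolding Basis_quartic_def by blast
  show "finite (Basis :: quartic set)"
    by (simp add: Basis_quartic_def)
  show "u \<bullet> v = (if u = v then 1 else 0)" if uv: "u \<in> Basis" "v \<in> Basis" for u v :: quartic
  proof -
    obtain i j k i' j' k' where
      u: "u = (1 / sqrt (fact i * fact j * fact k)) *\<^sub>R mon i j k" "(i, j, k) \<in> expos 4" and
      v: "v = (1 / sqrt (fact i' * fact j' * fact k')) *\<^sub>R mon i' j' k'" "(i', j', k') \<in> expos 4"
      using uv by (auto simp: Basis_quartic_def)
    show ?thesis
    proof (cases "(i, j, k) = (i', j', k')")
      case True
      then have "u \<bullet> v = (fact i * fact j * fact k) /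
          (sqrt (fact i * fact j * fact k) * sqrt (fact i * fact j * fact k))"
        using u v by (simp add: inner_mon coeff_mon)
      moreover have "u = v"
        using True u v by simp
      ultimately show ?thesis
        by simp
    next
      case False
      then have "u \<bullet> v = 0"
        using u v by (auto simp: inner_mon coeff_mon)
      moreover have "u \<noteq> v"
      proof
        assume "u = v"
        moreover have "coeff u (i, j, k) \<noteq> 0" "coeff v (i, j, k) = 0"
          using False u v by (auto simp: coeff_mon)
        ultimately show False
          by simp
      qed
      ultimately show ?thesis
        by simp
    qed
  qed
  show "(\<forall>u\<in>Basis. p \<bullet> u = 0) \<longleftrightarrow> p = 0" for p :: quartic
  proof
    assume 0: "\<forall>u\<in>Basis. p \<bullet> u = 0"
    have *: "p \<bullet> (1 / sqrt (fact i * fact j * fact k)) *\<^sub>R mon i j k = 0"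
      if "(i, j, k) \<in> expos 4" for i j k
      using 0 imageI [OF that, of "\<lambda>(i, j, k). (1 / sqrt (fact i * fact j * fact k)) *\<^sub>R mon i j k"]
      unfolding Basis_quartic_def [symmetric] prod.case by (rule bspec)
    show "p = 0"
    proof (rule quartic_eqI)
      fix d assume "d \<in> expos 4"
      then obtain i j k where "d = (i, j, k)" "(i, j, k) \<in> expos 4"
        by (cases d) auto
      then show "coeff p d = coeff 0 d"
        using * [of i j k] by (simp add: inner_mon)
    qed
  qed simp
qed

end

section \<open>The action\<close>

text \<open>\<open>(g \<cdot> p) u = p (g\<inverse> u)\<close>; the lemmas \<open>eval_inject\<close> and \<open>eval_act\<close> below show that this
  description determines a quartic.\<close>

definition act :: "real^3^3 \<Rightarrow> quartic \<Rightarrow> quartic" where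
  "act g p = (THE q. \<forall>u. eval q u = eval p (matrix_inv g *v u))"

lemma sum_expos: "(\<Sum>d\<in>expos n. f d) = (\<Sum>i\<le>n. \<Sum>j\<le>n - i. f (i, j, n - i - j))"
proof -
  have "(\<Sum>i\<le>n. \<Sum>j\<le>n - i. f (i, j, n - i - j))
      = (\<Sum>(i, j)\<in>Sigma {..n} (\<lambda>i. {..n - i}). f (i, j, n - i - j))"
    by (rule sum.Sigma) auto
  also have "\<dots> = (\<Sum>d\<in>expos n. f d)"
    by (rule sum.reindex_bij_witness [of _ "\<lambda>(i, j, k). (i, j)" "\<lambda>(i, j). (i, j, n - i - j)"])
      (auto simp: expos_def)
  finally show ?thesis ..
qed

lemma eval_inject: "eval p = eval q \<longleftrightarrow> p = q"
proof
  assume eq: "eval p = eval q"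
  let ?d = "\<lambda>i j. coeff p (i, j, 4 - i - j) - coeff q (i, j, 4 - i - j)"
  have "(\<Sum>i\<le>4. (\<Sum>j\<le>4 - i. ?d i j * y^j) * x^i) = 0" for x y :: real
  proof -
    have "eval p (vector [x, y, 1]) - eval q (vector [x, y, 1]) = 0"
      using eq by simp
    then show ?thesis
      unfolding eval_def sum_expos sum_subtractf [symmetric] sum_distrib_right
      by (simp add: algebra_simps vector_3)
  qed
  then have "\<forall>i\<le>4. (\<Sum>j\<le>4 - i. ?d i j * y^j) = 0" for y :: real
    using Transcendental.polyfun_eq_0 [of "\<lambda>i. \<Sum>j\<le>4 - i. ?d i j * y^j" 4] by blast
  then have *: "\<forall>j\<le>4 - i. ?d i j = 0" if "i \<le> 4" for i
    using Transcendental.polyfun_eq_0 [of "?d i" "4 - i"] that by blast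
  show "p = q"
  proof (rule quartic_eqI)
    fix d assume "d \<in> expos 4"
    then obtain i j where "d = (i, j, 4 - i - j)" "i \<le> 4" "j \<le> 4 - i"
      by (cases d) (auto simp: expos_def)
    then show "coeff p d = coeff q d"
      using * by auto
  qed
qed simp

definition homogeneous :: "nat \<Rightarrow> (real^3 \<Rightarrow> real) \<Rightarrow> bool" where
  "homogeneous n f \<longleftrightarrow>
    (\<exists>c. \<forall>u. f u = (\<Sum>(i, j, k)\<in>expos n. c (i, j, k) * (u$1)^i * (u$2)^j * (u$3)^k))"

lemma homogeneous_0: "homogeneous 0 (\<lambda>u. 1)"
proof -
  have "expos 0 = {(0, 0, 0)}"
    by (auto simp: expos_def)
  then show ?thesis
    unfolding homogeneous_def by (intro exI [of _ "\<lambda>_. 1"]) simp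
qed

lemma homogeneous_add:
  assumes "homogeneous n f" "homogeneous n g"
  shows "homogeneous n (\<lambda>u. f u + g u)"
proof -
  obtain c where
    "\<And>u. f u = (\<Sum>(i, j, k)\<in>expos n. c (i, j, k) * (u$1)^i * (u$2)^j * (u$3)^k)"
    using assms(1) unfolding homogeneous_def by blast
  moreover obtain d where
    "\<And>u. g u = (\<Sum>(i, j, k)\<in>expos n. d (i, j, k) * (u$1)^i * (u$2)^j * (u$3)^k)"
    using assms(2) unfolding homogeneous_def by blast
  ultimately have "f u + g u = (\<Sum>(i, j, k)\<in>expos n.
      (c (i, j, k) + d (i, j, k)) * (u$1)^i * (u$2)^j * (u$3)^k)" for u
    by (simp add: case_prod_unfold distrib_right sum.distrib)
  then show ?thesis
    unfolding homogeneous_def by (intro exI [of _ "\<lambda>e. c e + d e"]) blast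
qed

lemma homogeneous_cmult:
  assumes "homogeneous n f"
  shows "homogeneous n (\<lambda>u. a * f u)"
proof -
  obtain c where "\<And>u. f u = (\<Sum>(i, j, k)\<in>expos n. c (i, j, k) * (u$1)^i * (u$2)^j * (u$3)^k)"
    using assms unfolding homogeneous_def by blast
  then have "a * f u = (\<Sum>(i, j, k)\<in>expos n.
      (a * c (i, j, k)) * (u$1)^i * (u$2)^j * (u$3)^k)" for u
    by (simp add: case_prod_unfold sum_distrib_left mult.assoc)
  then show ?thesis
    unfolding homogeneous_def by (intro exI [of _ "\<lambda>e. a * c e"]) blast
qed

lemma homogeneous_sum:
  assumes "finite A" "A \<noteq> {}" "\<And>a. a \<in> A \<Longrightarrow> homogeneous n (f a)"
  shows "homogeneous n (\<lambda>u. \<Sum>a\<in>A. f a u)"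
  using assms by (induction rule: finite_ne_induct) (auto intro: homogeneous_add)

lemma homogeneous_coord:
  assumes "homogeneous n f"
  shows "homogeneous (Suc n) (\<lambda>u. u$l * f u)"
proof -
  obtain c where c: "\<And>u. f u = (\<Sum>(i, j, k)\<in>expos n. c (i, j, k) * (u$1)^i * (u$2)^j * (u$3)^k)"
    using assms unfolding homogeneous_def by blast
  have *: "homogeneous (Suc n) (\<lambda>u. u$l * f u)"
    if inj: "inj_on s (expos n)" and im: "s ` expos n \<subseteq> expos (Suc n)"
      and s: "\<And>i j k u. (case s (i, j, k) of (i', j', k') \<Rightarrow> (u$1)^i' * (u$2)^j' * (u$3)^k')
        = u$l * ((u$1)^i * (u$2)^j * (u$3)^k :: real)" for s
    unfolding homogeneous_def
  proof (intro exI [of _ "\<lambda>e. if e \<in> s ` expos n then c (the_inv_into (expos n) s e) else 0"] allI)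
    fix u :: "real^3"
    let ?m = "\<lambda>(i, j, k). (u$1)^i * (u$2)^j * (u$3)^k"
    have m: "?m (s d) = u$l * ?m d" for d
      using s [where u = u] by (cases d) simp
    have "u$l * f u = (\<Sum>d\<in>expos n. c d * (u$l * ?m d))"
      unfolding c by (simp add: case_prod_unfold sum_distrib_left mult_ac)
    then have "u$l * f u = (\<Sum>d\<in>expos n. c d * ?m (s d))"
      by (simp only: m)
    also have "\<dots> = (\<Sum>e\<in>s ` expos n. c (the_inv_into (expos n) s e) * ?m e)"
      by (subst sum.reindex [OF inj]) (auto simp: the_inv_into_f_f [OF inj] intro!: sum.cong)
    also have "\<dots> = (\<Sum>e\<in>expos (Suc n).
        (if e \<in> s ` expos n then c (the_inv_into (expos n) s e) else 0) * ?m e)"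
      using im by (intro sum.mono_neutral_cong_left) auto
    finally show "u$l * f u = (\<Sum>(i, j, k)\<in>expos (Suc n).
        (if (i, j, k) \<in> s ` expos n then c (the_inv_into (expos n) s (i, j, k)) else 0)
          * (u$1)^i * (u$2)^j * (u$3)^k)"
      by (simp only: case_prod_unfold mult.assoc prod.collapse)
  qed
  consider "l = 1" | "l = 2" | "l = 3"
    using exhaust_3 by blast
  then show ?thesis
  proof cases
    case 1
    show ?thesis
      by (rule * [of "\<lambda>(i, j, k). (Suc i, j, k)"]) (auto simp: inj_on_def expos_def 1)
  next
    case 2
    show ?thesis
      by (rule * [of "\<lambda>(i, j, k). (i, Suc j, k)"]) (auto simp: inj_on_def expos_def 2)
  next
    case 3
    show ?thesis
      by (rule * [of "\<lambda>(i, j, k). (i, j, Suc k)"]) (auto simp: inj_on_def expos_def 3)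
  qed
qed

lemma homogeneous_linear_power:
  fixes A :: "real^3^3"
  assumes "homogeneous n f"
  shows "homogeneous (m + n) (\<lambda>u. ((A *v u)$l)^m * f u)"
proof (induction m)
  case (Suc m)
  have "(\<lambda>u. ((A *v u)$l)^Suc m * f u)
      = (\<lambda>u. \<Sum>i\<in>UNIV. A$l$i * (u$i * (((A *v u)$l)^m * f u)))"
    by (rule ext) (simp add: matrix_vector_mult_def sum_distrib_right mult.assoc)
  then show ?case
    using Suc by (auto intro!: homogeneous_sum homogeneous_cmult homogeneous_coord)
qed (use assms in simp)

lemma homogeneous_eval_linear: "homogeneous 4 (\<lambda>u. eval p (A *v u))"
proof -
  have "homogeneous 4 (\<lambda>u. case d of (i, j, k) \<Rightarrow>
      coeff p (i, j, k) * ((A *v u)$1)^i * ((A *v u)$2)^j * ((A *v u)$3)^k)"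
    if "d \<in> expos 4" for d
  proof -
    obtain i j k where d: "d = (i, j, k)" "i + j + k = 4"
      using \<open>d \<in> expos 4\<close> by (auto simp: expos_def)
    have "homogeneous (i + (j + (k + 0))) (\<lambda>u. ((A *v u)$1)^i *
        (((A *v u)$2)^j * (((A *v u)$3)^k * 1)))"
      by (intro homogeneous_linear_power homogeneous_0)
    then have "homogeneous 4 (\<lambda>u. coeff p d * (((A *v u)$1)^i *
        (((A *v u)$2)^j * (((A *v u)$3)^k * 1))))"
      using d by (intro homogeneous_cmult) (simp add: add.assoc)
    then show ?thesis
      by (simp add: d mult.assoc)
  qed
  moreover have "(4, 0, 0) \<in> expos 4"
    by (simp add: expos_def)
  then have "expos 4 \<noteq> {}"
    by blast
  ultimately show ?thesis
    unfolding eval_def by (intro homogeneous_sum) auto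
qed

lemma eval_act: "eval (act g p) u = eval p (matrix_inv g *v u)"
proof -
  obtain c where c: "\<And>u. eval p (matrix_inv g *v u)
      = (\<Sum>(i, j, k)\<in>expos 4. c (i, j, k) * (u$1)^i * (u$2)^j * (u$3)^k)"
    using homogeneous_eval_linear [of p "matrix_inv g"] unfolding homogeneous_def by blast
  define q where "q = Quartic (\<lambda>d. if d \<in> expos 4 then c d else 0)"
  have "coeff q d = c d" if "d \<in> expos 4" for d
    unfolding q_def using that by (subst Quartic_inverse) auto
  then have q: "\<forall>u. eval q u = eval p (matrix_inv g *v u)"
    unfolding c by (auto simp: eval_def intro!: sum.cong)
  have "act g p = q"
    unfolding act_def
  proof (rule the_equality)
    show "\<forall>u. eval q u = eval p (matrix_inv g *v u)"
      by (fact q)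
    show "q' = q" if "\<forall>u. eval q' u = eval p (matrix_inv g *v u)" for q'
      using that q by (intro eval_inject [THEN iffD1] ext) simp
  qed
  then show ?thesis
    using q by simp
qed

definition orbit :: "quartic \<Rightarrow> quartic set" where
  "orbit p = {act g p |g. det g = 1}"

definition null_cone :: "quartic set" where
  "null_cone = {p. 0 \<in> closure (orbit p)}"

section \<open>Moment map and critical points\<close>

text \<open>The differential of the action: the derivative of \<open>g \<mapsto> g \<cdot> p\<close> at the identity matrix.\<close>

definition pi_action :: "real^3^3 \<Rightarrow> quartic \<Rightarrow> quartic" where
  "pi_action X p = frechet_derivative (\<lambda>g. act g p) (at (mat 1)) X"

text \<open>The library inner product on matrices is the trace form.\<close>

lemma inner_matrix_eq_trace:
  fixes X Y :: "real^3^3"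
  shows "X \<bullet> Y = trace (X ** transpose Y)"
  by (simp add: inner_vec_def trace_def matrix_matrix_mult_def transpose_def)

definition sym_gl :: "(real^3^3) set" where
  "sym_gl = {X. transpose X = X}"

definition sym_sl :: "(real^3^3) set" where
  "sym_sl = {X. transpose X = X \<and> trace X = 0}"

text \<open>The parameter \<open>P\<close> is the space of symmetric matrices in the Lie algebra, \<open>sym_gl\<close> or
  \<open>sym_sl\<close>. Both maps are only meaningful at nonzero quartics.\<close>

definition moment_map :: "(real^3^3) set \<Rightarrow> quartic \<Rightarrow> real^3^3" where
  "moment_map P p =
    (THE M. M \<in> P \<and> (\<forall>X\<in>P. M \<bullet> X = 1 / (norm p)\<^sup>2 * (pi_action X p \<bullet> p)))"

definition moment_norm :: "(real^3^3) set \<Rightarrow> quartic \<Rightarrow> real" where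
  "moment_norm P p = (norm (moment_map P p))\<^sup>2"

definition critical_point :: "(real^3^3) set \<Rightarrow> quartic \<Rightarrow> bool" where
  "critical_point P p \<longleftrightarrow> p \<noteq> 0 \<and> (moment_norm P has_derivative (\<lambda>h. 0)) (at p)"

definition global_minimum :: "(real^3^3) set \<Rightarrow> quartic \<Rightarrow> bool" where
  "global_minimum P p \<longleftrightarrow> p \<noteq> 0 \<and> (\<forall>q. q \<noteq> 0 \<longrightarrow> moment_norm P p \<le> moment_norm P q)"

definition distinguished :: "quartic set \<Rightarrow> bool" where
  "distinguished S \<longleftrightarrow> (\<exists>p. p \<noteq> 0 \<and> S = orbit p) \<and> (\<exists>q\<in>S. critical_point sym_sl q)"

section \<open>Strata\<close>

definition critical_set :: "real^3^3 \<Rightarrow> quartic set" where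
  "critical_set \<beta> = {p. critical_point sym_gl p \<and>
    (\<exists>k. orthogonal_matrix k \<and> moment_map sym_gl p = k ** \<beta> ** transpose k)}"

definition neg_gradient_trajectory :: "(real \<Rightarrow> quartic) \<Rightarrow> bool" where
  "neg_gradient_trajectory \<gamma> \<longleftrightarrow> (\<forall>t\<ge>0. \<gamma> t \<noteq> 0 \<and>
    (\<exists>v. GDERIV (moment_norm sym_gl) (\<gamma> t) :> v \<and>
         (\<gamma> has_vector_derivative - v) (at t within {0..})))"

definition stratum :: "real^3^3 \<Rightarrow> quartic set" where
  "stratum \<beta> = {p. \<exists>\<gamma> q. neg_gradient_trajectory \<gamma> \<and> \<gamma> 0 = p \<and>
    q \<in> critical_set \<beta> \<and> (\<gamma> \<longlongrightarrow> q) at_top}"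

section \<open>The table\<close>

datatype row =
    Beta0 | Beta1 | Beta2 | Beta3 | Beta4 | Alpha_xyzz | Beta5 | Beta6 | Beta7 | Alpha_yyzz
  | Beta8 | Alpha_yzzz | Alpha_zzzz

primrec row_type :: "row \<Rightarrow> real^3" where
  "row_type Beta0 = vector [4/3, 4/3, 4/3]"
| "row_type Beta1 = vector [8/7, 9/7, 11/7]"
| "row_type Beta2 = vector [1, 3/2, 3/2]"
| "row_type Beta3 = vector [6/7, 10/7, 12/7]"
| "row_type Beta4 = vector [5/6, 8/6, 11/6]"
| "row_type Alpha_xyzz = vector [1, 1, 2]"
| "row_type Beta5 = vector [8/13, 20/13, 24/13]"
| "row_type Beta6 = vector [1/2, 3/2, 2]"
| "row_type Beta7 = vector [1/3, 4/3, 7/3]"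
| "row_type Alpha_yyzz = vector [0, 2, 2]"
| "row_type Beta8 = vector [1/2, 1/2, 3]"
| "row_type Alpha_yzzz = vector [0, 1, 3]"
| "row_type Alpha_zzzz = vector [0, 0, 4]"

definition row_beta :: "row \<Rightarrow> real^3^3" where
  "row_beta r = - (\<chi> i j. if i = j then row_type r $ i else 0)"

primrec row_form :: "row \<Rightarrow> quartic set" where
  "row_form Beta0 = {\<Sum>(i, j, k)\<in>expos 4. a (i, j, k) *\<^sub>R mon i j k |a. True}"
| "row_form Beta1 = {a *\<^sub>R mon 2 0 2 + b *\<^sub>R mon 0 3 1 |a b. True}"
| "row_form Beta2 =
    {a *\<^sub>R mon 1 0 3 + b *\<^sub>R mon 1 1 2 + c *\<^sub>R mon 1 2 1 + d *\<^sub>R mon 1 3 0 |a b c d. True}"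
| "row_form Beta3 = {a *\<^sub>R mon 1 1 2 + b *\<^sub>R mon 0 4 0 |a b. True}"
| "row_form Beta4 = {a *\<^sub>R mon 1 1 2 + b *\<^sub>R mon 0 3 1 |a b. True}"
| "row_form Alpha_xyzz = {a *\<^sub>R mon 2 0 2 + b *\<^sub>R mon 1 1 2 + c *\<^sub>R mon 0 2 2 |a b c. True}"
| "row_form Beta5 = {a *\<^sub>R mon 1 0 3 + b *\<^sub>R mon 0 4 0 |a b. True}"
| "row_form Beta6 = {a *\<^sub>R mon 1 0 3 + b *\<^sub>R mon 0 3 1 |a b. True}"
| "row_form Beta7 = {a *\<^sub>R mon 1 0 3 + b *\<^sub>R mon 0 2 2 |a b. True}"
| "row_form Alpha_yyzz = {\<Sum>i\<le>4. a i *\<^sub>R mon 0 (4 - i) i |a. True}"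
| "row_form Beta8 = {a *\<^sub>R mon 1 0 3 + b *\<^sub>R mon 0 1 3 |a b. True}"
| "row_form Alpha_yzzz = {a *\<^sub>R mon 0 1 3 |a. True}"
| "row_form Alpha_zzzz = {a *\<^sub>R mon 0 0 4 |a. True}"

text \<open>The entries listed in a row. An entry is a set of quartics: a singleton, or a family
  depending on the real parameter \<open>t\<close>. The minimal row \<open>Beta0\<close> has no list.\<close>

primrec row_entries :: "row \<Rightarrow> quartic set set" where
  "row_entries Beta0 = {}"
| "row_entries Beta1 =
    {{sqrt (1/7) *\<^sub>R mon 2 0 2 + sqrt (1/14) *\<^sub>R mon 0 3 1},
     {- sqrt (1/7) *\<^sub>R mon 2 0 2 + sqrt (1/14) *\<^sub>R mon 0 3 1}}"
| "row_entries Beta2 = {{mon 1 3 0 + mon 1 1 2}, {mon 1 3 0 - mon 1 1 2}}"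
| "row_entries Beta3 =
    {{sqrt (3/7) *\<^sub>R mon 1 1 2 + sqrt (1/168) *\<^sub>R mon 0 4 0},
     {sqrt (3/7) *\<^sub>R mon 1 1 2 - sqrt (1/168) *\<^sub>R mon 0 4 0}}"
| "row_entries Beta4 = {{sqrt (5/12) *\<^sub>R mon 1 1 2 + sqrt (1/36) *\<^sub>R mon 0 3 1}}"
| "row_entries Alpha_xyzz =
    {{mon 2 0 2 + mon 0 2 2}, {- (mon 2 0 2 + mon 0 2 2)}, {mon 2 0 2 - mon 0 2 2}}"
| "row_entries Beta5 =
    {{sqrt (4/39) *\<^sub>R mon 1 0 3 + sqrt (5/312) *\<^sub>R mon 0 4 0},
     {sqrt (4/39) *\<^sub>R mon 1 0 3 - sqrt (5/312) *\<^sub>R mon 0 4 0}}"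
| "row_entries Beta6 = {{sqrt (1/12) *\<^sub>R mon 1 0 3 + sqrt (1/12) *\<^sub>R mon 0 3 1}}"
| "row_entries Beta7 =
    {{sqrt (1/18) *\<^sub>R mon 1 0 3 + sqrt (1/6) *\<^sub>R mon 0 2 2},
     {sqrt (1/18) *\<^sub>R mon 1 0 3 - sqrt (1/6) *\<^sub>R mon 0 2 2}}"
| "row_entries Alpha_yyzz =
    {{mon 0 4 0 + (2 * t) *\<^sub>R mon 0 2 2 + mon 0 0 4 |t. True},
     {- (mon 0 4 0 + (2 * t) *\<^sub>R mon 0 2 2 + mon 0 0 4) |t. -1 \<le> t},
     {mon 0 4 0 + (2 * t) *\<^sub>R mon 0 2 2 - mon 0 0 4 |t. True}}"
| "row_entries Beta8 = {}"
| "row_entries Alpha_yzzz = {{sqrt (1/6) *\<^sub>R mon 0 1 3}}"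
| "row_entries Alpha_zzzz = {{sqrt (1/24) *\<^sub>R mon 0 0 4}, {- sqrt (1/24) *\<^sub>R mon 0 0 4}}"

end

theory Submission
  imports Defs
begin

text \<open>Let \<open>m(p)\<close> be the moment matrix of a quartic \<open>p\<close> for the full linear group. Everything rests on
  two reformulations. First, the gradient of \<open>|m|^2\<close> at \<open>p\<close> is a multiple of
  \<open>m(p).p + |m(p)|^2 p\<close>, where \<open>X.p\<close> is the derivative of \<open>p\<close> along the linear vector field
  \<open>u \<mapsto> X u\<close>; so \<open>p\<close> is critical iff it is an eigenvector of its own moment matrix (\<open>GDERIV_mm\<close>,
  \<open>critical_point_gl\<close>). The trace of \<open>m(p)\<close> is \<open>-4\<close> by Euler's identity, hence passing to the special
  linear group subtracts the constant \<open>16/3\<close> from \<open>|m|^2\<close> and keeps the critical points. The gradient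
  vanishes at a critical point at least linearly, so by Gronwall's inequality the only trajectory
  starting there is constant, and membership of a critical point in a stratum is a condition on
  \<open>m(p)\<close> alone (\<open>critical_in_stratum_iff\<close>). Second, after an orthogonal change of coordinates
  \<open>m(p) = - diag b\<close> with \<open>b\<close> increasing, and then \<open>p\<close> is critical iff all its exponents lie on the
  hyperplane \<open>b \<bullet> \<alpha> = |b|^2\<close> (\<open>crit_iff_support\<close>).

  The vector \<open>b\<close> is the mean of the exponents of \<open>p\<close>, weighted by the squared norms of its terms. As
  all exponents lie in the plane of coordinate sum 4, they lie on one line, unless \<open>b\<close> is
  \<open>(4/3, 4/3, 4/3)\<close>, and \<open>b\<close> is the point of that line closest to the origin. So \<open>b\<close> is an exponent or
  the foot of the perpendicular from the origin to the segment between two exponents, and a finite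
  computation leaves the thirteen types (\<open>type_in_table\<close>).

  For each type the points of the hyperplane give the form of the critical points, and the
  diagonal and off-diagonal entries of \<open>m(p) = - diag b\<close> give equations for the coefficients. When
  the entries of \<open>b\<close> are distinct there are at most two terms, their coefficients are determined up
  to scaling and signs, and diagonal sign changes of determinant 1 leave the listed ones. For \<open>\<beta>\<^sub>8\<close> the equations
  contradict each other. In the rows \<open>\<beta>\<^sub>2\<close>, \<open>xyz\<^sup>2\<close> and \<open>y\<^sup>2z\<^sup>2\<close>, which have more terms, two entries of \<open>b\<close>
  agree; rotations in the corresponding plane preserve the type, and a suitable one removes the
  superfluous terms (\<open>normal_form\<close>).

  If \<open>|b|^2 > 16/3\<close>, the one-parameter group of \<open>b\<close>, made unimodular, rescales \<open>p\<close>; so the orbit is a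
  cone and reaches 0 in the limit (\<open>in_null_cone\<close>). As \<open>m(p)\<close> has trace \<open>-4\<close>, always
  \<open>|m(p)|^2 \<ge> 16/3\<close>, with equality iff \<open>m(p)\<close> is scalar, which the Fermat quartic achieves; so the row of
  \<open>\<beta>\<^sub>0\<close> consists of the global minima (\<open>global_minimum_iff\<close>). A quartic in this row is a
  shortest vector in its orbit by the argument of Kempf and Ness, and the orbit stays away from 0
  (\<open>minimal_not_in_null_cone\<close>).

  Finally, a critical point minimises \<open>|m|\<close> on its orbit, and the minimisers are controlled up to
  rotation: they arise from the critical point by matrices commuting with \<open>diag b\<close>
  (\<open>moment_norm_minimal_on_orbit\<close>). As \<open>|b|\<close> is different for all rows, the rows are
  separated. Inside a row with distinct \<open>b\<close>, that centraliser is diagonal and preserves the sign of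
  a coefficient with even exponents; in the remaining rows the signs of the values of the quartic
  or the number of its zeros on a line tell the entries apart (\<open>entries_distinct\<close>).\<close>

section \<open>Quartics and their pullbacks\<close>

lemma sum_expos_4: "(\<Sum>d\<in>expos 4. f d) =
    f (4,0,0) + f (3,1,0) + f (3,0,1) + f (2,2,0) + f (2,1,1) + f (2,0,2) + f (1,3,0) + f (1,2,1)
  + f (1,1,2) + f (1,0,3) + f (0,4,0) + f (0,3,1) + f (0,2,2) + f (0,1,3) + f (0,0,4)"
  for f :: "nat \<times> nat \<times> nat \<Rightarrow> 'a::comm_monoid_add"
  unfolding sum_expos by (simp add: eval_nat_numeral add_ac)

lemma expos_4: "expos 4 = {(4,0,0), (3,1,0), (3,0,1), (2,2,0), (2,1,1), (2,0,2), (1,3,0), (1,2,1),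
    (1,1,2), (1,0,3), (0,4,0), (0,3,1), (0,2,2), (0,1,3), (0,0,4)}"
(is "_ = ?S")
proof
  show "?S \<subseteq> expos 4"
    by (simp add: expos_def)
  have *: "(i, j, 4 - i - j) \<in> ?S" if "i + j \<le> 4" for i j
  proof -
    consider "i = 0" | "i = 1" | "i = 2" | "i = 3" | "i = 4"
      using \<open>i + j \<le> 4\<close> by linarith
    then show ?thesis
    proof cases
      case 1
      then have "j \<in> {0, 1, 2, 3, 4}"
        using that by auto
      then show ?thesis
        using 1 by auto
    next
      case 2
      then have "j \<in> {0, 1, 2, 3}"
        using that by auto
      then show ?thesis
        using 2 by auto
    next
      case 3
      then have "j \<in> {0, 1, 2}"
        using that by auto
      then show ?thesis
        using 3 by auto
    qed (use that in auto)
  qed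
  show "expos 4 \<subseteq> ?S"
  proof
    fix d assume "d \<in> expos 4"
    then obtain i j where "i + j \<le> 4" "d = (i, j, 4 - i - j)"
      by (cases d) (auto simp: expos_def)
    then show "d \<in> ?S"
      using * [of i j] by (simp only:)
  qed
qed

text \<open>The fourth power of the linear form with coefficient vector \<open>v\<close>: the factors
  \<open>24 / (i! j! k!)\<close> are the multinomial coefficients.\<close>

definition lin4 :: "real^3 \<Rightarrow> quartic" where
  "lin4 v = Quartic (\<lambda>(i, j, k). if (i, j, k) \<in> expos 4
     then 24 / (fact i * fact j * fact k) * ((v$1)^i * (v$2)^j * (v$3)^k) else 0)"

lemma coeff_lin4: "coeff (lin4 v) (i, j, k) = (if (i, j, k) \<in> expos 4
     then 24 / (fact i * fact j * fact k) * ((v$1)^i * (v$2)^j * (v$3)^k) else 0)"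
  unfolding lin4_def by (subst Quartic_inverse) auto

text \<open>The weights \<open>i! j! k!\<close> of the inner product cancel the denominators of the multinomial
  coefficients, so fourth powers represent evaluation at a point.\<close>

lemma inner_lin4: "p \<bullet> lin4 v = 24 * eval p v"
  unfolding inner_quartic_def eval_def sum_distrib_left
  by (rule sum.cong) (auto simp: coeff_lin4)

lemma eval_lin4: "eval (lin4 v) u = (v \<bullet> u)^4"
proof -
  have "(x + y + z)^4 = x^4 + 4*x^3*y + 4*x^3*z + 6*x^2*y^2 + 12*x^2*y*z + 6*x^2*z^2 + 4*x*y^3
      + 12*x*y^2*z + 12*x*y*z^2 + 4*x*z^3 + y^4 + 4*y^3*z + 6*y^2*z^2 + 4*y*z^3 + z^4"
    for x y z :: real
    by algebra
  then show ?thesis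
    unfolding eval_def sum_expos_4 inner_vec_def sum_3 case_prod_conv coeff_lin4
    by (simp add: expos_def fact_numeral power_mult_distrib)
qed

lemma eval_ops [simp]:
  "eval (p + q) u = eval p u + eval q u" "eval (p - q) u = eval p u - eval q u"
  "eval (- p) u = - eval p u" "eval (r *\<^sub>R p) u = r * eval p u" "eval 0 u = 0"
  unfolding eval_def
  by (simp_all add: case_prod_unfold sum.distrib sum_subtractf sum_distrib_left algebra_simps
      flip: sum_negf)

lemma eval_mon:
  assumes "(i, j, k) \<in> expos 4"
  shows "eval (mon i j k) u = (u$1)^i * (u$2)^j * (u$3)^k"
proof -
  have "eval (mon i j k) u =
    (\<Sum>d\<in>expos 4. if d = (i, j, k) then (u$1)^i * (u$2)^j * (u$3)^k else 0)"
    unfolding eval_def by (rule sum.cong) (auto simp: coeff_mon split: if_splits)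
  then show ?thesis
    using assms by simp
qed

lemma quartic_eq_evalI: "(\<And>u. eval p u = eval q u) \<Longrightarrow> p = q"
  using eval_inject by blast

text \<open>A quartic orthogonal to all fourth powers vanishes at every point.\<close>

lemma span_lin4: "span (range lin4) = UNIV"
proof (rule ccontr)
  assume "span (range lin4) \<noteq> UNIV"
  then obtain p where p: "p \<noteq> 0" "\<forall>q\<in>span (range lin4). p \<bullet> q = 0"
    using span_not_UNIV_orthogonal by blast
  have "eval p v = 0" for v
    using p(2) inner_lin4 [of p v] by (simp add: span_base)
  then have "p = 0"
    by (intro quartic_eq_evalI) simp
  then show False
    using p by simp
qed

text \<open>Identities that are linear in a quartic, such as adjointness relations, derivatives and
  limits, only need to be checked on fourth powers, where inner products are values.\<close>

lemma lin4_induct: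
  assumes "subspace {q. P q}" "\<And>v. P (lin4 v)"
  shows "P q"
proof -
  have "q \<in> span (range lin4)"
    by (simp add: span_lin4)
  then show ?thesis
    by (rule span_induct) (use assms in auto)
qed

text \<open>The substitution \<open>u \<mapsto> A u\<close>, also for singular \<open>A\<close>, characterised by its values.\<close>

definition pullback :: "real^3^3 \<Rightarrow> quartic \<Rightarrow> quartic" where
  "pullback A p = (SOME q. \<forall>u. eval q u = eval p (A *v u))"

lemma eval_pullback [simp]: "eval (pullback A p) u = eval p (A *v u)"
proof -
  obtain c where c: "\<And>u. eval p (A *v u)
      = (\<Sum>(i, j, k)\<in>expos 4. c (i, j, k) * (u$1)^i * (u$2)^j * (u$3)^k)"
    using homogeneous_eval_linear [of p A] unfolding homogeneous_def by blast
  define q where "q = Quartic (\<lambda>d. if d \<in> expos 4 then c d else 0)"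
  have "coeff q d = c d" if "d \<in> expos 4" for d
    unfolding q_def using that by (subst Quartic_inverse) auto
  then have "\<forall>u. eval q u = eval p (A *v u)"
    unfolding c by (auto simp: eval_def intro!: sum.cong)
  then show ?thesis
    unfolding pullback_def by (rule someI [THEN spec])
qed

lemma act_eq_pullback: "act g p = pullback (matrix_inv g) p"
  by (rule quartic_eq_evalI) (simp add: eval_act)

lemma pullback_pullback: "pullback B (pullback A p) = pullback (A ** B) p"
  by (rule quartic_eq_evalI) (simp add: matrix_vector_mul_assoc)

lemma pullback_mat_1 [simp]: "pullback (mat 1) p = p"
  by (rule quartic_eq_evalI) simp

lemma linear_pullback: "linear (pullback A)"
  by (rule linearI) (rule quartic_eq_evalI, simp)+

lemma pullback_lin4: "pullback A (lin4 v) = lin4 (transpose A *v v)"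
  by (rule quartic_eq_evalI) (simp add: eval_lin4 dot_lmul_matrix)

text \<open>Substituting \<open>A\<close> into a fourth power \<open>(v \<bullet> u)^4\<close> replaces \<open>v\<close> by \<open>A\<^sup>T v\<close>, and pairing with
  fourth powers is evaluation.\<close>

lemma inner_pullback: "pullback A p \<bullet> q = p \<bullet> pullback (transpose A) q"
proof (induction q rule: lin4_induct)
  case 1
  then show ?case
    by (auto simp: subspace_def inner_right_distrib linear_0 [OF linear_pullback]
        linear_add [OF linear_pullback] linear_scale [OF linear_pullback])
next
  case (2 v)
  then show ?case
    by (simp add: inner_lin4 pullback_lin4)
qed

section \<open>The infinitesimal action\<close>

fun expo :: "nat \<times> nat \<times> nat \<Rightarrow> 3 \<Rightarrow> nat" where
  "expo (i, j, k) a = (if a = 1 then i else if a = 2 then j else k)"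

fun shift :: "3 \<Rightarrow> 3 \<Rightarrow> nat \<times> nat \<times> nat \<Rightarrow> nat \<times> nat \<times> nat" where
  "shift a b (i, j, k) = (i + of_bool (b = 1) - of_bool (a = 1),
     j + of_bool (b = 2) - of_bool (a = 2), k + of_bool (b = 3) - of_bool (a = 3))"

definition monom :: "nat \<times> nat \<times> nat \<Rightarrow> quartic" where
  "monom d = (case d of (i, j, k) \<Rightarrow> mon i j k)"

text \<open>The polarisation operator \<open>u\<^sub>b \<partial>\<^sub>a\<close>. If \<open>\<partial>\<^sub>a\<close> kills a monomial, the subtraction in \<open>shift\<close> is
  truncated and the shifted exponent is meaningless, but then the factor \<open>expo d a\<close> is 0.\<close>

definition pol :: "3 \<Rightarrow> 3 \<Rightarrow> quartic \<Rightarrow> quartic" where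
  "pol a b p = (\<Sum>d\<in>expos 4. (coeff p d * expo d a) *\<^sub>R monom (shift a b d))"

text \<open>The derivative along the linear vector field \<open>u \<mapsto> X u\<close>.\<close>

definition lie :: "real^3^3 \<Rightarrow> quartic \<Rightarrow> quartic" where
  "lie X p = (\<Sum>a\<in>UNIV. \<Sum>b\<in>UNIV. X$a$b *\<^sub>R pol a b p)"

definition partial :: "3 \<Rightarrow> quartic \<Rightarrow> real^3 \<Rightarrow> real" where
  "partial a p u = (\<Sum>(i, j, k)\<in>expos 4. coeff p (i, j, k) *
     (if a = 1 then i * (u$1)^(i-1) * (u$2)^j * (u$3)^k
      else if a = 2 then (u$1)^i * (j * (u$2)^(j-1)) * (u$3)^k
      else (u$1)^i * (u$2)^j * (k * (u$3)^(k-1))))"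

lemma has_derivative_eval:
  "(eval p has_derivative (\<lambda>w. \<Sum>a\<in>UNIV. w$a * partial a p u)) (at u)"
  unfolding eval_def partial_def case_prod_unfold
  apply (rule derivative_eq_intros refl bounded_linear_imp_has_derivative bounded_linear_vec_nth)+
  apply (rule ext)
  apply (simp add: sum_3 sum_distrib_left flip: sum.distrib)
  apply (rule sum.cong)
   apply (simp_all add: algebra_simps)
  done

lemma eval_sum: "eval (\<Sum>x\<in>S. f x) u = (\<Sum>x\<in>S. eval (f x) u)"
  by (induction S rule: infinite_finite_induct) simp_all

lemma eval_pol: "eval (pol a b p) u = u$b * partial a p u"
proof -
  have *: "real (expo d a) * eval (monom (shift a b d)) u = u$b * (case d of (i, j, k) \<Rightarrow>
     (if a = 1 then i * (u$1)^(i-1) * (u$2)^j * (u$3)^k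
      else if a = 2 then (u$1)^i * (j * (u$2)^(j-1)) * (u$3)^k
      else (u$1)^i * (u$2)^j * (k * (u$3)^(k-1))))" if d: "d \<in> expos 4" for d
  proof -
    obtain i j k where ijk: "d = (i, j, k)" "i + j + k = 4"
      using d by (auto simp: expos_def)
    show ?thesis
    proof (cases "expo d a = 0")
      case True
      then show ?thesis
        using exhaust_3 [of a] ijk by auto
    next
      case False
      then have "shift a b d \<in> expos 4"
        using exhaust_3 [of a] exhaust_3 [of b] ijk by (auto simp: expos_def)
      then have "eval (monom (shift a b d)) u =
        (case shift a b d of (i, j, k) \<Rightarrow> (u$1)^i * (u$2)^j * (u$3)^k)"
        unfolding monom_def by (cases "shift a b d") (auto simp: eval_mon)
      then show ?thesis
        using False exhaust_3 [of a] exhaust_3 [of b] ijk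
        by (auto simp: power_eq_if [of _ i] power_eq_if [of _ j] power_eq_if [of _ k])
    qed
  qed
  show ?thesis
    unfolding pol_def partial_def eval_sum sum_distrib_left
    by (rule sum.cong) (auto simp: mult.assoc * mult.left_commute)
qed

lemma eval_lie: "eval (lie X p) u = (\<Sum>a\<in>UNIV. (X *v u)$a * partial a p u)"
  unfolding lie_def eval_sum
  by (simp add: eval_pol matrix_vector_mult_def sum_distrib_right mult.assoc)

text \<open>A family of quartics may be differentiated value by value, because fourth powers span.\<close>

lemma has_derivative_weakI:
  fixes f :: "'a::real_normed_vector \<Rightarrow> quartic"
  assumes "\<And>v. ((\<lambda>x. eval (f x) v) has_derivative (\<lambda>h. eval (f' h) v)) (at x)"
  shows "(f has_derivative f') (at x)"
proof -
  have "((\<lambda>x. f x \<bullet> q) has_derivative (\<lambda>h. f' h \<bullet> q)) (at x)" for q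
  proof (induction q rule: lin4_induct)
    case 1
    then show ?case
      by (auto simp: subspace_def inner_right_distrib intro!: has_derivative_add
          has_derivative_mult_right)
  next
    case (2 v)
    then show ?case
      using has_derivative_mult_right [OF assms [of v], of 24] by (simp add: inner_lin4)
  qed
  then show ?thesis
    by (subst has_derivative_componentwise_within) blast
qed

lemma has_derivative_eval_compose:
  assumes "(f has_derivative f') (at x)"
  shows "((\<lambda>x. eval p (f x)) has_derivative
           (\<lambda>h. \<Sum>a\<in>UNIV. f' h$a * partial a p (f x))) (at x)"
  using has_derivative_compose [OF assms has_derivative_eval [of p "f x"]] by simp

lemma bounded_linear_matrix_vector: "bounded_linear (\<lambda>A::real^3^3. A *v v)"
  by (intro linear_conv_bounded_linear [THEN iffD1] linearI)
    (simp_all add: matrix_vector_mult_add_rdistrib scaleR_matrix_vector_assoc)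

lemma has_derivative_pullback: "((\<lambda>A. pullback A p) has_derivative (\<lambda>X. lie X p)) (at (mat 1))"
proof (rule has_derivative_weakI)
  fix v
  have "((\<lambda>A. A *v v) has_derivative (\<lambda>X. X *v v)) (at (mat 1 :: real^3^3))"
    by (rule bounded_linear_imp_has_derivative [OF bounded_linear_matrix_vector])
  from has_derivative_eval_compose [OF this]
  show "((\<lambda>A. eval (pullback A p) v) has_derivative (\<lambda>X. eval (lie X p) v)) (at (mat 1))"
    by (simp add: eval_lie)
qed

lemma matrix_inv_unique:
  fixes A B :: "real^3^3"
  assumes "A ** B = mat 1"
  shows "matrix_inv A = B"
proof -
  have BA: "B ** A = mat 1"
    using assms matrix_left_right_inverse by blast
  have "A ** matrix_inv A = mat 1 \<and> matrix_inv A ** A = mat 1"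
    unfolding matrix_inv_def by (rule someI [of _ B]) (simp add: assms BA)
  then have "matrix_inv A = (B ** A) ** matrix_inv A"
    by (simp add: BA)
  also have "\<dots> = B"
    using \<open>A ** matrix_inv A = mat 1 \<and> _\<close> by (simp flip: matrix_mul_assoc)
  finally show ?thesis .
qed

text \<open>Cramer's rule expresses \<open>A\<^sup>-\<^sup>1 v\<close> as a rational function of the entries of \<open>A\<close> near the
  identity, which is differentiated entry by entry.\<close>

lemma has_derivative_matrix_inv_vector:
  "((\<lambda>A. matrix_inv A *v v) has_derivative (\<lambda>X. - (X *v v))) (at (mat 1 :: real^3^3))"
proof -
  let ?A = "\<lambda>k (A::real^3^3). (\<chi> i j. if j = k then v$i else A$i$j) :: real^3^3"
  let ?f = "\<lambda>A::real^3^3. (\<chi> k. det (?A k A) / det A) :: real^3"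
  have entry: "((\<lambda>A::real^3^3. A$i$j) has_derivative (\<lambda>X. X$i$j)) (at A)" for i j A
    by (rule bounded_linear_imp_has_derivative)
      (rule bounded_linear_compose [OF bounded_linear_vec_nth bounded_linear_vec_nth])
  have f: "(?f has_derivative (\<lambda>X. - (X *v v))) (at (mat 1))"
  proof (subst has_derivative_componentwise_within, rule ballI)
    fix e :: "real^3" assume "e \<in> Basis"
    then obtain k where k: "e = axis k 1"
      by (auto simp: Basis_vec_def)
    have "((\<lambda>A. det (?A k A) / det A) has_derivative (\<lambda>X. - (X *v v)$k)) (at (mat 1))"
      using exhaust_3 [of k]
      by (auto simp: det_3 mat_def matrix_vector_mult_def sum_3 algebra_simps
          intro!: derivative_eq_intros entry ext)
    then show "((\<lambda>A. ?f A \<bullet> e) has_derivative (\<lambda>X. - (X *v v) \<bullet> e)) (at (mat 1))"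
      by (simp add: k inner_axis)
  qed
  have "continuous_on UNIV (det :: real^3^3 \<Rightarrow> real)"
    unfolding det_3 by (intro continuous_intros)
  then have "open {A::real^3^3. det A \<noteq> 0}"
    by (intro open_Collect_neq continuous_on_const)
  moreover have "mat 1 \<in> {A::real^3^3. det A \<noteq> 0}"
    by simp
  moreover have "?f A = matrix_inv A *v v" if A: "A \<in> {A. det A \<noteq> 0}" for A
  proof -
    obtain B where B: "A ** B = mat 1"
      using A invertible_det_nz [of A] unfolding invertible_right_inverse by auto
    then have "A *v (B *v v) = v"
      by (simp add: matrix_vector_mul_assoc)
    then show ?thesis
      using cramer [of A "B *v v" v] A matrix_inv_unique [OF B] by simp
  qed
  ultimately show ?thesis
    by (rule has_derivative_transform_within_open [OF f])
qed

lemma has_derivative_act: "((\<lambda>g. act g p) has_derivative (\<lambda>X. - lie X p)) (at (mat 1))"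
proof (rule has_derivative_weakI)
  fix v
  have "matrix_inv (mat 1 :: real^3^3) = mat 1"
    by (rule matrix_inv_unique) simp
  then show "((\<lambda>g. eval (act g p) v) has_derivative (\<lambda>X. eval (- lie X p) v)) (at (mat 1))"
    using has_derivative_eval_compose [OF has_derivative_matrix_inv_vector [of v], of p]
    by (simp add: eval_lie eval_act sum_negf)
qed

text \<open>The sign appears because \<open>g\<close> acts by substituting its inverse.\<close>

lemma pi_action_eq_lie: "pi_action X p = - lie X p"
  unfolding pi_action_def by (simp flip: frechet_derivative_at [OF has_derivative_act])

lemma bounded_linear_transpose: "bounded_linear (transpose :: real^3^3 \<Rightarrow> real^3^3)"
  by (intro linear_conv_bounded_linear [THEN iffD1] linearI) (simp_all add: transpose_def vec_eq_iff)

text \<open>The derivative at the identity of the adjointness relation for substitutions.\<close>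

lemma inner_lie: "lie X p \<bullet> q = p \<bullet> lie (transpose X) q"
proof -
  have "((\<lambda>A. pullback A p \<bullet> q) has_derivative (\<lambda>X. lie X p \<bullet> q)) (at (mat 1))"
    by (rule has_derivative_inner_left [OF has_derivative_pullback])
  moreover have "((\<lambda>A. pullback (transpose A) q) has_derivative (\<lambda>X. lie (transpose X) q))
      (at (mat 1))"
    using has_derivative_compose [OF bounded_linear_imp_has_derivative [OF bounded_linear_transpose],
        of "\<lambda>A. pullback A q" "\<lambda>X. lie X q" "mat 1" UNIV]
    by (simp add: has_derivative_pullback transpose_mat)
  then have "((\<lambda>A. p \<bullet> pullback (transpose A) q) has_derivative (\<lambda>X. p \<bullet> lie (transpose X) q))
      (at (mat 1))"
    by (rule has_derivative_inner_right)
  ultimately have "(\<lambda>X. lie X p \<bullet> q) = (\<lambda>X. p \<bullet> lie (transpose X) q)"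
    unfolding inner_pullback by (rule has_derivative_unique)
  then show ?thesis
    by (rule fun_cong)
qed

text \<open>The derivative at \<open>Y = 1\<close> of the identity
  \<open>pullback Y (pullback A p) = pullback A (pullback (A Y A\<^sup>-\<^sup>1) p)\<close>.\<close>

lemma lie_pullback:
  assumes "B ** A = mat 1"
  shows "lie X (pullback A p) = pullback A (lie (A ** X ** B) p)"
proof -
  have lin: "bounded_linear (\<lambda>Y::real^3^3. A ** Y ** B)"
    by (intro linear_conv_bounded_linear [THEN iffD1] linearI)
      (simp_all add: matrix_matrix_mult_def vec_eq_iff sum_3 algebra_simps)
  have AB: "A ** B = mat 1"
    using assms matrix_left_right_inverse by blast
  have "((\<lambda>Y. pullback (A ** Y ** B) p) has_derivative (\<lambda>X. lie (A ** X ** B) p)) (at (mat 1))"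
    using has_derivative_compose [OF bounded_linear_imp_has_derivative [OF lin],
        of "\<lambda>A. pullback A p" "\<lambda>X. lie X p" "mat 1" UNIV]
    by (simp add: has_derivative_pullback AB)
  then have "((\<lambda>Y. pullback A (pullback (A ** Y ** B) p)) has_derivative
      (\<lambda>X. pullback A (lie (A ** X ** B) p))) (at (mat 1))"
    by (rule bounded_linear.has_derivative [OF linear_conv_bounded_linear [THEN iffD1, OF linear_pullback]])
  moreover have "pullback A (pullback (A ** Y ** B) p) = pullback Y (pullback A p)" for Y
    by (simp add: pullback_pullback assms flip: matrix_mul_assoc)
  ultimately show ?thesis
    using has_derivative_unique [OF has_derivative_pullback [of "pullback A p"]] by (simp add: fun_eq_iff)
qed

lemma lie_linear_simps:
  "lie (X + Y) p = lie X p + lie Y p" "lie (r *\<^sub>R X) p = r *\<^sub>R lie X p"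
  by (simp_all add: lie_def scaleR_add_left sum.distrib scaleR_sum_right)

lemma linear_lie: "linear (lie X)"
proof -
  have "partial a (p + q) u = partial a p u + partial a q u" for a p q u
    by (simp add: partial_def case_prod_unfold distrib_right sum.distrib)
  moreover have "partial a (r *\<^sub>R p) u = r * partial a p u" for a r p u
    by (simp add: partial_def case_prod_unfold sum_distrib_left mult.assoc)
  ultimately show ?thesis
    by (intro linearI; intro quartic_eq_evalI)
      (simp_all add: eval_lie distrib_left sum.distrib sum_distrib_left mult.left_commute)
qed

section \<open>The moment matrix\<close>

text \<open>The moment matrix: the entries are the pairings with the elementary matrices, and the sign is
  that of \<open>pi_action_eq_lie\<close>.\<close>

definition mm :: "quartic \<Rightarrow> real^3^3" where
  "mm p = (\<chi> a b. - (pol a b p \<bullet> p) / (norm p)\<^sup>2)"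

lemma inner_mm: "mm p \<bullet> X = - (lie X p \<bullet> p) / (norm p)\<^sup>2"
  by (simp add: mm_def inner_vec_def lie_def inner_sum_left sum_divide_distrib sum_negf mult_ac)

lemma transpose_mm [simp]: "transpose (mm p) = mm p"
proof -
  have inner_transpose: "transpose Y \<bullet> X = Y \<bullet> transpose X" for X Y :: "real^3^3"
    unfolding inner_vec_def transpose_def by (subst sum.swap) simp
  have "transpose (mm p) \<bullet> X = mm p \<bullet> X" for X
    unfolding inner_transpose inner_mm using inner_lie [of X p p] by (simp add: inner_commute)
  then have "(transpose (mm p) - mm p) \<bullet> (transpose (mm p) - mm p) = 0"
    by (simp only: inner_diff_left diff_self)
  then show ?thesis
    by simp
qed

lemma pi_action_inner: "1 / (norm p)\<^sup>2 * (pi_action X p \<bullet> p) = mm p \<bullet> X"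
  by (simp add: pi_action_eq_lie inner_mm)

text \<open>The explicit matrix is symmetric, so it is the symmetric matrix that the moment map asks for.\<close>

lemma moment_map_gl: "moment_map sym_gl p = mm p"
  unfolding moment_map_def pi_action_inner
proof (rule the_equality)
  show "mm p \<in> sym_gl \<and> (\<forall>X\<in>sym_gl. mm p \<bullet> X = mm p \<bullet> X)"
    by (simp add: sym_gl_def)
  fix M assume M: "M \<in> sym_gl \<and> (\<forall>X\<in>sym_gl. M \<bullet> X = mm p \<bullet> X)"
  then have "M - mm p \<in> sym_gl"
    using transpose_mm [of p] by (simp add: sym_gl_def transpose_def vec_eq_iff)
  then have "(M - mm p) \<bullet> (M - mm p) = 0"
    using M by (simp add: inner_diff_left)
  then show "M = mm p"
    by simp
qed

lemma coeff_sum: "coeff (\<Sum>x\<in>S. f x) d = (\<Sum>x\<in>S. coeff (f x) d)"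
  by (induction S rule: infinite_finite_induct) simp_all

lemma coeff_pol_diag:
  assumes d: "d \<in> expos 4"
  shows "coeff (pol a a p) d = expo d a * coeff p d"
proof -
  have "coeff (pol a a p) d = (\<Sum>e\<in>expos 4. if e = d then expo d a * coeff p d else 0)"
    unfolding pol_def coeff_sum
  proof (rule sum.cong [OF refl])
    fix e assume "e \<in> expos 4"
    moreover have "shift a a e = e"
      using exhaust_3 [of a] by (cases e) auto
    ultimately show "coeff ((coeff p e * expo e a) *\<^sub>R monom (shift a a e)) d =
        (if e = d then expo d a * coeff p d else 0)"
      by (cases e) (auto simp: monom_def coeff_mon)
  qed
  then show ?thesis
    using d by simp
qed

text \<open>Euler's identity for homogeneous polynomials of degree 4.\<close>

lemma lie_mat_1: "lie (mat 1) p = 4 *\<^sub>R p"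
proof (rule quartic_eqI)
  fix d assume d: "d \<in> expos 4"
  have "coeff (lie (mat 1) p) d = (expo d 1 + expo d 2 + expo d 3) * coeff p d"
    by (simp add: lie_def mat_def coeff_sum coeff_pol_diag [OF d] sum_3 algebra_simps)
  then show "coeff (lie (mat 1) p) d = coeff (4 *\<^sub>R p) d"
    using d by (cases d) (auto simp: expos_def)
qed

section \<open>Orthogonal changes of coordinates\<close>

lemma orthogonal_matrixD:
  assumes "orthogonal_matrix k"
  shows "transpose k ** k = mat 1" "k ** transpose k = mat 1"
  using assms by (auto simp: orthogonal_matrix_def)

lemma inner_matrix_mult:
  fixes A M X :: "real^3^3"
  shows "(A ** M) \<bullet> X = M \<bullet> (transpose A ** X)" "(M ** A) \<bullet> X = M \<bullet> (X ** transpose A)"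
proof -
  have "trace (A ** (M ** transpose X)) = trace ((M ** transpose X) ** A)"
    by (rule trace_mul_sym)
  then show "(A ** M) \<bullet> X = M \<bullet> (transpose A ** X)"
    by (simp add: inner_matrix_eq_trace matrix_transpose_mul matrix_mul_assoc)
  show "(M ** A) \<bullet> X = M \<bullet> (X ** transpose A)"
    by (simp add: inner_matrix_eq_trace matrix_transpose_mul matrix_mul_assoc)
qed

lemma inner_pullback_orthogonal:
  assumes "orthogonal_matrix k"
  shows "pullback k p \<bullet> pullback k q = p \<bullet> q"
  by (simp add: inner_pullback pullback_pullback orthogonal_matrixD [OF assms])

lemma norm_pullback_orthogonal:
  assumes "orthogonal_matrix k"
  shows "norm (pullback k p) = norm p"
  by (simp add: norm_eq_sqrt_inner inner_pullback_orthogonal [OF assms])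

text \<open>Orthogonal substitutions preserve the inner product and conjugate the infinitesimal action.\<close>

lemma mm_pullback:
  assumes "orthogonal_matrix k"
  shows "mm (pullback k p) = transpose k ** mm p ** k"
proof -
  have "mm (pullback k p) \<bullet> X = (transpose k ** mm p ** k) \<bullet> X" for X
  proof -
    have "mm (pullback k p) \<bullet> X = mm p \<bullet> (k ** X ** transpose k)"
      unfolding inner_mm lie_pullback [OF orthogonal_matrixD(1) [OF assms]]
      by (simp add: inner_pullback_orthogonal norm_pullback_orthogonal assms)
    then show ?thesis
      by (simp add: inner_matrix_mult(2) [of "transpose k ** mm p"]
          inner_matrix_mult(1) [of "transpose k"] matrix_mul_assoc)
  qed
  then have "\<forall>X. mm (pullback k p) \<bullet> X = (transpose k ** mm p ** k) \<bullet> X"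
    by blast
  then show ?thesis
    by (simp only: vector_eq_rdot)
qed

lemma norm_conj:
  fixes k M :: "real^3^3"
  assumes "orthogonal_matrix k"
  shows "(transpose k ** M ** k) \<bullet> (transpose k ** M ** k) = M \<bullet> M"
proof -
  have "(transpose k ** M ** k) \<bullet> (transpose k ** M ** k) = M \<bullet> (k ** (transpose k ** M ** k) ** transpose k)"
    by (subst (1) inner_matrix_mult(2)) (simp add: inner_matrix_mult(1) [of "transpose k"] matrix_mul_assoc)
  also have "k ** (transpose k ** M ** k) ** transpose k = (k ** transpose k) ** M ** (k ** transpose k)"
    by (simp only: matrix_mul_assoc)
  finally show ?thesis
    by (simp add: orthogonal_matrixD [OF assms])
qed

section \<open>The gradient of the squared moment map\<close>

text \<open>The gradient of the squared norm of the moment matrix, as \<open>GDERIV_mm\<close> shows.\<close>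

definition grad :: "quartic \<Rightarrow> quartic" where
  "grad p = - (4 / (p \<bullet> p)) *\<^sub>R (lie (mm p) p + (mm p \<bullet> mm p) *\<^sub>R p)"

lemma bounded_linear_lie: "bounded_linear (lie X)"
  using linear_lie linear_conv_bounded_linear by blast

text \<open>For fixed symmetric \<open>X\<close>, the function \<open>mm q \<bullet> X\<close> is minus the Rayleigh quotient of a
  self-adjoint operator.\<close>

lemma has_derivative_inner_mm:
  assumes "p \<noteq> 0" "transpose X = X"
  shows "((\<lambda>q. mm q \<bullet> X) has_derivative
    (\<lambda>h. h \<bullet> ((- 2 / (p \<bullet> p)) *\<^sub>R (lie X p + (mm p \<bullet> X) *\<^sub>R p)))) (at p)"
proof -
  have sym: "lie X h \<bullet> p = h \<bullet> lie X p" for h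
    using inner_lie [of X h p] assms by simp
  have num: "((\<lambda>q. - (lie X q \<bullet> q)) has_derivative (\<lambda>h. - (lie X p \<bullet> h + lie X h \<bullet> p))) (at p)"
    by (intro has_derivative_minus has_derivative_inner has_derivative_ident
        bounded_linear_imp_has_derivative bounded_linear_lie)
  have den: "((\<lambda>q. q \<bullet> q) has_derivative (\<lambda>h. p \<bullet> h + h \<bullet> p)) (at p)"
    by (intro has_derivative_inner has_derivative_ident)
  have "((\<lambda>q. - (lie X q \<bullet> q) / (q \<bullet> q)) has_derivative
    (\<lambda>h. h \<bullet> ((- 2 / (p \<bullet> p)) *\<^sub>R (lie X p + (- (lie X p \<bullet> p) / (p \<bullet> p)) *\<^sub>R p)))) (at p)"
    using has_derivative_divide [OF num den]
  proof (rule has_derivative_eq_rhs)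
    show "p \<bullet> p \<noteq> 0"
      using assms by simp
    then show "(\<lambda>h. - (- (lie X p \<bullet> p)) * (inverse (p \<bullet> p) * (p \<bullet> h + h \<bullet> p) * inverse (p \<bullet> p))
          + - (lie X p \<bullet> h + lie X h \<bullet> p) / (p \<bullet> p))
      = (\<lambda>h. h \<bullet> ((- 2 / (p \<bullet> p)) *\<^sub>R (lie X p + (- (lie X p \<bullet> p) / (p \<bullet> p)) *\<^sub>R p)))"
    proof (intro ext)
      fix h
      have "p \<bullet> h = h \<bullet> p" "lie X p \<bullet> h = h \<bullet> lie X p"
        by (rule inner_commute)+
      then show "- (- (lie X p \<bullet> p)) * (inverse (p \<bullet> p) * (p \<bullet> h + h \<bullet> p) * inverse (p \<bullet> p))
          + - (lie X p \<bullet> h + lie X h \<bullet> p) / (p \<bullet> p)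
        = h \<bullet> ((- 2 / (p \<bullet> p)) *\<^sub>R (lie X p + (- (lie X p \<bullet> p) / (p \<bullet> p)) *\<^sub>R p))"
        using \<open>p \<bullet> p \<noteq> 0\<close> unfolding sym inner_scaleR_right inner_add_right
        by (simp only:) (simp add: divide_simps)
    qed
  qed
  then show ?thesis
    by (simp add: inner_mm power2_norm_eq_inner)
qed

lemma differentiable_mm:
  assumes "p \<noteq> 0"
  shows "mm differentiable (at p)"
proof -
  have "(\<lambda>q. mm q \<bullet> X) differentiable (at p)" for X
    unfolding inner_mm power2_norm_eq_inner
    by (intro differentiable_divide differentiable_minus differentiable_inner differentiable_ident
        bounded_linear_imp_differentiable bounded_linear_lie) (use assms in simp)
  then show ?thesis
    by (subst differentiable_componentwise_within) blast
qed

text \<open>Both factors of \<open>mm q \<bullet> mm q\<close> contribute the same, namely the derivative of the Rayleigh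
  quotient \<open>mm q \<bullet> X\<close> with \<open>X\<close> fixed at \<open>mm p\<close>.\<close>

lemma GDERIV_mm:
  assumes "p \<noteq> 0"
  shows "GDERIV (\<lambda>q. mm q \<bullet> mm q) p :> grad p"
proof -
  obtain m' where m': "(mm has_derivative m') (at p)"
    using differentiable_mm [OF assms] unfolding differentiable_def by blast
  have "(\<lambda>h. m' h \<bullet> mm p)
      = (\<lambda>h. h \<bullet> ((- 2 / (p \<bullet> p)) *\<^sub>R (lie (mm p) p + (mm p \<bullet> mm p) *\<^sub>R p)))"
    by (rule has_derivative_unique [OF has_derivative_inner_left [OF m'] has_derivative_inner_mm])
      (use assms in auto)
  moreover have "((\<lambda>q. mm q \<bullet> mm q) has_derivative (\<lambda>h. mm p \<bullet> m' h + m' h \<bullet> mm p)) (at p)"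
    by (rule has_derivative_inner [OF m' m'])
  ultimately show ?thesis
  proof (simp only: gderiv_def, elim has_derivative_eq_rhs, intro ext)
    fix h
    assume *: "(\<lambda>h. m' h \<bullet> mm p)
      = (\<lambda>h. h \<bullet> ((- 2 / (p \<bullet> p)) *\<^sub>R (lie (mm p) p + (mm p \<bullet> mm p) *\<^sub>R p)))"
    have "mm p \<bullet> m' h + m' h \<bullet> mm p = 2 * (m' h \<bullet> mm p)"
      by (simp add: inner_commute [of "mm p" "m' h"])
    also have "\<dots> = h \<bullet> grad p"
      unfolding fun_cong [OF *] grad_def by simp
    finally show "mm p \<bullet> m' h + m' h \<bullet> mm p = h \<bullet> grad p" .
  qed
qed

lemma moment_norm_gl: "moment_norm sym_gl p = mm p \<bullet> mm p"
  by (simp add: moment_norm_def moment_map_gl power2_norm_eq_inner)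

lemma inner_mm_mat_1:
  assumes "p \<noteq> 0"
  shows "mm p \<bullet> mat 1 = - 4"
  using assms by (simp add: inner_mm lie_mat_1 power2_norm_eq_inner)

text \<open>The moment map for the special linear group is the trace-free part, and the trace is \<open>-4\<close>.\<close>

lemma moment_map_sl:
  assumes "p \<noteq> 0"
  shows "moment_map sym_sl p = mm p + (4/3) *\<^sub>R mat 1"
  unfolding moment_map_def pi_action_inner
proof (rule the_equality)
  have tr: "X \<bullet> mat 1 = trace X" for X :: "real^3^3"
    by (simp add: inner_matrix_eq_trace transpose_mat)
  have "mat 1 \<bullet> X = 0" if "X \<in> sym_sl" for X
    using that by (simp add: inner_commute [of "mat 1"] tr sym_sl_def)
  moreover have "mm p + (4/3) *\<^sub>R mat 1 \<in> sym_sl"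
  proof -
    have "mm p $ 1 $ 1 + mm p $ 2 $ 2 + mm p $ 3 $ 3 = - 4"
      using inner_mm_mat_1 [OF assms] by (simp add: tr trace_def sum_3)
    then show ?thesis
      using transpose_mm [of p]
      by (simp add: sym_sl_def transpose_def trace_def mat_def sum_3 vec_eq_iff)
  qed
  ultimately show *: "mm p + (4/3) *\<^sub>R mat 1 \<in> sym_sl \<and>
      (\<forall>X\<in>sym_sl. (mm p + (4/3) *\<^sub>R mat 1) \<bullet> X = mm p \<bullet> X)"
    by (simp add: inner_add_left)
  fix M assume M: "M \<in> sym_sl \<and> (\<forall>X\<in>sym_sl. M \<bullet> X = mm p \<bullet> X)"
  then have "M - (mm p + (4/3) *\<^sub>R mat 1) \<in> sym_sl"
    using * by (simp add: sym_sl_def transpose_def trace_def vec_eq_iff sum_subtractf)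
  then have "(M - (mm p + (4/3) *\<^sub>R mat 1)) \<bullet> (M - (mm p + (4/3) *\<^sub>R mat 1)) = 0"
    using M * by (simp only: inner_diff_left)
  then show "M = mm p + (4/3) *\<^sub>R mat 1"
    by simp
qed

lemma inner_mat_1: "mat 1 \<bullet> (mat 1 :: real^3^3) = 3"
  by (simp add: inner_matrix_eq_trace transpose_mat trace_I)

lemma moment_norm_sl:
  assumes "p \<noteq> 0"
  shows "moment_norm sym_sl p = mm p \<bullet> mm p - 16/3"
  using inner_mm_mat_1 [OF assms]
  by (simp add: moment_norm_def moment_map_sl [OF assms] power2_norm_eq_inner inner_add_left
      inner_add_right inner_commute [of "mat 1" "mm p"] inner_mat_1)

lemma has_derivative_inner_eq_0_iff:
  fixes v :: "'a::real_inner"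
  assumes "(f has_derivative (\<lambda>h. h \<bullet> v)) (at p)"
  shows "(f has_derivative (\<lambda>h. 0)) (at p) \<longleftrightarrow> v = 0"
proof
  assume "(f has_derivative (\<lambda>h. 0)) (at p)"
  then have "(\<lambda>h. h \<bullet> v) = (\<lambda>h. 0)"
    by (rule has_derivative_unique [OF assms])
  then have "v \<bullet> v = 0"
    by meson
  then show "v = 0"
    by simp
qed (use assms in simp)

text \<open>The critical point equation: \<open>p\<close> is an eigenvector of its own moment matrix. Pairing with \<open>p\<close> shows
  that \<open>- |mm p|^2\<close> is the only possible eigenvalue.\<close>

definition crit :: "quartic \<Rightarrow> bool" where
  "crit p \<longleftrightarrow> p \<noteq> 0 \<and> lie (mm p) p = - (mm p \<bullet> mm p) *\<^sub>R p"

lemma grad_eq_0_iff: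
  assumes "p \<noteq> 0"
  shows "grad p = 0 \<longleftrightarrow> crit p"
proof -
  have "grad p = 0 \<longleftrightarrow> lie (mm p) p + (mm p \<bullet> mm p) *\<^sub>R p = 0"
    unfolding grad_def using assms by simp
  also have "\<dots> \<longleftrightarrow> lie (mm p) p = - (mm p \<bullet> mm p) *\<^sub>R p"
    by (simp only: add_eq_0_iff2 scaleR_minus_left)
  finally show ?thesis
    using assms by (simp only: crit_def simp_thms)
qed

lemma critical_point_gl: "critical_point sym_gl p \<longleftrightarrow> crit p"
proof (cases "p = 0")
  case False
  then show ?thesis
    using has_derivative_inner_eq_0_iff [OF GDERIV_mm [OF False, unfolded gderiv_def]]
    by (simp add: critical_point_def moment_norm_gl [abs_def] grad_eq_0_iff)
qed (simp add: critical_point_def crit_def)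

text \<open>Away from 0 the two functions differ by the constant \<open>16/3\<close>.\<close>

lemma critical_point_sl: "critical_point sym_sl p \<longleftrightarrow> crit p"
proof (cases "p = 0")
  case False
  have "((\<lambda>q. mm q \<bullet> mm q - 16/3) has_derivative (\<lambda>h. h \<bullet> grad p)) (at p)"
    using has_derivative_diff [OF GDERIV_mm [OF False, unfolded gderiv_def] has_derivative_const]
    by simp
  then have "(moment_norm sym_sl has_derivative (\<lambda>h. h \<bullet> grad p)) (at p)"
    by (rule has_derivative_transform_within_open [where s = "- {0}"])
      (use False in \<open>auto simp: moment_norm_sl\<close>)
  from has_derivative_inner_eq_0_iff [OF this] show ?thesis
    using False grad_eq_0_iff [OF False] by (simp add: critical_point_def)
qed (simp add: critical_point_def crit_def)

text \<open>Orthogonal substitutions conjugate the moment matrix and the infinitesimal action alike, so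
  they preserve the critical point equation.\<close>

lemma crit_pullback:
  assumes k: "orthogonal_matrix k" and p: "crit p"
  shows "crit (pullback k p)"
proof -
  let ?M = "mm p"
  have "k ** (transpose k ** ?M ** k) ** transpose k = (k ** transpose k) ** ?M ** (k ** transpose k)"
    by (simp only: matrix_mul_assoc)
  then have conj: "k ** (transpose k ** ?M ** k) ** transpose k = ?M"
    by (simp add: orthogonal_matrixD [OF k])
  have "lie (mm (pullback k p)) (pullback k p) = pullback k (lie ?M p)"
    unfolding mm_pullback [OF k] lie_pullback [OF orthogonal_matrixD(1) [OF k]] conj ..
  also have "\<dots> = - (?M \<bullet> ?M) *\<^sub>R pullback k p"
    using p by (simp only: crit_def linear_scale [OF linear_pullback])
  finally have "lie (mm (pullback k p)) (pullback k p)
      = - (mm (pullback k p) \<bullet> mm (pullback k p)) *\<^sub>R pullback k p"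
    unfolding mm_pullback [OF k] norm_conj [OF k] .
  moreover have "pullback k p \<noteq> 0"
    using p norm_pullback_orthogonal [OF k, of p] by (metis crit_def norm_eq_zero)
  ultimately show ?thesis
    unfolding crit_def by blast
qed

section \<open>Gradient trajectories through critical points\<close>

text \<open>The moment matrix does not change when \<open>p\<close> is scaled, so the gradient is tangent to spheres.\<close>

lemma inner_grad: "q \<bullet> grad q = 0"
proof (cases "q = 0")
  case False
  then show ?thesis
    using inner_mm [of q "mm q"]
    by (simp add: grad_def inner_add_right inner_diff_right inner_commute [of q "lie (mm q) q"]
        power2_norm_eq_inner False)
qed simp

lemma bounded_bilinear_lie: "bounded_bilinear lie"
proof -
  have "bilinear lie"
    unfolding bilinear_def using linear_lie by (auto intro!: linearI simp: lie_linear_simps)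
  then show ?thesis
    by (simp add: bilinear_conv_bounded_bilinear)
qed

lemma differentiable_grad:
  assumes "p \<noteq> 0"
  shows "grad differentiable (at p)"
proof -
  obtain m' where m': "(mm has_derivative m') (at p)"
    using differentiable_mm [OF assms] unfolding differentiable_def by blast
  have "(\<lambda>q. lie (mm q) q) differentiable (at p)"
    unfolding differentiable_def
    using bounded_bilinear.FDERIV [OF bounded_bilinear_lie m' has_derivative_ident] by blast
  then show ?thesis
    unfolding grad_def [abs_def]
    by (intro differentiable_scaleR differentiable_add differentiable_minus differentiable_divide
        differentiable_inner differentiable_ident differentiable_const differentiable_mm)
      (use assms in auto)
qed

text \<open>Close to \<open>p\<close> this is differentiability of the gradient at its zero \<open>p\<close>; at distance at least
  \<open>d\<close> from \<open>p\<close> it follows from boundedness on the sphere. The sphere suffices, as trajectories have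
  constant norm.\<close>

lemma grad_Lipschitz_at_zero:
  assumes "crit p"
  obtains L where "L \<ge> 0" "\<And>q::quartic. norm q = norm p \<Longrightarrow> norm (grad q) \<le> L * norm (q - p)"
proof -
  have p: "p \<noteq> 0" "grad p = 0"
    using assms grad_eq_0_iff by (auto simp: crit_def)
  obtain g' where g': "(grad has_derivative g') (at p)"
    using differentiable_grad [OF p(1)] unfolding differentiable_def by blast
  then obtain K where K: "\<And>h. norm (g' h) \<le> norm h * K"
    using bounded_linear.bounded [OF has_derivative_bounded_linear] by blast
  obtain d where d: "d > 0" "\<And>q::quartic. norm (q - p) < d \<Longrightarrow> norm (grad q - grad p - g' (q - p)) \<le> 1 * norm (q - p)"
    using g' unfolding has_derivative_at_alt by (metis zero_less_one)
  have "continuous_on (sphere 0 (norm p)) grad"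
    using p(1) by (auto intro!: continuous_at_imp_continuous_on differentiable_imp_continuous_within
        differentiable_grad)
  then have "bounded (grad ` sphere 0 (norm p))"
    by (intro compact_imp_bounded compact_continuous_image) auto
  then obtain B where B: "B > 0" "\<And>q::quartic. norm q = norm p \<Longrightarrow> norm (grad q) \<le> B"
    unfolding bounded_pos by auto
  show thesis
  proof (rule that [of "max (1 + K) (B / d)"])
    show "max (1 + K) (B / d) \<ge> 0"
      using B d by (simp add: le_max_iff_disj)
    fix q :: quartic assume q: "norm q = norm p"
    have "norm (grad q) \<le> (1 + K) * norm (q - p) \<or> norm (grad q) \<le> B / d * norm (q - p)"
    proof (cases "norm (q - p) < d")
      case True
      then have "norm (grad q) \<le> norm (g' (q - p)) + norm (q - p)"
        using d(2) [OF True] norm_triangle_sub [of "grad q" "g' (q - p)"] by (simp add: p)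
      then show ?thesis
        using K [of "q - p"] by (simp add: algebra_simps)
    next
      case False
      then have "B * 1 \<le> B * (norm (q - p) / d)"
        using B d by (intro mult_left_mono) auto
      then show ?thesis
        using B(2) [OF q] by simp
    qed
    then show "norm (grad q) \<le> max (1 + K) (B / d) * norm (q - p)"
      by (simp add: max_mult_distrib_right le_max_iff_disj)
  qed
qed

text \<open>Gronwall's inequality: \<open>exp (- 2 L t) |\<gamma> t - p|^2\<close> is decreasing and starts at 0.\<close>

lemma trajectory_constant:
  assumes crit: "crit p" and traj: "neg_gradient_trajectory \<gamma>" and 0: "\<gamma> 0 = p" and "t \<ge> 0"
  shows "\<gamma> t = p"
proof -
  have nz: "\<gamma> s \<noteq> 0" if "s \<ge> 0" for s
    using traj that unfolding neg_gradient_trajectory_def by blast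
  have der: "(\<gamma> has_vector_derivative - grad (\<gamma> s)) (at s within {0..})" if s: "s \<ge> 0" for s
  proof -
    obtain v where v: "GDERIV (moment_norm sym_gl) (\<gamma> s) :> v"
      "(\<gamma> has_vector_derivative - v) (at s within {0..})"
      using traj s unfolding neg_gradient_trajectory_def by blast
    have "(\<lambda>h. h \<bullet> v) = (\<lambda>h. h \<bullet> grad (\<gamma> s))"
      using v(1) GDERIV_mm [OF nz [OF s]] unfolding moment_norm_gl [abs_def] gderiv_def
      by (rule has_derivative_unique)
    then have "\<forall>h. h \<bullet> v = h \<bullet> grad (\<gamma> s)"
      by (simp add: fun_eq_iff)
    then have "v = grad (\<gamma> s)"
      by (simp only: vector_eq_ldot)
    then show ?thesis
      using v by simp
  qed
  have cont: "continuous_on {0..t} \<gamma>"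
    unfolding continuous_on_eq_continuous_within
    by (auto intro!: continuous_within_subset [OF has_vector_derivative_continuous [OF der]])
  have der': "(\<gamma> has_vector_derivative - grad (\<gamma> s)) (at s)" if "0 < s" for s
  proof -
    have "at s within {0..} = at s"
      by (rule at_within_nhd [of s "{0<..}"]) (use that in auto)
    then show ?thesis
      using der [of s] that by simp
  qed
  have nrm: "norm (\<gamma> s) = norm p" if "0 \<le> s" "s \<le> t" for s
  proof (cases "s = 0")
    case False
    have "((\<lambda>r. \<gamma> r \<bullet> \<gamma> r) has_real_derivative 0) (at r)" if r: "0 < r" for r
      unfolding has_field_derivative_def
    proof (rule has_derivative_eq_rhs)
      show "((\<lambda>r. \<gamma> r \<bullet> \<gamma> r) has_derivative
          (\<lambda>h. \<gamma> r \<bullet> (h *\<^sub>R - grad (\<gamma> r)) + (h *\<^sub>R - grad (\<gamma> r)) \<bullet> \<gamma> r)) (at r)"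
        using der' [OF r] unfolding has_vector_derivative_def by (intro has_derivative_inner)
      show "(\<lambda>h. \<gamma> r \<bullet> (h *\<^sub>R - grad (\<gamma> r)) + (h *\<^sub>R - grad (\<gamma> r)) \<bullet> \<gamma> r) = (*) 0"
        by (rule ext) (simp add: inner_commute [of "grad (\<gamma> r)" "\<gamma> r"] inner_grad)
    qed
    moreover have "continuous_on {0..s} (\<lambda>r. \<gamma> r \<bullet> \<gamma> r)"
      using that by (intro continuous_intros continuous_on_subset [OF cont]) auto
    ultimately have "\<gamma> s \<bullet> \<gamma> s = \<gamma> 0 \<bullet> \<gamma> 0"
      using False that by (intro DERIV_isconst_end [of 0 s "\<lambda>r. \<gamma> r \<bullet> \<gamma> r"]) auto
    then show ?thesis
      by (simp add: 0 norm_eq_sqrt_inner)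
  qed (simp add: 0)
  obtain L where L: "\<And>q::quartic. norm q = norm p \<Longrightarrow> norm (grad q) \<le> L * norm (q - p)"
    using grad_Lipschitz_at_zero [OF crit] by blast
  let ?\<phi> = "\<lambda>r. exp (- (2 * L * r)) * ((\<gamma> r - p) \<bullet> (\<gamma> r - p))"
  have "?\<phi> t \<le> ?\<phi> 0"
  proof (rule DERIV_nonpos_imp_decreasing_open [OF \<open>t \<ge> 0\<close>])
    show "continuous_on {0..t} ?\<phi>"
      by (intro continuous_intros cont)
    fix s assume s: "0 < s" "s < t"
    have dd: "((\<lambda>r. (\<gamma> r - p) \<bullet> (\<gamma> r - p)) has_real_derivative - (2 * ((\<gamma> s - p) \<bullet> grad (\<gamma> s)))) (at s)"
      unfolding has_field_derivative_def
    proof (rule has_derivative_eq_rhs)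
      have "((\<lambda>r. \<gamma> r - p) has_derivative (\<lambda>h. h *\<^sub>R - grad (\<gamma> s) - 0)) (at s)"
        using der' [OF s(1)] unfolding has_vector_derivative_def
        by (intro has_derivative_diff has_derivative_const)
      then show "((\<lambda>r. (\<gamma> r - p) \<bullet> (\<gamma> r - p)) has_derivative (\<lambda>h. (\<gamma> s - p) \<bullet> (h *\<^sub>R - grad (\<gamma> s) - 0)
          + (h *\<^sub>R - grad (\<gamma> s) - 0) \<bullet> (\<gamma> s - p))) (at s)"
        by (intro has_derivative_inner)
      show "(\<lambda>h. (\<gamma> s - p) \<bullet> (h *\<^sub>R - grad (\<gamma> s) - 0) + (h *\<^sub>R - grad (\<gamma> s) - 0) \<bullet> (\<gamma> s - p))
          = (*) (- (2 * ((\<gamma> s - p) \<bullet> grad (\<gamma> s))))"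
        by (rule ext) (simp add: inner_commute [of "grad (\<gamma> s)" "\<gamma> s - p"])
    qed
    have "((\<lambda>r. exp (- (2 * L * r))) has_real_derivative - (2 * L) * exp (- (2 * L * s))) (at s)"
      by (auto intro!: derivative_eq_intros)
    then have "(?\<phi> has_real_derivative exp (- (2 * L * s)) *
        (- (2 * ((\<gamma> s - p) \<bullet> grad (\<gamma> s))) - 2 * L * ((\<gamma> s - p) \<bullet> (\<gamma> s - p)))) (at s)"
      by (rule DERIV_cong [OF DERIV_mult [OF _ dd]]) algebra
    moreover have "\<bar>(\<gamma> s - p) \<bullet> grad (\<gamma> s)\<bar> \<le> norm (\<gamma> s - p) * (L * norm (\<gamma> s - p))"
      by (rule order_trans [OF Cauchy_Schwarz_ineq2 mult_left_mono [OF L norm_ge_zero]])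
        (use s nrm in auto)
    then have "- (2 * ((\<gamma> s - p) \<bullet> grad (\<gamma> s))) - 2 * L * ((\<gamma> s - p) \<bullet> (\<gamma> s - p)) \<le> 0"
      unfolding dot_square_norm power2_eq_square by (simp add: abs_le_iff algebra_simps)
    ultimately show "\<exists>y. DERIV ?\<phi> s :> y \<and> y \<le> 0"
      using mult_nonneg_nonpos [OF exp_ge_zero] by blast
  qed
  then have "(\<gamma> t - p) \<bullet> (\<gamma> t - p) \<le> 0"
    by (simp add: 0 mult_le_0_iff)
  then have "(\<gamma> t - p) \<bullet> (\<gamma> t - p) = 0"
    using inner_ge_zero by (rule antisym)
  then show ?thesis
    by simp
qed

lemma critical_in_stratum_iff:
  assumes "crit p"
  shows "p \<in> stratum \<beta> \<longleftrightarrow> (\<exists>k. orthogonal_matrix k \<and> mm p = k ** \<beta> ** transpose k)"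
proof -
  have "p \<in> stratum \<beta> \<longleftrightarrow> p \<in> critical_set \<beta>"
  proof
    assume "p \<in> stratum \<beta>"
    then obtain \<gamma> q where *: "neg_gradient_trajectory \<gamma>" "\<gamma> 0 = p" "q \<in> critical_set \<beta>"
      "(\<gamma> \<longlongrightarrow> q) at_top"
      unfolding stratum_def by blast
    have "(\<gamma> \<longlongrightarrow> p) at_top"
      using trajectory_constant [OF assms *(1,2)]
      by (intro tendsto_eventually) (auto simp: eventually_at_top_linorder)
    then show "p \<in> critical_set \<beta>"
      using tendsto_unique [OF trivial_limit_at_top_linorder \<open>(\<gamma> \<longlongrightarrow> p) at_top\<close> *(4)] *(3) by simp
  next
    assume "p \<in> critical_set \<beta>"
    moreover have "neg_gradient_trajectory (\<lambda>t. p)"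
      using assms GDERIV_mm [of p] grad_eq_0_iff [of p]
      unfolding neg_gradient_trajectory_def moment_norm_gl [abs_def]
      by (auto simp: crit_def intro!: exI [of _ 0])
    ultimately show "p \<in> stratum \<beta>"
      unfolding stratum_def by (auto intro!: exI [of _ "\<lambda>t. p"] exI [of _ p])
  qed
  then show ?thesis
    using assms by (simp add: critical_set_def critical_point_gl moment_map_gl)
qed

section \<open>Diagonal and triangular forms of matrices\<close>

definition dg :: "real^3 \<Rightarrow> real^3^3" where
  "dg v = (\<chi> i j. if i = j then v$i else 0)"

lemma dg_nth [simp]: "dg v $ i $ j = (if i = j then v$i else 0)"
  by (simp add: dg_def)

lemma transpose_dg [simp]: "transpose (dg v) = dg v"
  by (auto simp: transpose_def vec_eq_iff)

lemma dg_mult_vector: "(dg v *v u) $ i = v$i * u$i"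
  by (simp add: matrix_vector_mult_def if_distrib [of "\<lambda>x. x * _"] cong: if_cong)

lemma dg_mult_left: "(dg v ** A) $ i $ j = v$i * A$i$j"
  by (simp add: matrix_matrix_mult_def if_distrib [of "\<lambda>x. x * _"] cong: if_cong)

lemma dg_mult_right: "(A ** dg v) $ i $ j = A$i$j * v$j"
  by (simp add: matrix_matrix_mult_def if_distrib [of "\<lambda>x. _ * x"] cong: if_cong)

lemma det_dg: "det (dg v) = v$1 * v$2 * v$3"
  by (simp add: det_3)

lemma inner_dg: "dg v \<bullet> dg w = v \<bullet> w"
  by (simp add: inner_vec_def sum_3)

lemma dg_uminus: "dg (- v) = - dg v"
  by (simp add: vec_eq_iff)

definition plane_rotation :: "3 \<Rightarrow> 3 \<Rightarrow> real \<Rightarrow> real \<Rightarrow> real^3^3" where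
  "plane_rotation i j c s = (\<chi> a b. if a = i \<and> b = i \<or> a = j \<and> b = j then c
     else if a = i \<and> b = j then - s else if a = j \<and> b = i then s
     else if a = b then 1 else 0)"

lemma orthogonal_plane_rotation:
  assumes "i \<noteq> j" "c\<^sup>2 + s\<^sup>2 = 1"
  shows "orthogonal_matrix (plane_rotation i j c s)"
proof -
  have "c * c + s * s = 1" "s * s + c * c = 1"
    using assms(2) by (simp_all add: power2_eq_square)
  note unit = this
  show ?thesis
    unfolding orthogonal_matrix vec_eq_iff forall_3
    using exhaust_3 [of i] exhaust_3 [of j] assms(1)
    by (elim disjE) (simp_all add: plane_rotation_def matrix_matrix_mult_def transpose_def mat_def
        sum_3 unit)
qed

lemma compact_orthogonal_matrices: "compact {k :: real^3^3. orthogonal_matrix k}"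
proof -
  have "closed {k :: real^3^3. \<forall>i j. (\<Sum>l\<in>UNIV. k$l$i * k$l$j) = (if i = j then 1 else 0)}"
    by (intro closed_Collect_all closed_Collect_eq continuous_intros)
  moreover have "{k :: real^3^3. \<forall>i j. (\<Sum>l\<in>UNIV. k$l$i * k$l$j) = (if i = j then 1 else 0)}
      = {k. orthogonal_matrix k}"
    by (simp add: orthogonal_matrix vec_eq_iff matrix_matrix_mult_def transpose_def mat_def)
  moreover have "norm k = sqrt 3" if "orthogonal_matrix k" for k :: "real^3^3"
  proof -
    have "k \<bullet> k = 3"
      by (simp add: inner_matrix_eq_trace orthogonal_matrixD [OF that] trace_I)
    then show ?thesis
      by (simp add: norm_eq_sqrt_inner)
  qed
  then have "bounded {k :: real^3^3. orthogonal_matrix k}"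
    unfolding bounded_iff by (metis mem_Collect_eq order_refl)
  ultimately show ?thesis
    by (simp add: compact_eq_bounded_closed)
qed

text \<open>For small \<open>s\<close> the term \<open>2 c s B\<close> dominates, and its sign changes with that of \<open>s\<close>.\<close>

lemma quadratic_on_circle:
  fixes A B :: real
  assumes "\<And>c s. c\<^sup>2 + s\<^sup>2 = 1 \<Longrightarrow> s\<^sup>2 * A + 2 * c * s * B \<ge> 0"
  shows "B = 0"
proof (rule ccontr)
  assume "B \<noteq> 0"
  \<comment> \<open>The tangent of an angle so small that the quadratic term cannot compensate the linear one.\<close>
  define t where "t = - B / (\<bar>A\<bar> + 1)"
  define c where "c = 1 / sqrt (1 + t\<^sup>2)"
  have "1 + t\<^sup>2 > 0"
    by (simp add: add_pos_nonneg)
  then have c: "c\<^sup>2 = 1 / (1 + t\<^sup>2)"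
    by (simp add: c_def power_divide)
  have "c\<^sup>2 + (t * c)\<^sup>2 = (1 + t\<^sup>2) * c\<^sup>2"
    by (simp add: power_mult_distrib algebra_simps)
  then have "c\<^sup>2 + (t * c)\<^sup>2 = 1"
    using c \<open>1 + t\<^sup>2 > 0\<close> by simp
  from assms [OF this] have "c\<^sup>2 * (t * (t * A + 2 * B)) \<ge> 0"
    by (simp add: power2_eq_square algebra_simps)
  moreover have "c\<^sup>2 > 0"
    using c \<open>1 + t\<^sup>2 > 0\<close> by simp
  ultimately have "t * (t * A + 2 * B) \<ge> 0"
    by (simp add: zero_le_mult_iff)
  moreover have "t * (t * A + 2 * B) = - (B\<^sup>2 / (\<bar>A\<bar> + 1)) * (2 - A / (\<bar>A\<bar> + 1))"
    unfolding t_def by (simp add: field_simps power2_eq_square)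
  moreover have "B\<^sup>2 / (\<bar>A\<bar> + 1) > 0"
    using \<open>B \<noteq> 0\<close> by simp
  moreover have "A / (\<bar>A\<bar> + 1) \<le> 1"
    by (rule divide_le_eq_1_pos [THEN iffD2]) auto
  ultimately show False
    using mult_pos_pos [of "B\<^sup>2 / (\<bar>A\<bar> + 1)" "2 - A / (\<bar>A\<bar> + 1)"] by linarith
qed

text \<open>Maximise the pairing of \<open>k\<^sup>T S k\<close> with \<open>diag (1, 2, 3)\<close> over the compact orthogonal group. At a
  maximum, rotating in a coordinate plane cannot increase the pairing: by rotations of small angle
  the off-diagonal entries vanish, by quarter turns the diagonal is sorted.\<close>

theorem sorted_spectral:
  fixes S :: "real^3^3"
  assumes "transpose S = S"
  obtains k b where "orthogonal_matrix k" "transpose k ** S ** k = dg b" "b$1 \<le> b$2" "b$2 \<le> b$3"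
proof -
  \<comment> \<open>Any strictly increasing vector would do; it makes the maximiser sort the eigenvalues.\<close>
  define w :: "real^3" where "w = vector [1, 2, 3]"
  let ?f = "\<lambda>k. S \<bullet> (k ** dg w ** transpose k)"
  have "continuous_on UNIV ?f"
    unfolding inner_vec_def matrix_matrix_mult_def transpose_def vec_lambda_beta inner_real_def
    by (intro continuous_intros)
  then have "continuous_on {k. orthogonal_matrix k} ?f"
    by (rule continuous_on_subset) simp
  moreover have "{k :: real^3^3. orthogonal_matrix k} \<noteq> {}"
    using orthogonal_matrix_id by blast
  ultimately have "\<exists>k\<in>{k. orthogonal_matrix k}. \<forall>l\<in>{k. orthogonal_matrix k}. ?f l \<le> ?f k"
    by (intro continuous_attains_sup compact_orthogonal_matrices)
  then obtain k where k: "orthogonal_matrix k"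
    and max: "\<And>l. orthogonal_matrix l \<Longrightarrow> ?f l \<le> ?f k"
    by blast
  define T where "T = transpose k ** S ** k"
  have "transpose T = T"
    by (simp add: T_def matrix_transpose_mul assms matrix_mul_assoc)
  then have sym: "T$j$i = T$i$j" for i j
    unfolding vec_eq_iff by (simp add: transpose_def)
  have rot: "s\<^sup>2 * (T$j$j - T$i$i) + 2 * c * s * T$i$j \<ge> 0"
    if cs: "c\<^sup>2 + s\<^sup>2 = 1" and ij: "w$i < w$j" for c s i j
  proof -
    let ?R = "plane_rotation i j c s"
    have "i \<noteq> j"
      using ij by auto
    have R: "orthogonal_matrix ?R"
      using \<open>i \<noteq> j\<close> cs by (rule orthogonal_plane_rotation)
    have conj: "?f l = (transpose l ** S ** l) \<bullet> dg w" for l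
      by (simp add: inner_matrix_mult(2) [of "transpose l ** S"] inner_matrix_mult(1) [of "transpose l"]
          matrix_mul_assoc)
    have "?f (k ** ?R) = (transpose ?R ** T ** ?R) \<bullet> dg w"
      unfolding conj T_def by (simp add: matrix_transpose_mul matrix_mul_assoc)
    then have "(transpose ?R ** T ** ?R) \<bullet> dg w \<le> T \<bullet> dg w"
      using max [OF orthogonal_matrix_mul [OF k R]] unfolding conj T_def by simp
    moreover have "(transpose ?R ** T ** ?R) \<bullet> dg w
        = T \<bullet> dg w - (w$j - w$i) * (s\<^sup>2 * (T$j$j - T$i$i) + 2 * c * s * T$i$j)"
    proof -
      have diag: "(transpose ?R ** T ** ?R) $ a $ a = (if a = i then c\<^sup>2 * T$i$i + 2 * c * s * T$i$j + s\<^sup>2 * T$j$j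
          else if a = j then s\<^sup>2 * T$i$i - 2 * c * s * T$i$j + c\<^sup>2 * T$j$j else T$a$a)" for a
        using exhaust_3 [of a] exhaust_3 [of i] exhaust_3 [of j] \<open>i \<noteq> j\<close>
        by (elim disjE) (simp_all add: plane_rotation_def matrix_matrix_mult_def transpose_def sum_3
            sym [of 2 1] sym [of 3 1] sym [of 3 2] power2_eq_square algebra_simps)
      have tr: "M \<bullet> dg w = M$1$1 * w$1 + M$2$2 * w$2 + M$3$3 * w$3" for M :: "real^3^3"
        by (simp add: inner_vec_def sum_3)
      have c2: "c\<^sup>2 = 1 - s\<^sup>2"
        using cs by simp
      show ?thesis
        unfolding tr diag c2 using exhaust_3 [of i] exhaust_3 [of j] \<open>i \<noteq> j\<close>
        by (elim disjE) (simp_all add: algebra_simps sym [of 2 1] sym [of 3 1] sym [of 3 2])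
    qed
    ultimately show ?thesis
      using ij by (simp add: zero_le_mult_iff)
  qed
  have "T$i$j = 0" if "w$i < w$j" for i j
    using quadratic_on_circle [of "T$j$j - T$i$i" "T$i$j"] rot [OF _ that] by blast
  moreover have "T$i$i \<le> T$j$j" if "w$i < w$j" for i j
    using rot [of 0 1 i j] that by simp
  moreover have "w$1 < w$2" "w$1 < w$3" "w$2 < w$3"
    by (simp_all add: w_def vector_3)
  ultimately have off: "T$1$2 = 0" "T$1$3 = 0" "T$2$3 = 0" and le: "T$1$1 \<le> T$2$2" "T$2$2 \<le> T$3$3"
    by blast+
  show thesis
  proof (rule that [OF k, of "\<chi> i. T$i$i"])
    show "transpose k ** S ** k = dg (\<chi> i. T$i$i)"
      unfolding T_def [symmetric] using off
      by (simp add: vec_eq_iff forall_3 sym [of 2 1] sym [of 3 1] sym [of 3 2])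
  qed (use le in auto)
qed

text \<open>Three plane rotations from the left clear the entries above the diagonal: first \<open>(1,3)\<close>, then
  \<open>(2,3)\<close> without touching the first row, then \<open>(1,2)\<close>, which only mixes rows that already end in 0.\<close>

lemma QL_decomposition:
  fixes g :: "real^3^3"
  obtains k l where "orthogonal_matrix k" "g = k ** l" "l$1$2 = 0" "l$1$3 = 0" "l$2$3 = 0"
proof -
  have rotate: "\<exists>c s. c\<^sup>2 + s\<^sup>2 = 1 \<and> c * x + s * y = 0" for x y :: real
  proof (cases "x = 0 \<and> y = 0")
    case True
    then show ?thesis
      by (intro exI [of _ 1] exI [of _ 0]) simp
  next
    case False
    then have "x\<^sup>2 + y\<^sup>2 > 0"
      by (simp add: sum_power2_gt_zero_iff)
    then have "(y / sqrt (x\<^sup>2 + y\<^sup>2))\<^sup>2 + (- x / sqrt (x\<^sup>2 + y\<^sup>2))\<^sup>2 = 1"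
      using False by (auto simp: power_divide add.commute simp flip: add_divide_distrib)
    then show ?thesis
      by (intro exI [of _ "y / sqrt (x\<^sup>2 + y\<^sup>2)"] exI [of _ "- x / sqrt (x\<^sup>2 + y\<^sup>2)"]) simp
  qed
  have step: "\<exists>R. orthogonal_matrix R \<and> (R ** h)$i$m = 0 \<and> (\<forall>a b. a \<noteq> i \<longrightarrow> a \<noteq> j \<longrightarrow> (R ** h)$a$b = h$a$b)
      \<and> (\<forall>b. h$i$b = 0 \<longrightarrow> h$j$b = 0 \<longrightarrow> (R ** h)$i$b = 0 \<and> (R ** h)$j$b = 0)"
    if "i \<noteq> j" for i j m :: 3 and h :: "real^3^3"
  proof -
    obtain c s where cs: "c\<^sup>2 + s\<^sup>2 = 1" "c * h$i$m + s * h$j$m = 0"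
      using rotate by blast
    have "orthogonal_matrix (plane_rotation i j c (- s))"
      using that cs by (intro orthogonal_plane_rotation) auto
    moreover have "(plane_rotation i j c (- s) ** h)$a$b = (if a = i then c * h$i$b + s * h$j$b
        else if a = j then c * h$j$b - s * h$i$b else h$a$b)" for a b
      using exhaust_3 [of a] exhaust_3 [of i] exhaust_3 [of j] \<open>i \<noteq> j\<close>
      by (elim disjE) (simp_all add: plane_rotation_def matrix_matrix_mult_def sum_3)
    ultimately show ?thesis
      using cs that by (intro exI [of _ "plane_rotation i j c (- s)"]) auto
  qed
  obtain R1 where R1: "orthogonal_matrix R1" "(R1 ** g)$1$3 = 0"
    using step [of 1 2 g 3] by auto
  obtain R2 where R2: "orthogonal_matrix R2" "(R2 ** (R1 ** g))$2$3 = 0"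
    "\<forall>b. (R2 ** (R1 ** g))$1$b = (R1 ** g)$1$b"
    using step [of 2 3 "R1 ** g" 3] by auto
  obtain R3 where R3: "orthogonal_matrix R3" "(R3 ** (R2 ** (R1 ** g)))$1$2 = 0"
    "\<forall>b. (R2 ** (R1 ** g))$1$b = 0 \<longrightarrow> (R2 ** (R1 ** g))$2$b = 0 \<longrightarrow>
      (R3 ** (R2 ** (R1 ** g)))$1$b = 0 \<and> (R3 ** (R2 ** (R1 ** g)))$2$b = 0"
    using step [of 1 2 "R2 ** (R1 ** g)" 2] by auto
  define K where "K = R3 ** (R2 ** R1)"
  have K: "orthogonal_matrix K"
    using R1 R2 R3 by (simp add: K_def orthogonal_matrix_mul)
  show thesis
  proof (rule that [of "transpose K" "K ** g"])
    show "g = transpose K ** (K ** g)"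
      by (simp add: matrix_mul_assoc orthogonal_matrixD [OF K])
  qed (use K R1 R2 R3 in \<open>auto simp: K_def matrix_mul_assoc\<close>)
qed

section \<open>Quartics with diagonal moment matrix\<close>

definition pw :: "real^3 \<Rightarrow> nat \<times> nat \<times> nat \<Rightarrow> real" where
  "pw u d = (u$1) ^ expo d 1 * (u$2) ^ expo d 2 * (u$3) ^ expo d 3"

definition bdot :: "real^3 \<Rightarrow> nat \<times> nat \<times> nat \<Rightarrow> real" where
  "bdot b d = b$1 * expo d 1 + b$2 * expo d 2 + b$3 * expo d 3"

text \<open>The squared norm of the term of \<open>p\<close> with exponent \<open>d\<close>.\<close>

definition mass :: "quartic \<Rightarrow> nat \<times> nat \<times> nat \<Rightarrow> real" where
  "mass p d = fact (expo d 1) * fact (expo d 2) * fact (expo d 3) * (coeff p d)\<^sup>2"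

lemma mass_nonneg: "mass p d \<ge> 0"
  by (simp add: mass_def)

lemma mass_eq_0_iff: "mass p d = 0 \<longleftrightarrow> coeff p d = 0"
  by (simp add: mass_def)

lemma sum_mass: "(\<Sum>d\<in>expos 4. mass p d) = (norm p)\<^sup>2"
  unfolding power2_norm_eq_inner inner_quartic_def
  by (rule sum.cong) (auto simp: mass_def power2_eq_square)

lemma eval_eq_sum_pw: "eval p u = (\<Sum>d\<in>expos 4. coeff p d * pw u d)"
  unfolding eval_def by (rule sum.cong) (auto simp: pw_def)

lemma coeff_eq_if_eval:
  assumes "\<And>u. eval p u = (\<Sum>d\<in>expos 4. c d * pw u d)" "d \<in> expos 4"
  shows "coeff p d = c d"
proof -
  define q where "q = Quartic (\<lambda>d. if d \<in> expos 4 then c d else 0)"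
  have q: "coeff q d = (if d \<in> expos 4 then c d else 0)" for d
    unfolding q_def by (subst Quartic_inverse) auto
  have "p = q"
    by (rule quartic_eq_evalI) (auto simp: assms(1) eval_eq_sum_pw [of q] q intro!: sum.cong)
  then show ?thesis
    using q assms(2) by simp
qed

lemma coeff_pullback_dg: "coeff (pullback (dg v) p) d = pw v d * coeff p d"
proof (cases "d \<in> expos 4")
  case True
  have "pw (dg v *v u) d = pw v d * pw u d" for u d
    by (simp add: pw_def dg_mult_vector power_mult_distrib)
  then have "eval (pullback (dg v) p) u = (\<Sum>d\<in>expos 4. (pw v d * coeff p d) * pw u d)" for u
    unfolding eval_pullback eval_eq_sum_pw [of p] by (simp add: mult_ac)
  then show ?thesis
    by (rule coeff_eq_if_eval) (rule True)
qed simp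

lemma coeff_lie_dg: "coeff (lie (dg b) p) d = bdot b d * coeff p d"
proof (cases "d \<in> expos 4")
  case True
  show ?thesis
    by (simp add: lie_def coeff_sum coeff_pol_diag [OF True] sum_3 bdot_def algebra_simps)
qed simp

lemma bdot_uminus: "bdot (- v) d = - bdot v d"
  by (simp add: bdot_def)

lemma expo_sum:
  assumes "d \<in> expos 4"
  shows "real (expo d 1) + real (expo d 2) + real (expo d 3) = 4"
proof -
  have "expo d 1 + expo d 2 + expo d 3 = 4"
    using assms by (auto simp: expos_def)
  then show ?thesis
    by linarith
qed

text \<open>The trace of the moment matrix is \<open>-4\<close>.\<close>

lemma sum_type_eq_4:
  assumes "mm p = - dg b" "p \<noteq> 0"
  shows "b$1 + b$2 + b$3 = 4"
proof -
  have "dg (\<chi> i. 1) = mat 1"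
    by (simp add: vec_eq_iff mat_def)
  then have "mm p \<bullet> dg (\<chi> i. 1) = - 4"
    using inner_mm_mat_1 [OF assms(2)] by simp
  then show ?thesis
    by (simp add: assms inner_dg inner_vec_def sum_3)
qed

text \<open>Diagonal matrices act diagonally on monomials. So the diagonal of \<open>- mm p\<close> is the mean of the
  exponents of \<open>p\<close>, weighted by the masses.\<close>

lemma inner_mm_dg: "mm p \<bullet> dg b = - (\<Sum>d\<in>expos 4. bdot b d * mass p d) / (norm p)\<^sup>2"
proof -
  have "lie (dg b) p \<bullet> p = (\<Sum>d\<in>expos 4. bdot b d * mass p d)"
    unfolding inner_quartic_def
    by (rule sum.cong) (auto simp: coeff_lie_dg mass_def power2_eq_square)
  then show ?thesis
    by (simp add: inner_mm)
qed

text \<open>A diagonal matrix multiplies each monomial by its pairing with the exponent, so the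
  eigenvector equation says that all exponents of \<open>p\<close> have the same pairing with \<open>b\<close>.\<close>

lemma crit_iff_support:
  assumes "mm p = - dg b"
  shows "crit p \<longleftrightarrow> p \<noteq> 0 \<and> (\<forall>d. coeff p d \<noteq> 0 \<longrightarrow> bdot b d = b \<bullet> b)"
proof -
  have "lie (mm p) p = - (mm p \<bullet> mm p) *\<^sub>R p \<longleftrightarrow> (\<forall>d. bdot b d * coeff p d = (b \<bullet> b) * coeff p d)"
  proof -
    have "lie (mm p) p = lie (dg (- b)) p" "mm p \<bullet> mm p = b \<bullet> b"
      by (simp_all add: assms dg_uminus inner_dg)
    then have "lie (mm p) p = - (mm p \<bullet> mm p) *\<^sub>R p
        \<longleftrightarrow> (\<forall>d. coeff (lie (dg (- b)) p) d = coeff (- (b \<bullet> b) *\<^sub>R p) d)"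
      by (metis quartic_eqI)
    then show ?thesis
      by (simp add: coeff_lie_dg bdot_uminus del: scaleR_minus_left)
  qed
  then show ?thesis
    by (auto simp: crit_def)
qed

lemma pullback_one_parameter:
  assumes supp: "\<And>d. coeff p d \<noteq> 0 \<Longrightarrow> bdot b d = c"
  shows "pullback (dg (\<chi> i. exp (s * b$i))) p = exp (s * c) *\<^sub>R p"
proof (rule quartic_eqI)
  fix d assume "d \<in> expos 4"
  have "pw (\<chi> i. exp (s * b$i)) d = exp (s * bdot b d)"
    by (simp add: pw_def bdot_def exp_add [symmetric] exp_of_nat_mult [symmetric] algebra_simps)
  then show "coeff (pullback (dg (\<chi> i. exp (s * b$i))) p) d = coeff (exp (s * c) *\<^sub>R p) d"
    using supp [of d] by (cases "coeff p d = 0") (auto simp: coeff_pullback_dg)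
qed

section \<open>Orbits and the null cone\<close>

lemma det_eq_1_invertible:
  fixes g :: "real^3^3"
  assumes "det g = 1"
  obtains h where "det h = 1" "h ** g = mat 1" "g ** h = mat 1" "matrix_inv g = h"
proof -
  obtain h where h: "g ** h = mat 1"
    using invertible_det_nz [of g] assms unfolding invertible_right_inverse by auto
  then have "h ** g = mat 1"
    using matrix_left_right_inverse by blast
  moreover have "det h = 1"
    using det_mul [of g h] h assms by simp
  ultimately show thesis
    using that h matrix_inv_unique [OF h] by blast
qed

lemma orbit_eq_pullback: "orbit p = {pullback A p |A. det A = 1}"
proof -
  have "q \<in> orbit p" if A: "det A = 1" "q = pullback A p" for q A
  proof -
    obtain B where "det B = 1" "matrix_inv B = A"
      using det_eq_1_invertible [OF A(1)] matrix_inv_unique by metis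
    then show ?thesis
      using A unfolding orbit_def act_eq_pullback by blast
  qed
  moreover have "\<exists>A. det A = 1 \<and> q = pullback A p" if "q \<in> orbit p" for q
    using that det_eq_1_invertible unfolding orbit_def act_eq_pullback by blast
  ultimately show ?thesis
    by blast
qed

lemma orbit_self: "p \<in> orbit p"
  unfolding orbit_eq_pullback by (intro CollectI exI [of _ "mat 1"]) simp

lemma orbit_eqI:
  assumes "q \<in> orbit p"
  shows "orbit q = orbit p"
proof -
  obtain A where A: "det A = 1" "q = pullback A p"
    using assms by (auto simp: orbit_eq_pullback)
  obtain B where B: "det B = 1" "A ** B = mat 1"
    using det_eq_1_invertible [OF A(1)] by blast
  have "p = pullback B q"
    by (simp add: A pullback_pullback B)
  have "pullback C q \<in> orbit p" if "det C = 1" for C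
    using that A by (auto simp: orbit_eq_pullback pullback_pullback det_mul)
  moreover have "pullback C p \<in> orbit q" if "det C = 1" for C
    unfolding \<open>p = pullback B q\<close> using that B by (auto simp: orbit_eq_pullback pullback_pullback det_mul)
  ultimately show ?thesis
    by (auto simp: orbit_eq_pullback)
qed

lemma orbit_eq_iff: "orbit p = orbit q \<longleftrightarrow> p \<in> orbit q"
  using orbit_eqI orbit_self by blast

lemma pullback_in_orbit: "det A = 1 \<Longrightarrow> pullback A p \<in> orbit p"
  by (auto simp: orbit_eq_pullback)

text \<open>An orthogonal matrix of determinant \<open>-1\<close> may be replaced by its negative, because quartics are
  even functions.\<close>

lemma orbit_pullback_orthogonal:
  assumes "orthogonal_matrix k"
  shows "pullback k p \<in> orbit p"
proof -
  have "pullback (- k) p = pullback k p"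
  proof (rule quartic_eq_evalI)
    fix u
    have "pw (- v) d = pw v d" if "d \<in> expos 4" for v d
      using that unfolding expos_4 by (auto simp: pw_def)
    then have "eval p (- v) = eval p v" for v
      unfolding eval_eq_sum_pw by simp
    moreover have "- k *v u = - (k *v u)"
      by (simp add: matrix_vector_mult_def vec_eq_iff sum_negf)
    ultimately show "eval (pullback (- k) p) u = eval (pullback k p) u"
      by simp
  qed
  moreover have "det (- k) = - det k"
    by (simp add: det_3)
  moreover have "det k = 1 \<or> det k = - 1"
    using det_orthogonal_matrix [OF assms] .
  ultimately show ?thesis
    using pullback_in_orbit [of k p] pullback_in_orbit [of "- k" p] by auto
qed

text \<open>Subtracting \<open>4/3\<close> from the entries of \<open>b\<close> gives a one-parameter group of determinant 1 that
  still has a single eigenvalue on \<open>p\<close>, namely \<open>|b|^2 - 16/3\<close>, which is not 0.\<close>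

lemma orbit_scaleR:
  assumes "mm p = - dg b" "crit p" "b \<bullet> b > 16/3" "c > 0"
  shows "c *\<^sub>R p \<in> orbit p"
proof -
  have p: "p \<noteq> 0"
    using assms by (simp add: crit_def)
  have b: "b$1 + b$2 + b$3 = 4"
    using assms(1) p by (rule sum_type_eq_4)
  \<comment> \<open>The traceless part of the type, which generates matrices of determinant 1.\<close>
  define b' where "b' = b - (\<chi> i. 4/3)"
  have "bdot b' d = b \<bullet> b - 16/3" if "coeff p d \<noteq> 0" for d
  proof -
    have "d \<in> expos 4"
      using that coeff_outside by blast
    from expo_sum [OF this] have "bdot b' d = bdot b d - 16/3"
      unfolding bdot_def b'_def by (simp add: algebra_simps)
    moreover have "bdot b d = b \<bullet> b"
      using crit_iff_support [OF assms(1)] assms(2) that by blast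
    ultimately show ?thesis
      by simp
  qed
  note * = pullback_one_parameter [of p b' "b \<bullet> b - 16/3", OF this]
  define s where "s = ln c / (b \<bullet> b - 16/3)"
  have "pullback (dg (\<chi> i. exp (s * b'$i))) p = c *\<^sub>R p"
  proof -
    have "s * (b \<bullet> b - 16/3) = ln c"
      using assms(3) by (simp add: s_def)
    then show ?thesis
      using * [of s] assms(4) by simp
  qed
  moreover have "det (dg (\<chi> i. exp (s * b'$i))) = 1"
  proof -
    have "s * b'$1 + s * b'$2 + s * b'$3 = s * (b$1 + b$2 + b$3 - 4)"
      by (simp add: b'_def algebra_simps)
    then show ?thesis
      by (simp add: det_dg b exp_add [symmetric])
  qed
  ultimately show ?thesis
    using pullback_in_orbit by metis
qed

lemma in_null_cone:
  assumes "mm p = - dg b" "crit p" "b \<bullet> b > 16/3"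
  shows "p \<in> null_cone"
proof -
  have "(\<lambda>n. inverse (real (Suc n)) *\<^sub>R p) \<longlonglongrightarrow> 0 *\<^sub>R p"
    by (intro tendsto_scaleR tendsto_const LIMSEQ_inverse_real_of_nat)
  moreover have "inverse (real (Suc n)) *\<^sub>R p \<in> orbit p" for n
    using assms by (intro orbit_scaleR) auto
  ultimately have "0 \<in> closure (orbit p)"
    unfolding closure_sequential by (intro exI [of _ "\<lambda>n. inverse (real (Suc n)) *\<^sub>R p"]) simp
  then show ?thesis
    by (simp add: null_cone_def)
qed

lemma null_cone_orbit: "q \<in> orbit p \<Longrightarrow> q \<in> null_cone \<longleftrightarrow> p \<in> null_cone"
  by (simp add: null_cone_def orbit_eqI)

section \<open>Shortest vectors in an orbit\<close>

text \<open>The argument of Kempf and Ness. By the spectral theorem for \<open>A A\<^sup>T\<close> and rotation of \<open>p\<close>, the claim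
  concerns a diagonal matrix with entries \<open>exp l\<^sub>i\<close>, \<open>l\<^sub>1 + l\<^sub>2 + l\<^sub>3 = 0\<close>, which multiplies the mass at \<open>d\<close>
  by \<open>exp (l \<bullet> d) \<ge> 1 + l \<bullet> d\<close>. The linear terms add up to a multiple of \<open>mm p \<bullet> diag l\<close>, which vanishes because
  \<open>mm p\<close> is scalar.\<close>

lemma norm_le_norm_pullback:
  assumes mm: "mm p = - (4/3) *\<^sub>R mat 1" and A: "det A = 1"
  shows "norm p \<le> norm (pullback A p)"
proof -
  define S where "S = A ** transpose A"
  have "transpose S = S"
    by (simp add: S_def matrix_transpose_mul)
  then obtain k b where k: "orthogonal_matrix k" and S: "transpose k ** S ** k = dg b"
    by (rule sorted_spectral)
  define q where "q = pullback k p"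
  have "pullback A p \<bullet> pullback A p = p \<bullet> pullback S p"
    by (simp add: inner_pullback pullback_pullback S_def)
  also have "S = k ** (dg b ** transpose k)"
    unfolding S [symmetric]
    by (metis S k matrix_mul_assoc matrix_mul_lid matrix_mul_rid orthogonal_matrixD(2))
  then have "p \<bullet> pullback S p = q \<bullet> pullback (dg b) q"
    by (simp add: q_def inner_pullback flip: pullback_pullback)
  also have "\<dots> = (\<Sum>d\<in>expos 4. pw b d * mass q d)"
    unfolding inner_quartic_def
    by (rule sum.cong) (auto simp: coeff_pullback_dg mass_def power2_eq_square)
  finally have lhs: "(norm (pullback A p))\<^sup>2 = (\<Sum>d\<in>expos 4. pw b d * mass q d)"
    by (simp add: power2_norm_eq_inner)
  have nonneg: "b$i \<ge> 0" for i
  proof -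
    define M where "M = transpose A ** k"
    have "dg b = transpose M ** M"
      by (simp add: S [symmetric] S_def M_def matrix_transpose_mul matrix_mul_assoc)
    moreover have "dg b $ i $ i = b$i"
      by simp
    ultimately have "b$i = (transpose M ** M) $ i $ i"
      by simp
    also have "\<dots> = (\<Sum>l\<in>UNIV. M$l$i * M$l$i)"
      by (simp add: matrix_matrix_mult_def transpose_def)
    finally show ?thesis
      by (simp add: sum_nonneg)
  qed
  have prod: "b$1 * b$2 * b$3 = 1"
  proof -
    have "det (dg b) = (det k)\<^sup>2"
      by (simp add: S [symmetric] S_def det_mul A power2_eq_square)
    then show ?thesis
      using det_orthogonal_matrix [OF k] by (auto simp: det_dg)
  qed
  then have "b$1 \<noteq> 0" "b$2 \<noteq> 0" "b$3 \<noteq> 0"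
    by auto
  then have "b$1 > 0" "b$2 > 0" "b$3 > 0"
    using nonneg by (simp_all add: less_le)
  define l :: "real^3" where "l = (\<chi> i. ln (b$i))"
  have "ln (b$1) + ln (b$2) + ln (b$3) = 0"
    using ln_mult [of "b$1 * b$2" "b$3"] ln_mult [of "b$1" "b$2"]
      \<open>b$1 > 0\<close> \<open>b$2 > 0\<close> \<open>b$3 > 0\<close> prod by simp
  have pw: "pw b d \<ge> 1 + bdot l d" for d
  proof -
    have "pw b d = exp (bdot l d)"
      using \<open>b$1 > 0\<close> \<open>b$2 > 0\<close> \<open>b$3 > 0\<close>
      by (simp add: pw_def bdot_def l_def exp_add exp_of_nat2_mult)
    then show ?thesis
      by (simp add: exp_ge_add_one_self)
  qed
  show ?thesis
  proof (cases "p = 0")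
    case False
    have nq: "norm q = norm p"
      by (simp add: q_def norm_pullback_orthogonal k)
    have "transpose k ** (c *\<^sub>R mat 1) ** k = c *\<^sub>R mat 1" for c :: real
      by (simp add: matrix_scalar_ac scalar_matrix_assoc [symmetric] orthogonal_matrixD [OF k])
    then have "mm q = - (4/3) *\<^sub>R mat 1"
      unfolding q_def mm_pullback [OF k] mm .
    then have "mm q \<bullet> dg l = 0"
      using \<open>ln (b$1) + ln (b$2) + ln (b$3) = 0\<close>
      by (simp add: inner_vec_def sum_3 mat_def l_def)
    then have "(\<Sum>d\<in>expos 4. bdot l d * mass q d) = 0"
      using False nq by (simp add: inner_mm_dg)
    then have "(norm p)\<^sup>2 = (\<Sum>d\<in>expos 4. (1 + bdot l d) * mass q d)"
      by (simp add: distrib_right sum.distrib sum_mass nq)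
    also have "\<dots> \<le> (norm (pullback A p))\<^sup>2"
      unfolding lhs by (intro sum_mono mult_right_mono pw mass_nonneg)
    finally show ?thesis
      by (rule power2_le_imp_le) simp
  qed simp
qed

lemma minimal_not_in_null_cone:
  assumes "mm p = - (4/3) *\<^sub>R mat 1" "p \<noteq> 0"
  shows "p \<notin> null_cone"
proof
  assume "p \<in> null_cone"
  then obtain q where "q \<in> orbit p" "dist q 0 < norm p"
    using assms(2) unfolding null_cone_def mem_Collect_eq closure_approachable
    by (meson zero_less_norm_iff)
  then show False
    using norm_le_norm_pullback [OF assms(1)] by (force simp: orbit_eq_pullback)
qed

section \<open>Initial forms and the moment norm along an orbit\<close>

lemma tendsto_coeffI:
  assumes "\<And>v. ((\<lambda>x. eval (f x) v) \<longlongrightarrow> eval l v) F"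
  shows "((\<lambda>x. coeff (f x) d) \<longlongrightarrow> coeff l d) F"
proof (cases "d \<in> expos 4")
  case True
  have "((\<lambda>x. f x \<bullet> q) \<longlongrightarrow> l \<bullet> q) F" for q
  proof (induction q rule: lin4_induct)
    case 1
    then show ?case
      by (auto simp: subspace_def inner_right_distrib intro!: tendsto_add tendsto_mult_left)
  next
    case (2 v)
    then show ?case
      using tendsto_mult_left [OF assms [of v], of 24] by (simp add: inner_lin4)
  qed
  from this [of "(1 / (fact (expo d 1) * fact (expo d 2) * fact (expo d 3))) *\<^sub>R monom d"]
  show ?thesis
    using True by (cases d) (simp add: monom_def inner_mon)
qed simp

lemma tendsto_coeff_pullback:
  assumes "(A \<longlongrightarrow> B) F"
  shows "((\<lambda>x. coeff (pullback (A x) p) d) \<longlongrightarrow> coeff (pullback B p) d) F"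
proof (rule tendsto_coeffI)
  fix v
  have "isCont (eval p) (B *v v)"
    using has_derivative_continuous [OF has_derivative_eval] .
  moreover have "((\<lambda>x. A x *v v) \<longlongrightarrow> B *v v) F"
    using assms by (rule bounded_linear.tendsto [OF bounded_linear_matrix_vector])
  ultimately show "((\<lambda>x. eval (pullback (A x) p) v) \<longlongrightarrow> eval (pullback B p) v) F"
    unfolding eval_pullback by (rule isCont_tendsto_compose)
qed

lemma tendsto_exp_neg:
  fixes x :: real
  assumes "x > 0"
  shows "((\<lambda>t. exp (- (x * t))) \<longlongrightarrow> 0) at_top"
proof -
  have "filterlim (\<lambda>t. x * t) at_top at_top"
    using assms by (intro filterlim_tendsto_pos_mult_at_top [OF tendsto_const] filterlim_ident)
  then show ?thesis
    by (intro filterlim_compose [OF exp_at_bot]) (simp add: filterlim_uminus_at_bot)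
qed

text \<open>Conjugating \<open>h\<close> by \<open>diag (exp (t b))\<close> scales the entry \<open>(i, j)\<close> by \<open>exp (- (b\<^sub>j - b\<^sub>i) t)\<close>. For upper
  triangular \<open>h\<close> and increasing \<open>b\<close> the limit keeps exactly the entries with \<open>b\<^sub>i = b\<^sub>j\<close>.\<close>

lemma initial_form_limit:
  assumes supp: "\<And>d. coeff p d \<noteq> 0 \<Longrightarrow> bdot b d = c"
    and tri: "h$2$1 = 0" "h$3$1 = 0" "h$3$2 = 0" and sorted: "b$1 \<le> b$2" "b$2 \<le> b$3"
  shows "((\<lambda>t. exp (- ((bdot b d - c) * t)) * coeff (pullback h p) d) \<longlongrightarrow>
    coeff (pullback (\<chi> i j. if b$i = b$j then h$i$j else 0) p) d) at_top"
proof -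
  let ?D = "\<lambda>t. dg (\<chi> i. exp (t * b$i))"
  have eq: "exp (- ((bdot b d - c) * t)) * coeff (pullback h p) d
      = coeff (pullback (?D t ** h ** ?D (- t)) p) d" for t
  proof -
    have D: "coeff (pullback (?D (- t)) q) d = exp (- t * bdot b d) * coeff q d" for q
      by (simp add: coeff_pullback_dg pw_def bdot_def exp_add [symmetric] exp_of_nat_mult [symmetric]
          algebra_simps)
    have "pullback (?D t ** h ** ?D (- t)) p = pullback (?D (- t)) (pullback h (pullback (?D t) p))"
      by (simp add: pullback_pullback matrix_mul_assoc)
    also have "pullback (?D t) p = exp (t * c) *\<^sub>R p"
      using supp by (rule pullback_one_parameter)
    finally have "coeff (pullback (?D t ** h ** ?D (- t)) p) d
        = exp (t * c) * (exp (- t * bdot b d) * coeff (pullback h p) d)"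
      by (simp only: linear_scale [OF linear_pullback] coeff_ops D)
    also have "\<dots> = exp (- ((bdot b d - c) * t)) * coeff (pullback h p) d"
    proof -
      have "exp (t * c) * exp (- t * bdot b d) = exp (- ((bdot b d - c) * t))"
        by (simp add: exp_add [symmetric] algebra_simps)
      then show ?thesis
        by (simp only: mult.assoc [symmetric])
    qed
    finally show ?thesis
      by simp
  qed
  have lim: "((\<lambda>t. ?D t ** h ** ?D (- t)) \<longlongrightarrow> (\<chi> i j. if b$i = b$j then h$i$j else 0)) at_top"
  proof (intro vec_tendstoI)
    fix i j
    have entry: "(?D t ** h ** ?D (- t)) $ i $ j = exp (- ((b$j - b$i) * t)) * h$i$j" for t
    proof -
      have "exp (- ((b$j - b$i) * t)) = exp (t * b$i) * exp (- t * b$j)"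
        by (simp add: exp_add [symmetric] algebra_simps)
      then show ?thesis
        unfolding dg_mult_left dg_mult_right vec_lambda_beta by simp
    qed
    have "b$i \<le> b$j \<or> h$i$j = 0"
      using tri sorted exhaust_3 [of i] exhaust_3 [of j] by auto
    then consider "h$i$j = 0" | "b$i = b$j" | "b$i < b$j"
      by linarith
    then show "((\<lambda>t. (?D t ** h ** ?D (- t)) $ i $ j) \<longlongrightarrow>
        (\<chi> i j. if b$i = b$j then h$i$j else 0) $ i $ j) at_top"
      unfolding entry
    proof cases
      case 3
      then have "((\<lambda>t. exp (- ((b$j - b$i) * t)) * h$i$j) \<longlongrightarrow> 0 * h$i$j) at_top"
        by (intro tendsto_mult tendsto_const tendsto_exp_neg) simp
      then show "((\<lambda>t. exp (- ((b$j - b$i) * t)) * h$i$j) \<longlongrightarrow>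
          (\<chi> i j. if b$i = b$j then h$i$j else 0) $ i $ j) at_top"
        using 3 by simp
    qed auto
  qed
  show ?thesis
    unfolding eq by (rule tendsto_coeff_pullback [OF lim])
qed

text \<open>By the limit above, coefficients of weight below \<open>c\<close> must vanish, as they would be multiplied by
  growing exponentials; those of weight \<open>c\<close> are constant in \<open>t\<close>, and those of larger weight tend to 0.\<close>

lemma initial_form:
  assumes supp: "\<And>d. coeff p d \<noteq> 0 \<Longrightarrow> bdot b d = c"
    and tri: "h$2$1 = 0" "h$3$1 = 0" "h$3$2 = 0" and sorted: "b$1 \<le> b$2" "b$2 \<le> b$3"
  shows "coeff (pullback h p) d \<noteq> 0 \<Longrightarrow> c \<le> bdot b d"
    and "coeff (pullback (\<chi> i j. if b$i = b$j then h$i$j else 0) p) d =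
      (if bdot b d = c then coeff (pullback h p) d else 0)"
proof -
  note lim = initial_form_limit [of p b c h d, OF assms]
  have small: "coeff (pullback h p) d = 0" if "bdot b d < c"
  proof -
    have "((\<lambda>t. exp (- ((c - bdot b d) * t)) * (exp (- ((bdot b d - c) * t)) * coeff (pullback h p) d))
      \<longlongrightarrow> 0 * coeff (pullback (\<chi> i j. if b$i = b$j then h$i$j else 0) p) d) at_top"
      using that by (intro tendsto_mult lim tendsto_exp_neg) simp
    moreover have "exp (- ((c - bdot b d) * t)) * (exp (- ((bdot b d - c) * t)) * x) = x" for t x
    proof -
      have "exp (- ((c - bdot b d) * t)) * exp (- ((bdot b d - c) * t)) = 1"
        by (simp add: exp_add [symmetric] algebra_simps)
      then show ?thesis
        by (simp flip: mult.assoc)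
    qed
    ultimately show ?thesis
      by (simp add: tendsto_const_iff)
  qed
  then show "coeff (pullback h p) d \<noteq> 0 \<Longrightarrow> c \<le> bdot b d"
    by force
  consider "bdot b d < c" | "bdot b d = c" | "bdot b d > c"
    by linarith
  then show "coeff (pullback (\<chi> i j. if b$i = b$j then h$i$j else 0) p) d =
      (if bdot b d = c then coeff (pullback h p) d else 0)"
  proof cases
    case 1
    then show ?thesis
      using lim small by (simp add: tendsto_const_iff)
  next
    case 2
    then show ?thesis
      using lim by (simp add: tendsto_const_iff)
  next
    case 3
    then have "((\<lambda>t. exp (- ((bdot b d - c) * t)) * coeff (pullback h p) d)
        \<longlongrightarrow> 0 * coeff (pullback h p) d) at_top"
      by (intro tendsto_mult tendsto_const tendsto_exp_neg) simp
    then show ?thesis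
      using tendsto_unique [OF trivial_limit_at_top_linorder lim] 3 by simp
  qed
qed

lemma matrix_mult_uminus:
  fixes A B :: "real^3^3"
  shows "(- A) ** B = - (A ** B)" "A ** (- B) = - (A ** B)"
  by (simp_all add: vec_eq_iff matrix_matrix_mult_def sum_negf)

text \<open>Write the substitution as an upper triangular matrix \<open>h\<close> followed by a rotation. By
  \<open>initial_form\<close>, the triangular part only produces weights at least \<open>|b|^2\<close>, so the pairing of \<open>- m\<close> with
  \<open>diag b\<close> is at least \<open>|b|^2\<close>, where \<open>m\<close> is the moment matrix of \<open>pullback h p\<close>. Then \<open>|m| \<ge> |b|\<close>, and equality
  forces \<open>m = - diag b\<close> and excludes weights above \<open>|b|^2\<close>, so that only the initial form is left.\<close>

lemma moment_norm_minimal_on_orbit: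
  assumes p: "p \<noteq> 0" and supp: "\<And>d. coeff p d \<noteq> 0 \<Longrightarrow> bdot b d = b \<bullet> b"
    and sorted: "b$1 \<le> b$2" "b$2 \<le> b$3" and q: "q \<in> orbit p"
  shows "b \<bullet> b \<le> mm q \<bullet> mm q"
    and "mm q \<bullet> mm q = b \<bullet> b \<Longrightarrow> \<exists>k h. orthogonal_matrix k \<and> mm q = - (transpose k ** dg b ** k)
      \<and> q = pullback k (pullback (\<chi> i j. if b$i = b$j then h$i$j else 0) p)"
proof -
  obtain A where A: "det A = 1" "q = pullback A p"
    using q by (auto simp: orbit_eq_pullback)
  have "q \<noteq> 0"
  proof
    obtain B where B: "A ** B = mat 1"
      using det_eq_1_invertible [OF A(1)] by blast
    have "p = pullback B q"
      by (simp add: A pullback_pullback B)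
    also assume "q = 0"
    finally show False
      using p by (simp add: linear_0 [OF linear_pullback])
  qed
  obtain k' l where kl: "orthogonal_matrix k'" "transpose A = k' ** l"
    "l$1$2 = 0" "l$1$3 = 0" "l$2$3 = 0"
    by (rule QL_decomposition)
  define k h where "k = transpose k'" and "h = transpose l"
  have k: "orthogonal_matrix k"
    by (simp add: k_def kl)
  have h: "h$2$1 = 0" "h$3$1 = 0" "h$3$2 = 0"
    using kl by (simp_all add: h_def transpose_def)
  define r where "r = pullback h p"
  have "A = h ** k"
    unfolding k_def h_def using kl(2) by (metis matrix_transpose_mul transpose_transpose)
  then have qr: "q = pullback k r"
    by (simp add: A r_def pullback_pullback)
  then have "r \<noteq> 0"
    using \<open>q \<noteq> 0\<close> by (auto simp: linear_0 [OF linear_pullback])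
  have mmq: "mm q = transpose k ** mm r ** k"
    unfolding qr by (rule mm_pullback [OF k])
  have "mm q \<bullet> mm q = mm r \<bullet> mm r"
    unfolding mmq by (rule norm_conj [OF k])
  have ge: "(b \<bullet> b) * mass r d \<le> bdot b d * mass r d" for d
    using initial_form(1) [of p b "b \<bullet> b" h d, OF supp h sorted] mass_nonneg [of r d] mass_eq_0_iff [of r d]
    by (cases "coeff r d = 0") (auto simp: r_def intro!: mult_right_mono)
  have "(b \<bullet> b) * (norm r)\<^sup>2 \<le> (\<Sum>d\<in>expos 4. bdot b d * mass r d)"
    unfolding sum_mass [symmetric] sum_distrib_left by (intro sum_mono ge)
  then have le: "mm r \<bullet> dg b \<le> - (b \<bullet> b)"
    using \<open>r \<noteq> 0\<close> by (simp add: inner_mm_dg pos_le_divide_eq)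
  \<comment> \<open>The square \<open>|mm r + diag b|^2\<close> is at most \<open>|mm r|^2 - |b|^2\<close>; its sign gives both claims.\<close>
  have expand: "(mm r + dg b) \<bullet> (mm r + dg b) = mm r \<bullet> mm r + 2 * (mm r \<bullet> dg b) + b \<bullet> b"
    by (simp add: inner_add_left inner_add_right inner_dg inner_commute [of "dg b" "mm r"])
  then have "mm r \<bullet> mm r + 2 * (mm r \<bullet> dg b) + b \<bullet> b \<ge> 0"
    by (metis inner_ge_zero)
  then show "b \<bullet> b \<le> mm q \<bullet> mm q"
    using le \<open>mm q \<bullet> mm q = mm r \<bullet> mm r\<close> by linarith
  assume "mm q \<bullet> mm q = b \<bullet> b"
  then have "(mm r + dg b) \<bullet> (mm r + dg b) \<le> 0"
    using le expand \<open>mm q \<bullet> mm q = mm r \<bullet> mm r\<close> by linarith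
  then have "(mm r + dg b) \<bullet> (mm r + dg b) = 0"
    using inner_ge_zero by (rule antisym)
  then have mmr: "mm r = - dg b"
    by (simp add: eq_neg_iff_add_eq_0)
  then have "(\<Sum>d\<in>expos 4. bdot b d * mass r d) = (b \<bullet> b) * (norm r)\<^sup>2"
    using inner_mm_dg [of r b] \<open>r \<noteq> 0\<close> by (simp add: inner_dg field_simps)
  then have "(\<Sum>d\<in>expos 4. bdot b d * mass r d - (b \<bullet> b) * mass r d) = 0"
    by (simp add: sum_subtractf sum_mass flip: sum_distrib_left)
  then have "\<forall>d\<in>expos 4. bdot b d * mass r d - (b \<bullet> b) * mass r d = 0"
    using ge by (subst (asm) sum_nonneg_eq_0_iff) auto
  then have "coeff r d = 0" if "bdot b d \<noteq> b \<bullet> b" for d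
    using that mass_eq_0_iff [of r d] by (cases "d \<in> expos 4") auto
  then have rp: "r = pullback (\<chi> i j. if b$i = b$j then h$i$j else 0) p"
    by (intro quartic_eqI) (auto simp: initial_form(2) [of p b "b \<bullet> b" h, OF supp h sorted] r_def)
  have "mm q = - (transpose k ** dg b ** k)"
    unfolding mmq mmr by (simp only: matrix_mult_uminus)
  with k qr [unfolded rp] show "\<exists>k h. orthogonal_matrix k \<and> mm q = - (transpose k ** dg b ** k)
      \<and> q = pullback k (pullback (\<chi> i j. if b$i = b$j then h$i$j else 0) p)"
    by blast
qed

text \<open>Each of the two critical points minimises the moment norm on the common orbit.\<close>

lemma same_orbit_moment_norm:
  assumes "crit p" "mm p = - dg b" "b$1 \<le> b$2" "b$2 \<le> b$3"
    and "crit q" "mm q = - dg c" "c$1 \<le> c$2" "c$2 \<le> c$3"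
    and "orbit p = orbit q"
  shows "b \<bullet> b = c \<bullet> c"
proof -
  have *: "b \<bullet> b \<le> c \<bullet> c"
    if "crit p" "mm p = - dg b" "b$1 \<le> b$2" "b$2 \<le> b$3" "mm q = - dg c" "orbit p = orbit q" for p q b c
  proof -
    have "p \<noteq> 0" "\<And>d. coeff p d \<noteq> 0 \<Longrightarrow> bdot b d = b \<bullet> b"
      using \<open>crit p\<close> crit_iff_support [OF \<open>mm p = - dg b\<close>] by blast+
    moreover have "q \<in> orbit p"
      using \<open>orbit p = orbit q\<close> orbit_self by blast
    ultimately have "b \<bullet> b \<le> mm q \<bullet> mm q"
      using that by (intro moment_norm_minimal_on_orbit(1))
    then show ?thesis
      by (simp add: \<open>mm q = - dg c\<close> inner_dg)
  qed
  show ?thesis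
    using * [OF assms(1-4) assms(6,9)] * [OF assms(5-8) assms(2) assms(9) [symmetric]] by simp
qed

text \<open>When the entries of \<open>b\<close> are distinct, everything that commutes with \<open>diag b\<close> is diagonal. So
  \<open>q\<close> arises from \<open>p\<close> by diagonal matrices, which multiply coefficients with even exponents by squares.\<close>

lemma same_orbit_even_sign:
  assumes p: "crit p" "mm p = - dg b" and q: "mm q = - dg b" and b: "b$1 < b$2" "b$2 < b$3"
    and orb: "orbit p = orbit q" and even: "\<And>a. even (expo d a)"
  shows "coeff p d * coeff q d \<ge> 0"
proof -
  have "mm q \<bullet> mm q = b \<bullet> b"
    by (simp add: q inner_dg)
  moreover have supp: "p \<noteq> 0" "\<And>d. coeff p d \<noteq> 0 \<Longrightarrow> bdot b d = b \<bullet> b"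
    using p crit_iff_support by blast+
  moreover have "q \<in> orbit p"
    using orb orbit_self by blast
  ultimately obtain k h where k: "orthogonal_matrix k" "mm q = - (transpose k ** dg b ** k)"
    and qk: "q = pullback k (pullback (\<chi> i j. if b$i = b$j then h$i$j else 0) p)"
    using moment_norm_minimal_on_orbit(2) [of p b q, OF supp less_imp_le [OF b(1)] less_imp_le [OF b(2)]]
    by blast
  have inj: "b$i = b$j \<longleftrightarrow> i = j" for i j
    using b exhaust_3 [of i] exhaust_3 [of j] by auto
  have "dg b = transpose k ** dg b ** k"
    using k q by simp
  then have "k ** dg b = (k ** transpose k) ** dg b ** k"
    by (metis matrix_mul_assoc)
  then have "k ** dg b = dg b ** k"
    by (simp add: orthogonal_matrixD [OF k(1)])
  then have "k$i$j * b$j = b$i * k$i$j" for i j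
    by (metis dg_mult_left dg_mult_right)
  then have "k$i$j = 0" if "i \<noteq> j" for i j
    using inj [of i j] that by (metis mult.commute mult_cancel_left)
  then have "k = dg (\<chi> i. k$i$i)"
    by (auto simp: vec_eq_iff)
  moreover have "(\<chi> i j. if b$i = b$j then h$i$j else 0) = dg (\<chi> i. h$i$i)"
    by (auto simp: vec_eq_iff inj)
  ultimately have "coeff q d = pw (\<chi> i. k$i$i) d * (pw (\<chi> i. h$i$i) d * coeff p d)"
    using qk coeff_pullback_dg by metis
  moreover have "pw v d \<ge> 0" for v
    unfolding pw_def using even by (intro mult_nonneg_nonneg zero_le_even_power)
  ultimately have "coeff p d * coeff q d = (pw (\<chi> i. k$i$i) d * pw (\<chi> i. h$i$i) d) * (coeff p d)\<^sup>2"
    by (simp add: power2_eq_square)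
  then show ?thesis
    using \<open>\<And>v. pw v d \<ge> 0\<close> by simp
qed

section \<open>The possible types\<close>

text \<open>The vector \<open>v\<close> is the cross product of \<open>b\<close> with \<open>(1, 1, 1)\<close>, and \<open>w\<close> is orthogonal to both factors.\<close>

lemma perpendicular_to_type:
  fixes b w v :: "real^3"
  assumes v: "v$1 = b$2 - b$3" "v$2 = b$3 - b$1" "v$3 = b$1 - b$2"
    and w: "w$1 + w$2 + w$3 = 0" "b \<bullet> w = 0"
  shows "(v \<bullet> v) *\<^sub>R w = (v \<bullet> w) *\<^sub>R v"
proof -
  have *: "w1 * ((b2 - b3) * (b2 - b3) + (b3 - b1) * (b3 - b1) + (b1 - b2) * (b1 - b2))
      = ((b2 - b3) * w1 + (b3 - b1) * w2 + (b1 - b2) * w3) * (b2 - b3)"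
    if "w1 + w2 + w3 = 0" "b1 * w1 + b2 * w2 + b3 * w3 = 0" for b1 b2 b3 w1 w2 w3 :: real
  proof -
    have w3: "w3 = - w1 - w2"
      using that(1) by simp
    have "w1 * ((b2 - b3) * (b2 - b3) + (b3 - b1) * (b3 - b1) + (b1 - b2) * (b1 - b2))
        - ((b2 - b3) * w1 + (b3 - b1) * w2 + (b1 - b2) * w3) * (b2 - b3)
      = (2 * (b1 - b3) - (b2 - b3)) * (b1 * w1 + b2 * w2 + b3 * w3)"
      unfolding w3 by (simp add: algebra_simps)
    then show ?thesis
      using that(2) by simp
  qed
  have inner3: "x \<bullet> y = x$1 * y$1 + x$2 * y$2 + x$3 * y$3" for x y :: "real^3"
    by (simp add: inner_vec_def sum_3)
  have bw: "b$1 * w$1 + b$2 * w$2 + b$3 * w$3 = 0"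
    using w(2) by (simp only: inner3)
  have "w$1 * (v \<bullet> v) = (v \<bullet> w) * v$1"
    unfolding inner3 v using w(1) bw by (rule *)
  moreover have "w$2 * ((b$3 - b$1) * (b$3 - b$1) + (b$1 - b$2) * (b$1 - b$2) + (b$2 - b$3) * (b$2 - b$3))
      = ((b$3 - b$1) * w$2 + (b$1 - b$2) * w$3 + (b$2 - b$3) * w$1) * (b$3 - b$1)"
    by (rule *) (use w(1) bw in linarith)+
  then have "w$2 * (v \<bullet> v) = (v \<bullet> w) * v$2"
    unfolding inner3 v by (simp only: ac_simps)
  moreover have "w$3 * ((b$1 - b$2) * (b$1 - b$2) + (b$2 - b$3) * (b$2 - b$3) + (b$3 - b$1) * (b$3 - b$1))
      = ((b$1 - b$2) * w$3 + (b$2 - b$3) * w$1 + (b$3 - b$1) * w$2) * (b$1 - b$2)"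
    by (rule *) (use w(1) bw in linarith)+
  then have "w$3 * (v \<bullet> v) = (v \<bullet> w) * v$3"
    unfolding inner3 v by (simp only: ac_simps)
  ultimately show ?thesis
    by (simp add: vec_eq_iff forall_3 mult.commute [of "v \<bullet> v"])
qed

definition int_expos :: "(int \<times> int \<times> int) list" where
  "int_expos = [(4,0,0), (3,1,0), (3,0,1), (2,2,0), (2,1,1), (2,0,2), (1,3,0), (1,2,1),
    (1,1,2), (1,0,3), (0,4,0), (0,3,1), (0,2,2), (0,1,3), (0,0,4)]"

text \<open>The types that occur as feet of perpendiculars, as integer vectors over a common denominator:
  \<open>(k, t\<^sub>1, t\<^sub>2, t\<^sub>3)\<close> stands for \<open>(t\<^sub>1/k, t\<^sub>2/k, t\<^sub>3/k)\<close>.\<close>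

definition int_types :: "(int \<times> int \<times> int \<times> int) list" where
  "int_types = [(3, 4,4,4), (7, 8,9,11), (2, 2,3,3), (7, 6,10,12), (6, 5,8,11), (1, 1,1,2),
    (13, 8,20,24), (2, 1,3,4), (3, 1,4,7), (1, 0,2,2), (2, 1,1,6)]"

text \<open>The foot of the perpendicular from the origin to the line through \<open>x\<close> and \<open>y\<close> is \<open>c / n\<close>. It lies
  strictly between \<open>x\<close> and \<open>y\<close> iff \<open>0 < m < n\<close>. All quantities are kept integral.\<close>

definition foot_in_table :: "int \<times> int \<times> int \<Rightarrow> int \<times> int \<times> int \<Rightarrow> bool" where
  "foot_in_table = (\<lambda>(x1, x2, x3) (y1, y2, y3).
    let d1 = y1 - x1; d2 = y2 - x2; d3 = y3 - x3;
        n = d1 * d1 + d2 * d2 + d3 * d3; m = - (x1 * d1 + x2 * d2 + x3 * d3);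
        c1 = n * x1 + m * d1; c2 = n * x2 + m * d2; c3 = n * x3 + m * d3
    in 0 < m \<and> m < n \<and> c1 \<le> c2 \<and> c2 \<le> c3 \<longrightarrow>
       list_ex (\<lambda>(k, t1, t2, t3). k * c1 = n * t1 \<and> k * c2 = n * t2 \<and> k * c3 = n * t3) int_types)"

lemma all_feet_in_table: "list_all (\<lambda>x. list_all (foot_in_table x) int_expos) int_expos"
  by code_simp

lemma foot_in_tableD:
  fixes b x y :: "real^3" and i1 i2 i3 j1 j2 j3 :: int
  assumes x: "x = vector [real_of_int i1, real_of_int i2, real_of_int i3]" "(i1, i2, i3) \<in> set int_expos"
    and y: "y = vector [real_of_int j1, real_of_int j2, real_of_int j3]" "(j1, j2, j3) \<in> set int_expos"
    and b: "b = x + s *\<^sub>R (y - x)" "0 < s" "s < 1" "b \<bullet> (y - x) = 0" "y \<noteq> x"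
    and sorted: "b$1 \<le> b$2" "b$2 \<le> b$3"
  obtains k t1 t2 t3 where "(k, t1, t2, t3) \<in> set int_types"
    "k * b$1 = t1" "k * b$2 = t2" "k * b$3 = t3"
proof -
  define d1 d2 d3 where d: "d1 = j1 - i1" "d2 = j2 - i2" "d3 = j3 - i3"
  define n m where nm: "n = d1 * d1 + d2 * d2 + d3 * d3" "m = - (i1 * d1 + i2 * d2 + i3 * d3)"
  have yx: "(y - x)$1 = d1" "(y - x)$2 = d2" "(y - x)$3 = d3"
    by (simp_all add: x y d vector_3)
  then have n: "(y - x) \<bullet> (y - x) = n"
    by (simp add: inner_vec_def sum_3 nm)
  moreover have m: "x \<bullet> (y - x) = - m"
    unfolding inner_vec_def sum_3 inner_real_def yx by (simp add: x nm vector_3)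
  moreover have "x \<bullet> (y - x) + s * ((y - x) \<bullet> (y - x)) = 0"
    using b(4) unfolding b(1) by (simp only: inner_add_left inner_scaleR_left)
  ultimately have sn: "s * n = m"
    by simp
  have "real_of_int n > 0"
    unfolding n [symmetric] using b(5) by simp
  then have "real_of_int m > 0" "real_of_int m < n"
    using b(2,3) unfolding sn [symmetric] by simp_all
  have c: "n * b$1 = n * i1 + m * d1" "n * b$2 = n * i2 + m * d2" "n * b$3 = n * i3 + m * d3"
    unfolding b(1) vector_add_component vector_scaleR_component yx using sn
    by (simp_all add: x vector_3 algebra_simps)
  have "n * b$1 \<le> n * b$2" "n * b$2 \<le> n * b$3"
    using sorted \<open>real_of_int n > 0\<close> by (simp_all add: mult_left_mono)
  then have le: "n * i1 + m * d1 \<le> n * i2 + m * d2" "n * i2 + m * d2 \<le> n * i3 + m * d3"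
    unfolding c by (simp_all flip: of_int_mult of_int_add)
  have "foot_in_table (i1, i2, i3) (j1, j2, j3)"
    using all_feet_in_table x(2) y(2) by (auto simp: list_all_iff)
  then have "list_ex (\<lambda>(k, t1, t2, t3). k * (n * i1 + m * d1) = n * t1 \<and> k * (n * i2 + m * d2) = n * t2
      \<and> k * (n * i3 + m * d3) = n * t3) int_types"
    using le \<open>real_of_int m > 0\<close> \<open>real_of_int m < n\<close>
    unfolding foot_in_table_def prod.case Let_def d [symmetric] nm [symmetric] by simp
  then obtain k t1 t2 t3 where t: "(k, t1, t2, t3) \<in> set int_types"
    "k * (n * i1 + m * d1) = n * t1" "k * (n * i2 + m * d2) = n * t2" "k * (n * i3 + m * d3) = n * t3"
    by (auto simp: list_ex_iff)
  have div: "k * v = t" if "n * v = real_of_int (n * i + m * e)" "k * (n * i + m * e) = n * t"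
    for v :: real and i e t :: int
  proof -
    have "n * (k * v) = real_of_int k * (n * v)"
      by simp
    also have "\<dots> = real_of_int (k * (n * i + m * e))"
      by (simp only: that(1) of_int_mult)
    also have "\<dots> = n * real_of_int t"
      by (simp only: that(2) of_int_mult)
    finally show ?thesis
      using \<open>real_of_int n > 0\<close> by simp
  qed
  show thesis
    by (rule that [OF t(1)]; rule div) (use c t in simp_all)
qed

lemma row_typeI:
  assumes "b$1 + b$2 + b$3 = 4" "(k, t1, t2, t3) \<in> set int_types"
    "k * b$1 = t1" "k * b$2 = t2" "k * b$3 = t3"
  shows "\<exists>r. b = row_type r"
proof -
  have "b = row_type Beta0 \<or> b = row_type Beta1 \<or> b = row_type Beta2 \<or> b = row_type Beta3
      \<or> b = row_type Beta4 \<or> b = row_type Alpha_xyzz \<or> b = row_type Beta5 \<or> b = row_type Beta6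
      \<or> b = row_type Beta7 \<or> b = row_type Alpha_yyzz \<or> b = row_type Beta8"
    using assms unfolding int_types_def list.set
    by (elim insertE) (auto simp: vec_eq_iff forall_3 vector_3)
  then show ?thesis
    by blast
qed

definition expo_vec :: "nat \<times> nat \<times> nat \<Rightarrow> real^3" where
  "expo_vec d = (\<chi> a. real (expo d a))"

lemma bdot_eq_inner: "bdot v d = v \<bullet> expo_vec d"
  by (simp add: bdot_def expo_vec_def inner_vec_def sum_3)

lemma expo_vec_int_expos:
  assumes "d \<in> expos 4"
  obtains i j k where "(i, j, k) \<in> set int_expos" "expo_vec d = vector [real_of_int i, real_of_int j, real_of_int k]"
proof (rule that [of "int (expo d 1)" "int (expo d 2)" "int (expo d 3)"])
  show "(int (expo d 1), int (expo d 2), int (expo d 3)) \<in> set int_expos"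
    using assms unfolding expos_4 int_expos_def by (elim insertE) simp_all
  show "expo_vec d = vector [real_of_int (int (expo d 1)), real_of_int (int (expo d 2)),
      real_of_int (int (expo d 3))]"
    by (simp add: expo_vec_def vec_eq_iff forall_3 vector_3)
qed

lemma sorted_exponent_in_table:
  assumes "d \<in> expos 4" "b = expo_vec d" "b$1 \<le> b$2" "b$2 \<le> b$3"
  shows "\<exists>r. b = row_type r"
proof -
  have "b = row_type Alpha_xyzz \<or> b = row_type Alpha_yyzz \<or> b = row_type Alpha_yzzz \<or> b = row_type Alpha_zzzz"
    using assms unfolding expos_4
    by (elim insertE) (simp_all add: vec_eq_iff forall_3 vector_3 expo_vec_def)
  then show ?thesis
    by blast
qed

text \<open>If \<open>b\<close> is not the centre \<open>(4/3, 4/3, 4/3)\<close>, the exponents of \<open>p\<close> differ from \<open>b\<close> by multiples of the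
  vector \<open>v\<close> perpendicular to \<open>b\<close> and \<open>(1, 1, 1)\<close>. As \<open>b\<close> is their weighted mean, either one of them equals \<open>b\<close>, or
  there are exponents on both sides of \<open>b\<close>, and \<open>b\<close> is the foot of the perpendicular on the line through them.\<close>

theorem type_in_table:
  assumes crit: "crit p" and mm: "mm p = - dg b" and sorted: "b$1 \<le> b$2" "b$2 \<le> b$3"
  obtains r where "b = row_type r"
proof -
  have p: "p \<noteq> 0" and supp: "\<And>d. coeff p d \<noteq> 0 \<Longrightarrow> bdot b d = b \<bullet> b"
    using crit crit_iff_support [OF mm] by blast+
  have b4: "b$1 + b$2 + b$3 = 4"
    using mm p by (rule sum_type_eq_4)
  have in4: "d \<in> expos 4" if "coeff p d \<noteq> 0" for d
    using that coeff_outside by blast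
  define v :: "real^3" where "v = vector [b$2 - b$3, b$3 - b$1, b$1 - b$2]"
  have v: "v$1 = b$2 - b$3" "v$2 = b$3 - b$1" "v$3 = b$1 - b$2"
    by (simp_all add: v_def vector_3)
  have inner3: "x \<bullet> y = x$1 * y$1 + x$2 * y$2 + x$3 * y$3" for x y :: "real^3"
    by (simp add: inner_vec_def sum_3)
  note perp = perpendicular_to_type [OF v]
  show thesis
  proof (cases "v = 0")
    case True
    then have "b$1 = 4/3" "b$2 = 4/3" "b$3 = 4/3"
    proof -
      have "b$2 - b$3 = 0" "b$3 - b$1 = 0"
        unfolding v [symmetric] using True by simp_all
      then show "b$1 = 4/3" "b$2 = 4/3" "b$3 = 4/3"
        using b4 by linarith+
    qed
    then have "b = row_type Beta0"
      by (simp add: vec_eq_iff forall_3 vector_3)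
    then show ?thesis
      by (rule that)
  next
    case False
    then have vv: "v \<bullet> v \<noteq> 0"
      by simp
    have sum0: "(\<Sum>d\<in>expos 4. bdot v d * mass p d) = 0"
    proof -
      have "mm p \<bullet> dg v = 0"
        by (simp add: mm inner_dg inner3 v algebra_simps)
      then show ?thesis
        using p by (simp add: inner_mm_dg)
    qed
    have diff: "(expo_vec d - b)$1 + (expo_vec d - b)$2 + (expo_vec d - b)$3 = 0" "b \<bullet> (expo_vec d - b) = 0"
      if "coeff p d \<noteq> 0" for d
      using expo_sum [OF in4 [OF that]] b4 supp [OF that]
      by (simp_all add: expo_vec_def bdot_eq_inner inner_diff_right)
    have vb: "v \<bullet> b = 0"
      by (simp add: inner3 v algebra_simps)
    show ?thesis
    proof (cases "\<exists>d. coeff p d \<noteq> 0 \<and> bdot v d = 0")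
      case True
      then obtain d where d: "coeff p d \<noteq> 0" "bdot v d = 0"
        by blast
      have "(v \<bullet> v) *\<^sub>R (expo_vec d - b) = 0"
        using perp [OF diff [OF d(1)]] d(2) vb by (simp add: bdot_eq_inner inner_diff_right)
      then have "b = expo_vec d"
        using vv by simp
      then show ?thesis
        using sorted_exponent_in_table [OF in4 [OF d(1)] _ sorted] that by blast
    next
      case False
      obtain d0 where d0: "coeff p d0 \<noteq> 0"
        using p quartic_eqI [of p 0] by auto
      \<comment> \<open>A weighted mean of numbers that are not 0 can only vanish if both signs occur.\<close>
      have *: "\<exists>d. coeff p d \<noteq> 0 \<and> \<sigma> * bdot v d > 0" if "\<sigma> = 1 \<or> \<sigma> = - 1" for \<sigma>
      proof (rule ccontr)
        assume "\<not> ?thesis"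
        then have le: "\<sigma> * bdot v d \<le> 0" if "coeff p d \<noteq> 0" for d
          using that not_less by blast
        have nonneg: "- \<sigma> * bdot v d * mass p d \<ge> 0" for d
          using mult_nonneg_nonneg [of "- (\<sigma> * bdot v d)" "mass p d"] le [of d] mass_nonneg [of p d]
            mass_eq_0_iff [of p d]
          by (cases "coeff p d = 0") auto
        moreover have "(\<Sum>d\<in>expos 4. - \<sigma> * bdot v d * mass p d) = - \<sigma> * (\<Sum>d\<in>expos 4. bdot v d * mass p d)"
          by (simp add: sum_distrib_left mult.assoc)
        ultimately have "\<forall>d\<in>expos 4. - \<sigma> * bdot v d * mass p d = 0"
          using sum0 by (subst sum_nonneg_eq_0_iff [symmetric]) auto
        then have "bdot v d0 = 0"
          using in4 [OF d0] d0 mass_eq_0_iff [of p d0] that by auto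
        then show False
          using False d0 by blast
      qed
      obtain d1 where d1: "coeff p d1 \<noteq> 0" "bdot v d1 > 0"
        using * [of 1] by auto
      obtain d2 where d2: "coeff p d2 \<noteq> 0" "bdot v d2 < 0"
        using * [of "- 1"] by auto
      define x y where xy: "x = expo_vec d1" "y = expo_vec d2"
      define s where "s = bdot v d1 / (bdot v d1 - bdot v d2)"
      have pos: "bdot v d1 - bdot v d2 > 0"
        using d1 d2 by simp
      have by0: "b \<bullet> (y - x) = 0"
        using supp [OF d1(1)] supp [OF d2(1)] by (simp add: xy bdot_eq_inner inner_diff_right)
      have vx: "v \<bullet> (x - b) = bdot v d1" and vyx: "v \<bullet> (y - x) = bdot v d2 - bdot v d1"
        by (simp_all add: xy bdot_eq_inner inner_diff_right vb)
      have e1: "(v \<bullet> v) *\<^sub>R (x - b) = bdot v d1 *\<^sub>R v"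
        using perp [OF diff [OF d1(1)]] vx by (simp add: xy)
      have "(y - x)$1 + (y - x)$2 + (y - x)$3 = 0"
        using diff(1) [OF d1(1)] diff(1) [OF d2(1)] by (simp add: xy)
      from perp [OF this by0] have e2: "(v \<bullet> v) *\<^sub>R (y - x) = (bdot v d2 - bdot v d1) *\<^sub>R v"
        by (simp only: vyx)
      have "(v \<bullet> v) *\<^sub>R (x - b + s *\<^sub>R (y - x)) = (v \<bullet> v) *\<^sub>R (x - b) + s *\<^sub>R ((v \<bullet> v) *\<^sub>R (y - x))"
        by (simp only: scaleR_add_right scaleR_scaleR mult.commute)
      also have "\<dots> = (bdot v d1 + s * (bdot v d2 - bdot v d1)) *\<^sub>R v"
        by (simp only: e1 e2 scaleR_add_left scaleR_scaleR)
      also have "bdot v d1 + s * (bdot v d2 - bdot v d1) = 0"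
        using pos unfolding s_def by (simp add: field_simps)
      finally have "x - b + s *\<^sub>R (y - x) = 0"
        using vv by (simp only: scaleR_zero_left scaleR_eq_0_iff simp_thms)
      then have "x + s *\<^sub>R (y - x) - b = 0"
        by (simp only: diff_add_eq)
      then have b: "b = x + s *\<^sub>R (y - x)"
        by (simp only: right_minus_eq)
      obtain i1 i2 i3 where i: "(i1, i2, i3) \<in> set int_expos" "x = vector [real_of_int i1, real_of_int i2, real_of_int i3]"
        unfolding xy by (rule expo_vec_int_expos [OF in4 [OF d1(1)]])
      obtain j1 j2 j3 where j: "(j1, j2, j3) \<in> set int_expos" "y = vector [real_of_int j1, real_of_int j2, real_of_int j3]"
        unfolding xy by (rule expo_vec_int_expos [OF in4 [OF d2(1)]])
      have "0 < s" "s < 1"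
        using d1 d2 by (simp_all add: s_def)
      moreover have "y \<noteq> x"
        using vyx pos by auto
      ultimately obtain k t1 t2 t3 where t: "(k, t1, t2, t3) \<in> set int_types" "k * b$1 = t1" "k * b$2 = t2" "k * b$3 = t3"
        using foot_in_tableD [OF i(2,1) j(2,1) b _ _ by0 _ sorted] by blast
      then show ?thesis
        using row_typeI [OF b4 t] that by blast
    qed
  qed
qed

section \<open>The moment matrix in coordinates\<close>

definition wt :: "nat \<times> nat \<times> nat \<Rightarrow> real" where
  "wt d = fact (expo d 1) * fact (expo d 2) * fact (expo d 3)"

text \<open>The pairing of \<open>pol a b p\<close> with \<open>p\<close>, written in the coefficients.\<close>

definition off :: "3 \<Rightarrow> 3 \<Rightarrow> quartic \<Rightarrow> real" where
  "off a b p = (\<Sum>d\<in>expos 4. expo d a * coeff p d * (wt (shift a b d) * coeff p (shift a b d)))"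

lemma inner_pol: "pol a b p \<bullet> p = off a b p"
  unfolding pol_def off_def inner_sum_left inner_scaleR_left
proof (rule sum.cong [OF refl])
  fix d assume d: "d \<in> expos 4"
  show "coeff p d * expo d a * (monom (shift a b d) \<bullet> p)
      = expo d a * coeff p d * (wt (shift a b d) * coeff p (shift a b d))"
  proof (cases "expo d a = 0")
    case False
    then have "shift a b d \<in> expos 4"
      using d exhaust_3 [of a] exhaust_3 [of b] by (cases d) (auto simp: expos_def)
    then show ?thesis
      by (cases "shift a b d") (simp add: monom_def wt_def inner_commute [of "mon _ _ _" p] inner_mon)
  qed simp
qed

lemma mm_eq_iff:
  assumes "p \<noteq> 0"
  shows "mm p = - dg b \<longleftrightarrow>
    (\<Sum>d\<in>expos 4. expo d 1 * mass p d) = b$1 * (norm p)\<^sup>2 \<and>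
    (\<Sum>d\<in>expos 4. expo d 2 * mass p d) = b$2 * (norm p)\<^sup>2 \<and>
    (\<Sum>d\<in>expos 4. expo d 3 * mass p d) = b$3 * (norm p)\<^sup>2 \<and>
    off 1 2 p = 0 \<and> off 1 3 p = 0 \<and> off 2 3 p = 0"
proof -
  have entry: "mm p $ a $ c = - off a c p / (norm p)\<^sup>2" for a c
    by (simp add: mm_def inner_pol)
  have "mm p $ c $ a = mm p $ a $ c" for a c
    using transpose_mm [of p] unfolding vec_eq_iff by (simp add: transpose_def)
  then have sym: "off c a p = off a c p" for a c
    using assms unfolding entry by (simp add: field_simps)
  have diag: "off a a p = (\<Sum>d\<in>expos 4. expo d a * mass p d)" for a
    unfolding off_def
  proof (rule sum.cong [OF refl])
    fix d assume "d \<in> expos 4"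
    have "shift a a d = d"
      using exhaust_3 [of a] by (cases d) auto
    then show "expo d a * coeff p d * (wt (shift a a d) * coeff p (shift a a d)) = expo d a * mass p d"
      by (simp add: mass_def wt_def power2_eq_square)
  qed
  show ?thesis
    using assms
    by (auto simp: vec_eq_iff forall_3 entry sym [of 2 1] sym [of 3 1] sym [of 3 2]
        diag field_simps)
qed

lemma coeff_support_iff: "(\<forall>d. coeff p d \<noteq> 0 \<longrightarrow> P d) \<longleftrightarrow> (\<forall>d\<in>expos 4. coeff p d \<noteq> 0 \<longrightarrow> P d)"
  using coeff_outside by blast

lemma norm_sq_eq_mass: "(norm p)\<^sup>2 = (\<Sum>d\<in>expos 4. mass p d)"
  by (simp add: sum_mass)

lemma row_beta_eq: "row_beta r = - dg (row_type r)"
  by (simp add: row_beta_def dg_def)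

lemma crit_row_iff:
  assumes "p \<noteq> 0"
  shows "crit p \<and> mm p = row_beta r \<longleftrightarrow>
    (\<forall>d\<in>expos 4. coeff p d \<noteq> 0 \<longrightarrow> bdot (row_type r) d = row_type r \<bullet> row_type r) \<and>
    mm p = - dg (row_type r)"
  using crit_iff_support [of p "row_type r"] assms unfolding row_beta_eq coeff_support_iff by blast

text \<open>The criteria for the support and for the moment matrix, combined in a form that the simplifier
  can decide for an explicit quartic.\<close>

lemma critical_rowI:
  assumes "coeff p e \<noteq> 0"
    and "(\<forall>d\<in>expos 4. coeff p d \<noteq> 0 \<longrightarrow> bdot (row_type r) d = row_type r \<bullet> row_type r) \<and>
      (\<Sum>d\<in>expos 4. expo d 1 * mass p d) = row_type r $ 1 * (\<Sum>d\<in>expos 4. mass p d) \<and>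
      (\<Sum>d\<in>expos 4. expo d 2 * mass p d) = row_type r $ 2 * (\<Sum>d\<in>expos 4. mass p d) \<and>
      (\<Sum>d\<in>expos 4. expo d 3 * mass p d) = row_type r $ 3 * (\<Sum>d\<in>expos 4. mass p d) \<and>
      off 1 2 p = 0 \<and> off 1 3 p = 0 \<and> off 2 3 p = 0"
  shows "crit p \<and> mm p = row_beta r"
proof -
  have "p \<noteq> 0"
    using assms(1) by auto
  then show ?thesis
    unfolding crit_row_iff [OF \<open>p \<noteq> 0\<close>] mm_eq_iff [OF \<open>p \<noteq> 0\<close>] norm_sq_eq_mass
    using assms(2) by blast
qed

lemmas listed_simps = expos_4 bdot_def inner_vec_def sum_3 vector_3 coeff_mon mass_def off_def wt_def
  power_mult_distrib fact_numeral

lemma crit_scaleR: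
  assumes "c \<noteq> 0"
  shows "mm (c *\<^sub>R p) = mm p" "crit (c *\<^sub>R p) \<longleftrightarrow> crit p"
proof -
  have "pol a b (c *\<^sub>R p) = c *\<^sub>R pol a b p" for a b
    by (simp add: pol_def scaleR_sum_right mult.assoc)
  then show mm: "mm (c *\<^sub>R p) = mm p"
    using assms by (simp add: mm_def vec_eq_iff power_mult_distrib) (simp add: power2_eq_square)
  have "- m *\<^sub>R (c *\<^sub>R p) = c *\<^sub>R (- m *\<^sub>R p)" for m
    by (simp only: scaleR_scaleR mult.commute)
  then show "crit (c *\<^sub>R p) \<longleftrightarrow> crit p"
    by (simp only: crit_def mm linear_scale [OF linear_lie] scaleR_cancel_left scaleR_eq_0_iff assms
        simp_thms)
qed

section \<open>Listed critical points\<close>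

lemma quartic_expand: "p = (\<Sum>d\<in>expos 4. coeff p d *\<^sub>R monom d)"
proof (rule quartic_eqI)
  fix d assume d: "d \<in> expos 4"
  have "coeff (\<Sum>e\<in>expos 4. coeff p e *\<^sub>R monom e) d = (\<Sum>e\<in>expos 4. if e = d then coeff p d else 0)"
    unfolding coeff_sum by (rule sum.cong) (auto simp: monom_def coeff_mon split: prod.splits)
  then show "coeff p d = coeff (\<Sum>d\<in>expos 4. coeff p d *\<^sub>R monom d) d"
    using d by simp
qed

lemma listed_Beta1:
  assumes "a\<^sup>2 = 1/7" "b\<^sup>2 = 1/14" and p: "p = a *\<^sub>R mon 2 0 2 + b *\<^sub>R mon 0 3 1"
  shows "crit p \<and> mm p = row_beta Beta1"
proof (rule critical_rowI [of p "(2,0,2)"])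
  show "coeff p (2,0,2) \<noteq> 0"
    using assms(1) by (auto simp: p coeff_mon expos_def)
qed (simp add: listed_simps p assms)

lemma listed_Beta3:
  assumes "a\<^sup>2 = 3/7" "b\<^sup>2 = 1/168" and p: "p = a *\<^sub>R mon 1 1 2 + b *\<^sub>R mon 0 4 0"
  shows "crit p \<and> mm p = row_beta Beta3"
proof (rule critical_rowI [of p "(1,1,2)"])
  show "coeff p (1,1,2) \<noteq> 0"
    using assms(1) by (auto simp: p coeff_mon expos_def)
qed (simp add: listed_simps p assms)

lemma listed_Beta4:
  assumes "a\<^sup>2 = 5/12" "b\<^sup>2 = 1/36" and p: "p = a *\<^sub>R mon 1 1 2 + b *\<^sub>R mon 0 3 1"
  shows "crit p \<and> mm p = row_beta Beta4"
proof (rule critical_rowI [of p "(1,1,2)"])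
  show "coeff p (1,1,2) \<noteq> 0"
    using assms(1) by (auto simp: p coeff_mon expos_def)
qed (simp add: listed_simps p assms)

lemma listed_Beta5:
  assumes "a\<^sup>2 = 4/39" "b\<^sup>2 = 5/312" and p: "p = a *\<^sub>R mon 1 0 3 + b *\<^sub>R mon 0 4 0"
  shows "crit p \<and> mm p = row_beta Beta5"
proof (rule critical_rowI [of p "(1,0,3)"])
  show "coeff p (1,0,3) \<noteq> 0"
    using assms(1) by (auto simp: p coeff_mon expos_def)
qed (simp add: listed_simps p assms)

lemma listed_Beta6:
  assumes "a\<^sup>2 = 1/12" "b\<^sup>2 = 1/12" and p: "p = a *\<^sub>R mon 1 0 3 + b *\<^sub>R mon 0 3 1"
  shows "crit p \<and> mm p = row_beta Beta6"
proof (rule critical_rowI [of p "(1,0,3)"])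
  show "coeff p (1,0,3) \<noteq> 0"
    using assms(1) by (auto simp: p coeff_mon expos_def)
qed (simp add: listed_simps p assms)

lemma listed_Beta7:
  assumes "a\<^sup>2 = 1/18" "b\<^sup>2 = 1/6" and p: "p = a *\<^sub>R mon 1 0 3 + b *\<^sub>R mon 0 2 2"
  shows "crit p \<and> mm p = row_beta Beta7"
proof (rule critical_rowI [of p "(1,0,3)"])
  show "coeff p (1,0,3) \<noteq> 0"
    using assms(1) by (auto simp: p coeff_mon expos_def)
qed (simp add: listed_simps p assms)

lemma listed_Alpha_yzzz:
  assumes "a \<noteq> 0" and p: "p = a *\<^sub>R mon 0 1 3"
  shows "crit p \<and> mm p = row_beta Alpha_yzzz"
proof (rule critical_rowI [of p "(0,1,3)"])
  show "coeff p (0,1,3) \<noteq> 0"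
    using assms(1) by (auto simp: p coeff_mon expos_def)
qed (simp add: listed_simps p assms)

lemma listed_Alpha_zzzz:
  assumes "a \<noteq> 0" and p: "p = a *\<^sub>R mon 0 0 4"
  shows "crit p \<and> mm p = row_beta Alpha_zzzz"
proof (rule critical_rowI [of p "(0,0,4)"])
  show "coeff p (0,0,4) \<noteq> 0"
    using assms(1) by (auto simp: p coeff_mon expos_def)
qed (simp add: listed_simps p assms)

lemma listed_Alpha_xyzz:
  assumes "a \<noteq> 0" "a\<^sup>2 = c\<^sup>2" and p: "p = a *\<^sub>R mon 2 0 2 + c *\<^sub>R mon 0 2 2"
  shows "crit p \<and> mm p = row_beta Alpha_xyzz"
proof (rule critical_rowI [of p "(2,0,2)"])
  show "coeff p (2,0,2) \<noteq> 0"
    using assms(1) by (auto simp: p coeff_mon expos_def)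
qed (simp add: listed_simps p assms)

lemma listed_Alpha_yyzz:
  assumes "a \<noteq> 0" "a\<^sup>2 = c\<^sup>2" and p: "p = a *\<^sub>R mon 0 4 0 + b *\<^sub>R mon 0 2 2 + c *\<^sub>R mon 0 0 4"
  shows "crit p \<and> mm p = row_beta Alpha_yyzz"
proof (rule critical_rowI [of p "(0,4,0)"])
  show "coeff p (0,4,0) \<noteq> 0"
    using assms(1) by (auto simp: p coeff_mon expos_def)
qed (simp add: listed_simps p assms)

text \<open>The quartics \<open>x (y^3 \<plusminus> y z^2)\<close> are not critical themselves; \<open>x (y^3 \<plusminus> 3 y z^2)\<close> are.\<close>

lemma listed_Beta2:
  assumes "a \<noteq> 0" "b\<^sup>2 = 9 * a\<^sup>2" and p: "p = a *\<^sub>R mon 1 3 0 + b *\<^sub>R mon 1 1 2"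
  shows "crit p \<and> mm p = row_beta Beta2"
proof (rule critical_rowI [of p "(1,3,0)"])
  show "coeff p (1,3,0) \<noteq> 0"
    using assms(1) by (auto simp: p coeff_mon expos_def)
qed (simp add: listed_simps p assms)

section \<open>The forms of the critical points\<close>

text \<open>The exponents \<open>d\<close> with \<open>bdot (row_type r) d = row_type r \<bullet> row_type r\<close> are enumerated for each row.\<close>

lemma row_expansion:
  assumes "crit p" "mm p = row_beta r"
  shows
    "r = Beta1 \<Longrightarrow> p = coeff p (2,0,2) *\<^sub>R mon 2 0 2 + coeff p (0,3,1) *\<^sub>R mon 0 3 1" (is "_ \<Longrightarrow> ?e1")
    and "r = Beta2 \<Longrightarrow> p = coeff p (1,0,3) *\<^sub>R mon 1 0 3 + coeff p (1,1,2) *\<^sub>R mon 1 1 2 + coeff p (1,2,1) *\<^sub>R mon 1 2 1 + coeff p (1,3,0) *\<^sub>R mon 1 3 0" (is "_ \<Longrightarrow> ?e2")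
    and "r = Beta3 \<Longrightarrow> p = coeff p (1,1,2) *\<^sub>R mon 1 1 2 + coeff p (0,4,0) *\<^sub>R mon 0 4 0" (is "_ \<Longrightarrow> ?e3")
    and "r = Beta4 \<Longrightarrow> p = coeff p (1,1,2) *\<^sub>R mon 1 1 2 + coeff p (0,3,1) *\<^sub>R mon 0 3 1" (is "_ \<Longrightarrow> ?e4")
    and "r = Alpha_xyzz \<Longrightarrow> p = coeff p (2,0,2) *\<^sub>R mon 2 0 2 + coeff p (1,1,2) *\<^sub>R mon 1 1 2 + coeff p (0,2,2) *\<^sub>R mon 0 2 2" (is "_ \<Longrightarrow> ?e5")
    and "r = Beta5 \<Longrightarrow> p = coeff p (1,0,3) *\<^sub>R mon 1 0 3 + coeff p (0,4,0) *\<^sub>R mon 0 4 0" (is "_ \<Longrightarrow> ?e6")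
    and "r = Beta6 \<Longrightarrow> p = coeff p (1,0,3) *\<^sub>R mon 1 0 3 + coeff p (0,3,1) *\<^sub>R mon 0 3 1" (is "_ \<Longrightarrow> ?e7")
    and "r = Beta7 \<Longrightarrow> p = coeff p (1,0,3) *\<^sub>R mon 1 0 3 + coeff p (0,2,2) *\<^sub>R mon 0 2 2" (is "_ \<Longrightarrow> ?e8")
    and "r = Alpha_yyzz \<Longrightarrow> p = coeff p (0,4,0) *\<^sub>R mon 0 4 0 + coeff p (0,3,1) *\<^sub>R mon 0 3 1 + coeff p (0,2,2) *\<^sub>R mon 0 2 2 + coeff p (0,1,3) *\<^sub>R mon 0 1 3 + coeff p (0,0,4) *\<^sub>R mon 0 0 4" (is "_ \<Longrightarrow> ?e9")
    and "r = Beta8 \<Longrightarrow> p = coeff p (1,0,3) *\<^sub>R mon 1 0 3 + coeff p (0,1,3) *\<^sub>R mon 0 1 3" (is "_ \<Longrightarrow> ?e10")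
    and "r = Alpha_yzzz \<Longrightarrow> p = coeff p (0,1,3) *\<^sub>R mon 0 1 3" (is "_ \<Longrightarrow> ?e11")
    and "r = Alpha_zzzz \<Longrightarrow> p = coeff p (0,0,4) *\<^sub>R mon 0 0 4" (is "_ \<Longrightarrow> ?e12")
proof -
  have z: "\<forall>d\<in>expos 4. coeff p d \<noteq> 0 \<longrightarrow> bdot (row_type r) d = row_type r \<bullet> row_type r"
    using crit_row_iff [of p r] assms by (auto simp: crit_def)
  note e = quartic_expand [of p, unfolded sum_expos_4 monom_def prod.case]
  show ?e1 if "r = Beta1"
    by (rule trans [OF e]) (use z in \<open>simp add: that expos_4 bdot_def inner_vec_def sum_3 vector_3\<close>)
  show ?e2 if "r = Beta2"
    by (rule trans [OF e]) (use z in \<open>simp add: that expos_4 bdot_def inner_vec_def sum_3 vector_3\<close>)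
  show ?e3 if "r = Beta3"
    by (rule trans [OF e]) (use z in \<open>simp add: that expos_4 bdot_def inner_vec_def sum_3 vector_3\<close>)
  show ?e4 if "r = Beta4"
    by (rule trans [OF e]) (use z in \<open>simp add: that expos_4 bdot_def inner_vec_def sum_3 vector_3\<close>)
  show ?e5 if "r = Alpha_xyzz"
    by (rule trans [OF e]) (use z in \<open>simp add: that expos_4 bdot_def inner_vec_def sum_3 vector_3\<close>)
  show ?e6 if "r = Beta5"
    by (rule trans [OF e]) (use z in \<open>simp add: that expos_4 bdot_def inner_vec_def sum_3 vector_3\<close>)
  show ?e7 if "r = Beta6"
    by (rule trans [OF e]) (use z in \<open>simp add: that expos_4 bdot_def inner_vec_def sum_3 vector_3\<close>)
  show ?e8 if "r = Beta7"
    by (rule trans [OF e]) (use z in \<open>simp add: that expos_4 bdot_def inner_vec_def sum_3 vector_3\<close>)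
  show ?e9 if "r = Alpha_yyzz"
    by (rule trans [OF e]) (use z in \<open>simp add: that expos_4 bdot_def inner_vec_def sum_3 vector_3\<close>)
  show ?e10 if "r = Beta8"
    by (rule trans [OF e]) (use z in \<open>simp add: that expos_4 bdot_def inner_vec_def sum_3 vector_3\<close>)
  show ?e11 if "r = Alpha_yzzz"
    by (rule trans [OF e]) (use z in \<open>simp add: that expos_4 bdot_def inner_vec_def sum_3 vector_3\<close>)
  show ?e12 if "r = Alpha_zzzz"
    by (rule trans [OF e]) (use z in \<open>simp add: that expos_4 bdot_def inner_vec_def sum_3 vector_3\<close>)
qed

text \<open>Read off from the exponents on the hyperplane of the type.\<close>

lemma crit_in_row_form:
  assumes "crit p" "mm p = row_beta r"
  shows "p \<in> row_form r"
proof (cases r)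
  case Beta0
  have "p = (\<Sum>(i, j, k)\<in>expos 4. coeff p (i, j, k) *\<^sub>R mon i j k)"
    by (subst quartic_expand) (simp add: monom_def case_prod_unfold)
  then show ?thesis
    unfolding Beta0 row_form.simps by blast
next
  case Alpha_yyzz
  have "p = (\<Sum>i\<le>4. coeff p (0, 4 - i, i) *\<^sub>R mon 0 (4 - i) i)"
    using row_expansion(9) [OF assms Alpha_yyzz] by (simp add: eval_nat_numeral)
  then show ?thesis
    unfolding Alpha_yyzz row_form.simps
    by (intro CollectI exI [of _ "\<lambda>i. coeff p (0, 4 - i, i)"] conjI TrueI)
qed (simp only: row_form.simps, intro CollectI exI conjI TrueI, erule row_expansion [OF assms])+

section \<open>Normal forms in rows with at most two monomials\<close>

lemma pullback_dg_mon:
  "pullback (dg v) (mon i j k) = ((v$1)^i * (v$2)^j * (v$3)^k) *\<^sub>R mon i j k"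
  by (rule quartic_eqI) (simp add: coeff_pullback_dg coeff_mon pw_def)

text \<open>Diagonal matrices of determinant 1, used mostly with entries \<open>\<plusminus>1\<close> to change signs.\<close>

lemma orbit_flip:
  assumes "s1 * s2 * s3 = 1"
  shows "orbit (a *\<^sub>R mon i j k + b *\<^sub>R mon i' j' k') =
    orbit ((a * (s1^i * s2^j * s3^k)) *\<^sub>R mon i j k + (b * (s1^i' * s2^j' * s3^k')) *\<^sub>R mon i' j' k')"
proof -
  have "pullback (dg (vector [s1, s2, s3])) (a *\<^sub>R mon i j k + b *\<^sub>R mon i' j' k')
      \<in> orbit (a *\<^sub>R mon i j k + b *\<^sub>R mon i' j' k')"
    by (rule pullback_in_orbit) (simp add: det_dg vector_3 assms)
  then show ?thesis
    by (simp add: linear_add [OF linear_pullback] linear_scale [OF linear_pullback] pullback_dg_mon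
        vector_3 orbit_eqI)
qed

lemma sqrt_cases:
  fixes a :: real
  assumes "a\<^sup>2 = x"
  obtains "a = sqrt x" | "a = - sqrt x"
  using assms by (metis abs_if minus_minus real_sqrt_abs)

text \<open>In this row and the following ones with two monomials, the diagonal of the moment matrix and the
  norm determine the squares of the two coefficients, and sign changes of determinant 1 remove the
  ambiguity of signs as far as the parities of the exponents permit.\<close>

lemma normal_form_Beta1:
  assumes "crit p" "mm p = row_beta Beta1" "norm p = 1"
  shows "\<exists>e\<in>\<Union> (row_entries Beta1). orbit p = orbit e"
proof -
  define a b where "a = coeff p (2,0,2)" and "b = coeff p (0,3,1)"
  have p: "p = a *\<^sub>R mon 2 0 2 + b *\<^sub>R mon 0 3 1"
    unfolding a_def b_def using row_expansion [OF assms(1,2)] by blast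
  have "p \<noteq> 0"
    using assms by auto
  then have "a\<^sup>2 = 1/7" "b\<^sup>2 = 1/14"
    using mm_eq_iff [of p "row_type Beta1"] assms(2,3)
    by (simp_all add: row_beta_eq listed_simps p)
  have flip1: "orbit (a *\<^sub>R mon 2 0 2 + b *\<^sub>R mon 0 3 1) = orbit (a *\<^sub>R mon 2 0 2 + (- b) *\<^sub>R mon 0 3 1)" for a b
    using orbit_flip [of "- 1" "1" "- 1" a 2 0 2 b 0 3 1] by simp
  have *: "orbit p = orbit (a *\<^sub>R mon 2 0 2 + sqrt (1/14) *\<^sub>R mon 0 3 1)"
    by (rule sqrt_cases [OF \<open>b\<^sup>2 = 1/14\<close>]) (simp_all only: p flip1 [of a "sqrt (1/14)"])
  have "orbit p = orbit (sqrt (1/7) *\<^sub>R mon 2 0 2 + sqrt (1/14) *\<^sub>R mon 0 3 1) \<or> orbit p = orbit (- sqrt (1/7) *\<^sub>R mon 2 0 2 + sqrt (1/14) *\<^sub>R mon 0 3 1)"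
    by (rule sqrt_cases [OF \<open>a\<^sup>2 = 1/7\<close>]) (simp_all only: * scaleR_minus_left add_uminus_conv_diff simp_thms)
  then show ?thesis
    unfolding row_entries.simps by blast
qed

lemma normal_form_Beta3:
  assumes "crit p" "mm p = row_beta Beta3" "norm p = 1"
  shows "\<exists>e\<in>\<Union> (row_entries Beta3). orbit p = orbit e"
proof -
  define a b where "a = coeff p (1,1,2)" and "b = coeff p (0,4,0)"
  have p: "p = a *\<^sub>R mon 1 1 2 + b *\<^sub>R mon 0 4 0"
    unfolding a_def b_def using row_expansion [OF assms(1,2)] by blast
  have "p \<noteq> 0"
    using assms by auto
  then have "a\<^sup>2 = 3/7" "b\<^sup>2 = 1/168"
    using mm_eq_iff [of p "row_type Beta3"] assms(2,3)
    by (simp_all add: row_beta_eq listed_simps p)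
  have flip1: "orbit (a *\<^sub>R mon 1 1 2 + b *\<^sub>R mon 0 4 0) = orbit ((- a) *\<^sub>R mon 1 1 2 + b *\<^sub>R mon 0 4 0)" for a b
    using orbit_flip [of "1" "- 1" "- 1" a 1 1 2 b 0 4 0] by simp
  have *: "orbit p = orbit (sqrt (3/7) *\<^sub>R mon 1 1 2 + b *\<^sub>R mon 0 4 0)"
    by (rule sqrt_cases [OF \<open>a\<^sup>2 = 3/7\<close>]) (simp_all only: p flip1 [of "sqrt (3/7)" b])
  have "orbit p = orbit (sqrt (3/7) *\<^sub>R mon 1 1 2 + sqrt (1/168) *\<^sub>R mon 0 4 0) \<or> orbit p = orbit (sqrt (3/7) *\<^sub>R mon 1 1 2 - sqrt (1/168) *\<^sub>R mon 0 4 0)"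
    by (rule sqrt_cases [OF \<open>b\<^sup>2 = 1/168\<close>]) (simp_all only: * scaleR_minus_left add_uminus_conv_diff simp_thms)
  then show ?thesis
    unfolding row_entries.simps by blast
qed

lemma normal_form_Beta5:
  assumes "crit p" "mm p = row_beta Beta5" "norm p = 1"
  shows "\<exists>e\<in>\<Union> (row_entries Beta5). orbit p = orbit e"
proof -
  define a b where "a = coeff p (1,0,3)" and "b = coeff p (0,4,0)"
  have p: "p = a *\<^sub>R mon 1 0 3 + b *\<^sub>R mon 0 4 0"
    unfolding a_def b_def using row_expansion [OF assms(1,2)] by blast
  have "p \<noteq> 0"
    using assms by auto
  then have "a\<^sup>2 = 4/39" "b\<^sup>2 = 5/312"
    using mm_eq_iff [of p "row_type Beta5"] assms(2,3)
    by (simp_all add: row_beta_eq listed_simps p)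
  have flip1: "orbit (a *\<^sub>R mon 1 0 3 + b *\<^sub>R mon 0 4 0) = orbit ((- a) *\<^sub>R mon 1 0 3 + b *\<^sub>R mon 0 4 0)" for a b
    using orbit_flip [of "1" "- 1" "- 1" a 1 0 3 b 0 4 0] by simp
  have *: "orbit p = orbit (sqrt (4/39) *\<^sub>R mon 1 0 3 + b *\<^sub>R mon 0 4 0)"
    by (rule sqrt_cases [OF \<open>a\<^sup>2 = 4/39\<close>]) (simp_all only: p flip1 [of "sqrt (4/39)" b])
  have "orbit p = orbit (sqrt (4/39) *\<^sub>R mon 1 0 3 + sqrt (5/312) *\<^sub>R mon 0 4 0) \<or> orbit p = orbit (sqrt (4/39) *\<^sub>R mon 1 0 3 - sqrt (5/312) *\<^sub>R mon 0 4 0)"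
    by (rule sqrt_cases [OF \<open>b\<^sup>2 = 5/312\<close>]) (simp_all only: * scaleR_minus_left add_uminus_conv_diff simp_thms)
  then show ?thesis
    unfolding row_entries.simps by blast
qed

lemma normal_form_Beta7:
  assumes "crit p" "mm p = row_beta Beta7" "norm p = 1"
  shows "\<exists>e\<in>\<Union> (row_entries Beta7). orbit p = orbit e"
proof -
  define a b where "a = coeff p (1,0,3)" and "b = coeff p (0,2,2)"
  have p: "p = a *\<^sub>R mon 1 0 3 + b *\<^sub>R mon 0 2 2"
    unfolding a_def b_def using row_expansion [OF assms(1,2)] by blast
  have "p \<noteq> 0"
    using assms by auto
  then have "a\<^sup>2 = 1/18" "b\<^sup>2 = 1/6"
    using mm_eq_iff [of p "row_type Beta7"] assms(2,3)
    by (simp_all add: row_beta_eq listed_simps p)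
  have flip1: "orbit (a *\<^sub>R mon 1 0 3 + b *\<^sub>R mon 0 2 2) = orbit ((- a) *\<^sub>R mon 1 0 3 + b *\<^sub>R mon 0 2 2)" for a b
    using orbit_flip [of "1" "- 1" "- 1" a 1 0 3 b 0 2 2] by simp
  have *: "orbit p = orbit (sqrt (1/18) *\<^sub>R mon 1 0 3 + b *\<^sub>R mon 0 2 2)"
    by (rule sqrt_cases [OF \<open>a\<^sup>2 = 1/18\<close>]) (simp_all only: p flip1 [of "sqrt (1/18)" b])
  have "orbit p = orbit (sqrt (1/18) *\<^sub>R mon 1 0 3 + sqrt (1/6) *\<^sub>R mon 0 2 2) \<or> orbit p = orbit (sqrt (1/18) *\<^sub>R mon 1 0 3 - sqrt (1/6) *\<^sub>R mon 0 2 2)"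
    by (rule sqrt_cases [OF \<open>b\<^sup>2 = 1/6\<close>]) (simp_all only: * scaleR_minus_left add_uminus_conv_diff simp_thms)
  then show ?thesis
    unfolding row_entries.simps by blast
qed

lemma normal_form_Beta4:
  assumes "crit p" "mm p = row_beta Beta4" "norm p = 1"
  shows "\<exists>e\<in>\<Union> (row_entries Beta4). orbit p = orbit e"
proof -
  define a b where "a = coeff p (1,1,2)" and "b = coeff p (0,3,1)"
  have p: "p = a *\<^sub>R mon 1 1 2 + b *\<^sub>R mon 0 3 1"
    unfolding a_def b_def using row_expansion [OF assms(1,2)] by blast
  have "p \<noteq> 0"
    using assms by auto
  then have "a\<^sup>2 = 5/12" "b\<^sup>2 = 1/36"
    using mm_eq_iff [of p "row_type Beta4"] assms(2,3)
    by (simp_all add: row_beta_eq listed_simps p)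
  have flip1: "orbit (a *\<^sub>R mon 1 1 2 + b *\<^sub>R mon 0 3 1) = orbit ((- a) *\<^sub>R mon 1 1 2 + b *\<^sub>R mon 0 3 1)" for a b
    using orbit_flip [of "1" "- 1" "- 1" a 1 1 2 b 0 3 1] by simp
  have flip2: "orbit (a *\<^sub>R mon 1 1 2 + b *\<^sub>R mon 0 3 1) = orbit ((- a) *\<^sub>R mon 1 1 2 + (- b) *\<^sub>R mon 0 3 1)" for a b
    using orbit_flip [of "- 1" "1" "- 1" a 1 1 2 b 0 3 1] by simp
  have r1: "orbit ((- sqrt (5/12)) *\<^sub>R mon 1 1 2 + sqrt (1/36) *\<^sub>R mon 0 3 1) = orbit (sqrt (5/12) *\<^sub>R mon 1 1 2 + sqrt (1/36) *\<^sub>R mon 0 3 1)"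
    by (rule flip1 [symmetric])
  have r2: "orbit ((- sqrt (5/12)) *\<^sub>R mon 1 1 2 + (- sqrt (1/36)) *\<^sub>R mon 0 3 1) = orbit (sqrt (5/12) *\<^sub>R mon 1 1 2 + sqrt (1/36) *\<^sub>R mon 0 3 1)"
    by (rule flip2 [symmetric])
  have r3: "orbit (sqrt (5/12) *\<^sub>R mon 1 1 2 + (- sqrt (1/36)) *\<^sub>R mon 0 3 1) = orbit (sqrt (5/12) *\<^sub>R mon 1 1 2 + sqrt (1/36) *\<^sub>R mon 0 3 1)"
    using flip1 [of "sqrt (5/12)" "- sqrt (1/36)"] flip2 [of "sqrt (5/12)" "sqrt (1/36)"] by simp
  have "orbit p = orbit (sqrt (5/12) *\<^sub>R mon 1 1 2 + sqrt (1/36) *\<^sub>R mon 0 3 1)"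
    by (rule sqrt_cases [OF \<open>a\<^sup>2 = 5/12\<close>]; rule sqrt_cases [OF \<open>b\<^sup>2 = 1/36\<close>])
      (simp_all only: p r1 r2 r3)
  then show ?thesis
    unfolding row_entries.simps by blast
qed

lemma normal_form_Beta6:
  assumes "crit p" "mm p = row_beta Beta6" "norm p = 1"
  shows "\<exists>e\<in>\<Union> (row_entries Beta6). orbit p = orbit e"
proof -
  define a b where "a = coeff p (1,0,3)" and "b = coeff p (0,3,1)"
  have p: "p = a *\<^sub>R mon 1 0 3 + b *\<^sub>R mon 0 3 1"
    unfolding a_def b_def using row_expansion [OF assms(1,2)] by blast
  have "p \<noteq> 0"
    using assms by auto
  then have "a\<^sup>2 = 1/12" "b\<^sup>2 = 1/12"
    using mm_eq_iff [of p "row_type Beta6"] assms(2,3)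
    by (simp_all add: row_beta_eq listed_simps p)
  have flip1: "orbit (a *\<^sub>R mon 1 0 3 + b *\<^sub>R mon 0 3 1) = orbit ((- a) *\<^sub>R mon 1 0 3 + b *\<^sub>R mon 0 3 1)" for a b
    using orbit_flip [of "1" "- 1" "- 1" a 1 0 3 b 0 3 1] by simp
  have flip2: "orbit (a *\<^sub>R mon 1 0 3 + b *\<^sub>R mon 0 3 1) = orbit (a *\<^sub>R mon 1 0 3 + (- b) *\<^sub>R mon 0 3 1)" for a b
    using orbit_flip [of "- 1" "1" "- 1" a 1 0 3 b 0 3 1] by simp
  have r1: "orbit ((- sqrt (1/12)) *\<^sub>R mon 1 0 3 + sqrt (1/12) *\<^sub>R mon 0 3 1) = orbit (sqrt (1/12) *\<^sub>R mon 1 0 3 + sqrt (1/12) *\<^sub>R mon 0 3 1)"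
    by (rule flip1 [symmetric])
  have r2: "orbit ((- sqrt (1/12)) *\<^sub>R mon 1 0 3 + (- sqrt (1/12)) *\<^sub>R mon 0 3 1) = orbit (sqrt (1/12) *\<^sub>R mon 1 0 3 + sqrt (1/12) *\<^sub>R mon 0 3 1)"
    using flip1 [of "sqrt (1/12)" "- sqrt (1/12)"] flip2 [of "sqrt (1/12)" "sqrt (1/12)"] by simp
  have r3: "orbit (sqrt (1/12) *\<^sub>R mon 1 0 3 + (- sqrt (1/12)) *\<^sub>R mon 0 3 1) = orbit (sqrt (1/12) *\<^sub>R mon 1 0 3 + sqrt (1/12) *\<^sub>R mon 0 3 1)"
    by (rule flip2 [symmetric])
  have "orbit p = orbit (sqrt (1/12) *\<^sub>R mon 1 0 3 + sqrt (1/12) *\<^sub>R mon 0 3 1)"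
    by (rule sqrt_cases [OF \<open>a\<^sup>2 = 1/12\<close>]; rule sqrt_cases [OF \<open>b\<^sup>2 = 1/12\<close>])
      (simp_all only: p r1 r2 r3)
  then show ?thesis
    unfolding row_entries.simps by blast
qed

lemma normal_form_Alpha_yzzz:
  assumes "crit p" "mm p = row_beta Alpha_yzzz" "norm p = 1"
  shows "\<exists>e\<in>\<Union> (row_entries Alpha_yzzz). orbit p = orbit e"
proof -
  define a where "a = coeff p (0,1,3)"
  have p: "p = a *\<^sub>R mon 0 1 3"
    unfolding a_def using row_expansion [OF assms(1,2)] by blast
  have "a\<^sup>2 = 1/6"
    using sum_mass [of p, unfolded assms(3)] by (simp add: listed_simps p)
  moreover have "orbit (- sqrt (1/6) *\<^sub>R mon 0 1 3) = orbit (sqrt (1/6) *\<^sub>R mon 0 1 3)"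
    using orbit_flip [of "- 1" "- 1" "1" "sqrt (1/6)" 0 1 3 0 0 1 3] by simp
  ultimately have "orbit p = orbit (sqrt (1/6) *\<^sub>R mon 0 1 3)"
    by (elim sqrt_cases) (simp_all only: p)
  then show ?thesis
    unfolding row_entries.simps by blast
qed

lemma normal_form_Alpha_zzzz:
  assumes "crit p" "mm p = row_beta Alpha_zzzz" "norm p = 1"
  shows "\<exists>e\<in>\<Union> (row_entries Alpha_zzzz). orbit p = orbit e"
proof -
  define a where "a = coeff p (0,0,4)"
  have p: "p = a *\<^sub>R mon 0 0 4"
    unfolding a_def using row_expansion [OF assms(1,2)] by blast
  have "a\<^sup>2 = 1/24"
    using sum_mass [of p, unfolded assms(3)] by (simp add: listed_simps p)
  then have "p = sqrt (1/24) *\<^sub>R mon 0 0 4 \<or> p = - sqrt (1/24) *\<^sub>R mon 0 0 4"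
    by (elim sqrt_cases) (simp_all only: p simp_thms)
  then show ?thesis
    unfolding row_entries.simps by blast
qed

text \<open>The diagonal of the moment matrix requires both terms to have the same mass, while the entry
  \<open>(1,2)\<close> is a multiple of the product of the coefficients and has to vanish.\<close>

lemma no_critical_point_Beta8:
  assumes "crit p" "mm p = row_beta Beta8"
  shows False
proof -
  define a b where "a = coeff p (1,0,3)" and "b = coeff p (0,1,3)"
  have p: "p = a *\<^sub>R mon 1 0 3 + b *\<^sub>R mon 0 1 3"
    unfolding a_def b_def using row_expansion [OF assms] by blast
  have "p \<noteq> 0"
    using assms by (simp add: crit_def)
  then have "a\<^sup>2 = b\<^sup>2" "a * b = 0"
    using mm_eq_iff [of p "row_type Beta8"] assms(2) norm_sq_eq_mass [of p]
    by (auto simp add: row_beta_eq listed_simps p)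
  then have "a = 0" "b = 0"
    by auto
  then show False
    using p \<open>p \<noteq> 0\<close> by simp
qed

section \<open>Normal forms in rows with a plane of rotations\<close>

text \<open>The three diagonal entries and the entry \<open>(2,3)\<close> of \<open>mm p = - diag b\<close>, cleared of the
  denominator \<open>|p|^2\<close>.\<close>

lemma mm_equations:
  assumes "p \<noteq> 0" "mm p = - dg b"
  defines "n \<equiv> 24 * (coeff p (4,0,0))\<^sup>2 + 6 * (coeff p (3,1,0))\<^sup>2 + 6 * (coeff
      p (3,0,1))\<^sup>2 + 4 * (coeff p (2,2,0))\<^sup>2 + 2 * (coeff p (2,1,1))\<^sup>2 + 4 *
      (coeff p (2,0,2))\<^sup>2 + 6 * (coeff p (1,3,0))\<^sup>2 + 2 * (coeff p (1,2,1))\<^sup>2 +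
      2 * (coeff p (1,1,2))\<^sup>2 + 6 * (coeff p (1,0,3))\<^sup>2 + 24 * (coeff p
      (0,4,0))\<^sup>2 + 6 * (coeff p (0,3,1))\<^sup>2 + 4 * (coeff p (0,2,2))\<^sup>2 + 6 *
      (coeff p (0,1,3))\<^sup>2 + 24 * (coeff p (0,0,4))\<^sup>2"
  shows "96 * (coeff p (4,0,0))\<^sup>2 + 18 * (coeff p (3,1,0))\<^sup>2 + 18 * (coeff p
      (3,0,1))\<^sup>2 + 8 * (coeff p (2,2,0))\<^sup>2 + 4 * (coeff p (2,1,1))\<^sup>2 + 8 *
      (coeff p (2,0,2))\<^sup>2 + 6 * (coeff p (1,3,0))\<^sup>2 + 2 * (coeff p (1,2,1))\<^sup>2 +
      2 * (coeff p (1,1,2))\<^sup>2 + 6 * (coeff p (1,0,3))\<^sup>2 = b$1 * n" (is ?e1)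
    and "6 * (coeff p (3,1,0))\<^sup>2 + 8 * (coeff p (2,2,0))\<^sup>2 + 2 * (coeff p
      (2,1,1))\<^sup>2 + 18 * (coeff p (1,3,0))\<^sup>2 + 4 * (coeff p (1,2,1))\<^sup>2 + 2 *
      (coeff p (1,1,2))\<^sup>2 + 96 * (coeff p (0,4,0))\<^sup>2 + 18 * (coeff p (0,3,1))\<^sup>2
      + 8 * (coeff p (0,2,2))\<^sup>2 + 6 * (coeff p (0,1,3))\<^sup>2 = b$2 * n" (is ?e2)
    and "6 * (coeff p (3,0,1))\<^sup>2 + 2 * (coeff p (2,1,1))\<^sup>2 + 8 * (coeff p
      (2,0,2))\<^sup>2 + 2 * (coeff p (1,2,1))\<^sup>2 + 4 * (coeff p (1,1,2))\<^sup>2 + 18 *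
      (coeff p (1,0,3))\<^sup>2 + 6 * (coeff p (0,3,1))\<^sup>2 + 8 * (coeff p (0,2,2))\<^sup>2 +
      18 * (coeff p (0,1,3))\<^sup>2 + 96 * (coeff p (0,0,4))\<^sup>2 = b$3 * n" (is ?e3)
    and "6 * (coeff p (3,1,0) * coeff p (3,0,1)) + 4 * (coeff p (2,2,0) * coeff p (2,1,1)) + 4 *
      (coeff p (2,1,1) * coeff p (2,0,2)) + 6 * (coeff p (1,3,0) * coeff p (1,2,1)) + 4 * (coeff p
      (1,2,1) * coeff p (1,1,2)) + 6 * (coeff p (1,1,2) * coeff p (1,0,3)) + 24 * (coeff p (0,4,0)
      * coeff p (0,3,1)) + 12 * (coeff p (0,3,1) * coeff p (0,2,2)) + 12 * (coeff p (0,2,2) *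
      coeff p (0,1,3)) + 24 * (coeff p (0,1,3) * coeff p (0,0,4)) = 0" (is ?e4)
proof -
  have n: "(norm p)\<^sup>2 = n"
    unfolding norm_sq_eq_mass n_def sum_expos_4 mass_def by (simp add: fact_numeral)
  note eqs = mm_eq_iff [THEN iffD1, OF assms(1,2), unfolded n sum_expos_4 mass_def off_def wt_def]
  show ?e1
    using eqs [THEN conjunct1] by (simp add: fact_numeral algebra_simps)
  show ?e2
    using eqs [THEN conjunct2, THEN conjunct1] by (simp add: fact_numeral algebra_simps)
  show ?e3
    using eqs [THEN conjunct2, THEN conjunct2, THEN conjunct1] by (simp add: fact_numeral algebra_simps)
  show ?e4
    using eqs [THEN conjunct2, THEN conjunct2, THEN conjunct2, THEN conjunct2, THEN conjunct2] by (simp add: fact_numeral algebra_simps eval_nat_numeral)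
qed

lemma row_norm_gt:
  assumes "r \<noteq> Beta0"
  shows "row_type r \<bullet> row_type r > 16/3"
  using assms by (cases r) (simp_all add: inner_vec_def sum_3 vector_3)

lemma orbit_scale_row:
  assumes "crit p" "mm p = row_beta r" "r \<noteq> Beta0" "c > 0"
  shows "orbit (c *\<^sub>R p) = orbit p"
  using orbit_scaleR [of p "row_type r" c] assms row_norm_gt [of r] by (simp add: row_beta_eq orbit_eqI)

text \<open>A rotation in a plane on which the type is constant commutes with the moment matrix.\<close>

lemma rotated_critical_point:
  assumes p: "crit p" "mm p = row_beta r" and ij: "i \<noteq> j" "row_type r $ i = row_type r $ j"
    and cs: "c\<^sup>2 + s\<^sup>2 = 1"
  defines "q \<equiv> pullback (plane_rotation i j c s) p"
  shows "crit q" "mm q = row_beta r" "orbit q = orbit p"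
proof -
  let ?R = "plane_rotation i j c s" and ?b = "row_type r"
  have R: "orthogonal_matrix ?R"
    using ij(1) cs by (rule orthogonal_plane_rotation)
  have "dg ?b ** ?R = ?R ** dg ?b"
    using ij by (auto simp: vec_eq_iff dg_mult_left dg_mult_right plane_rotation_def)
  then have comm: "transpose ?R ** dg ?b ** ?R = dg ?b"
    by (metis R matrix_mul_assoc matrix_mul_lid orthogonal_matrixD(1))
  show "crit q"
    unfolding q_def by (rule crit_pullback [OF R p(1)])
  show "mm q = row_beta r"
    by (simp add: q_def mm_pullback [OF R] p(2) row_beta_eq matrix_mult_uminus comm)
  show "orbit q = orbit p"
    unfolding q_def by (rule orbit_eqI [OF orbit_pullback_orthogonal [OF R]])
qed

lemma rotation_23: "(plane_rotation 2 3 c s *v u) $ 1 = u$1" "(plane_rotation 2 3 c s *v u) $ 2 = c * u$2 - s * u$3"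
  "(plane_rotation 2 3 c s *v u) $ 3 = s * u$2 + c * u$3"
  and rotation_12: "(plane_rotation 1 2 c s *v u) $ 1 = c * u$1 - s * u$2" "(plane_rotation 1 2 c s *v u) $ 2 = s * u$1 + c * u$2"
  "(plane_rotation 1 2 c s *v u) $ 3 = u$3"
  by (simp_all add: plane_rotation_def matrix_vector_mult_def sum_3)

lemma zero_of_sign_change:
  fixes f :: "real \<Rightarrow> real"
  assumes "continuous_on {a..b} f" "a \<le> b" "f b = - f a"
  obtains x where "f x = 0"
proof -
  have "\<exists>x. a \<le> x \<and> x \<le> b \<and> f x = 0"
  proof (cases "f a \<le> 0")
    case True
    then show ?thesis
      using assms by (intro IVT') auto
  next
    case False
    then show ?thesis
      using assms by (intro IVT2') auto
  qed
  then show thesis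
    using that by blast
qed

lemma eval_mon_4:
  "i + j + k = 4 \<Longrightarrow> eval (mon i j k) u = (u$1)^i * (u$2)^j * (u$3)^k"
  by (rule eval_mon) (simp add: expos_def)

text \<open>The substitution is diagonal; its entries \<open>\<surd>3 / s^2\<close>, \<open>s\<close>, \<open>s / \<surd>3\<close> have product 1 and equalise the two
  coefficients, and \<open>s\<close> is chosen to make them 1 in absolute value.\<close>

lemma Beta2_cubic:
  assumes "d \<noteq> 0" "e = 1 \<or> e = - 1"
  shows "orbit (d *\<^sub>R mon 1 3 0 + (3 * e * d) *\<^sub>R mon 1 1 2) = orbit (mon 1 3 0 + e *\<^sub>R mon 1 1 2)"
proof -
  define s where "s = 1 / (sqrt 3 * d)"
  have s: "s \<noteq> 0" "sqrt 3 * s * d = 1"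
    using assms by (simp_all add: s_def)
  have r3: "sqrt 3 * sqrt 3 = (3::real)"
    by simp
  have 1: "(sqrt 3 / s^2) * s * (s / sqrt 3) = 1"
    using s by (simp add: power2_eq_square)
  have 2: "d * ((sqrt 3 / s^2)^1 * s^3 * (s / sqrt 3)^0) = 1"
    using s by (simp add: power2_eq_square power3_eq_cube mult_ac)
  have 3: "(3 * e * d) * ((sqrt 3 / s^2)^1 * s^1 * (s / sqrt 3)^2) = e"
    using s by (simp add: power2_eq_square power_divide mult_ac)
  show ?thesis
    using orbit_flip [OF 1, of d 1 3 0 "3 * e * d" 1 1 2] unfolding 2 3 by simp
qed

text \<open>A binary cubic has a real linear factor, so a rotation of \<open>y, z\<close> removes the term \<open>x z^3\<close>. Then the
  moment equations force the coefficient of \<open>x y^2 z\<close> to vanish and determine the ratio of the others up to sign.\<close>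

lemma normal_form_Beta2:
  assumes "crit p" "mm p = row_beta Beta2"
  shows "\<exists>e\<in>\<Union> (row_entries Beta2). orbit p = orbit e"
proof -
  define a b c d where "a = coeff p (1,0,3)" and "b = coeff p (1,1,2)" and "c = coeff p (1,2,1)"
    and "d = coeff p (1,3,0)"
  have p: "p = a *\<^sub>R mon 1 0 3 + b *\<^sub>R mon 1 1 2 + c *\<^sub>R mon 1 2 1 + d *\<^sub>R mon 1 3 0"
    unfolding a_def b_def c_def d_def using row_expansion(2) [OF assms] by blast
  \<comment> \<open>The coefficient of \<open>x z^3\<close> after rotation by \<open>t\<close>. It changes sign under a half turn.\<close>
  let ?f = "\<lambda>t. a * (cos t)^3 - b * sin t * (cos t)^2 + c * (sin t)^2 * cos t - d * (sin t)^3"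
  have "continuous_on {0..pi} ?f"
    by (intro continuous_intros)
  then obtain t where t: "?f t = 0"
    by (rule zero_of_sign_change) auto
  define q where "q = pullback (plane_rotation 2 3 (cos t) (sin t)) p"
  have q: "crit q" "mm q = row_beta Beta2" "orbit q = orbit p"
    unfolding q_def by (rule rotated_critical_point [OF assms]; simp add: vector_3)+
  define b' c' d' where "b' = coeff q (1,1,2)" and "c' = coeff q (1,2,1)" and "d' = coeff q (1,3,0)"
  have "coeff q (1,0,3) = eval q (vector [1, 0, 1])"
    by (subst (2) row_expansion(2) [OF q(1,2) refl]) (simp add: eval_mon_4 vector_3)
  also have "\<dots> = ?f t"
    unfolding q_def eval_pullback p by (simp add: eval_mon_4 rotation_23 vector_3 power2_eq_square power3_eq_cube)
  finally have "coeff q (1,0,3) = 0"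
    using t by simp
  then have qf: "q = b' *\<^sub>R mon 1 1 2 + c' *\<^sub>R mon 1 2 1 + d' *\<^sub>R mon 1 3 0"
    using row_expansion(2) [OF q(1,2)] by (simp add: b'_def c'_def d'_def)
  have "q \<noteq> 0"
    using q by (simp add: crit_def)
  note mom = mm_equations [OF \<open>q \<noteq> 0\<close> q(2) [unfolded row_beta_eq]]
  have b'2: "b'\<^sup>2 = 9 * d'\<^sup>2 + c'\<^sup>2"
    using mom(2,3) by (simp add: qf coeff_mon expos_def vector_3)
  have "6 * (c' * d') + 4 * (b' * c') = 0"
    using mom(4) by (simp add: qf coeff_mon expos_def mult_ac)
  then have "c' * (3 * d' + 2 * b') = 0"
    by (simp only: distrib_left mult_ac)
  note eqs = b'2 this
  have c': "c' = 0"
  proof (rule ccontr)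
    assume "c' \<noteq> 0"
    then have "2 * b' = - (3 * d')"
      using eqs(2) by simp
    then have "(2 * b')\<^sup>2 = (3 * d')\<^sup>2"
      by simp
    then have "27 * d'\<^sup>2 + 4 * c'\<^sup>2 = 0"
      using eqs(1) by (simp add: power_mult_distrib)
    then show False
      using \<open>c' \<noteq> 0\<close> by (simp add: add_nonneg_eq_0_iff)
  qed
  then have "b'\<^sup>2 = (3 * d')\<^sup>2"
    using eqs by (simp add: power_mult_distrib)
  then obtain e where e: "e = 1 \<or> e = - 1" "b' = 3 * e * d'"
    unfolding power2_eq_iff by force
  then have "d' \<noteq> 0"
    using qf \<open>q \<noteq> 0\<close> c' by auto
  have "q = d' *\<^sub>R mon 1 3 0 + (3 * e * d') *\<^sub>R mon 1 1 2"
    unfolding qf c' e(2) by simp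
  then have "orbit p = orbit (mon 1 3 0 + e *\<^sub>R mon 1 1 2)"
    using Beta2_cubic [OF \<open>d' \<noteq> 0\<close> e(1)] q(3) by simp
  then have "orbit p = orbit (mon 1 3 0 + mon 1 1 2) \<or> orbit p = orbit (mon 1 3 0 - mon 1 1 2)"
    using e(1) by (elim disjE)
      (simp_all only: scaleR_one scaleR_minus1_left add_uminus_conv_diff simp_thms)
  then show ?thesis
    unfolding row_entries.simps by blast
qed

definition swap_xy :: "real^3^3" where
  "swap_xy = vector [vector [0, 1, 0], vector [1, 0, 0], vector [0, 0, - 1]]"

definition swap_yz :: "real^3^3" where
  "swap_yz = vector [vector [- 1, 0, 0], vector [0, 0, 1], vector [0, 1, 0]]"

text \<open>Up to the scaling of \<open>x\<close> that restores determinant 1, this is \<open>(y, z) \<mapsto> (y + z, y - z)\<close>.\<close>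

definition turn_yz :: "real^3^3" where
  "turn_yz = vector [vector [- 1/2, 0, 0], vector [0, 1, 1], vector [0, 1, - 1]]"

lemma det_moves: "det swap_xy = 1" "det swap_yz = 1" "det turn_yz = 1"
  by (simp_all add: det_3 swap_xy_def swap_yz_def turn_yz_def vector_3)

lemma eval_moves:
  "(swap_xy *v u)$1 = u$2" "(swap_xy *v u)$2 = u$1" "(swap_xy *v u)$3 = - (u$3)"
  "(swap_yz *v u)$1 = - (u$1)" "(swap_yz *v u)$2 = u$3" "(swap_yz *v u)$3 = u$2"
  "(turn_yz *v u)$1 = - (u$1 / 2)" "(turn_yz *v u)$2 = u$2 + u$3" "(turn_yz *v u)$3 = u$2 - u$3"
  by (simp_all add: matrix_vector_mult_def sum_3 swap_xy_def swap_yz_def turn_yz_def vector_3)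

text \<open>A rotation of \<open>x, y\<close> diagonalises the binary quadratic form that multiplies \<open>z^2\<close>; the moment
  equations make its eigenvalues equal in absolute value.\<close>

lemma normal_form_Alpha_xyzz:
  assumes "crit p" "mm p = row_beta Alpha_xyzz"
  shows "\<exists>e\<in>\<Union> (row_entries Alpha_xyzz). orbit p = orbit e"
proof -
  define a b c where "a = coeff p (2,0,2)" and "b = coeff p (1,1,2)" and "c = coeff p (0,2,2)"
  have p: "p = a *\<^sub>R mon 2 0 2 + b *\<^sub>R mon 1 1 2 + c *\<^sub>R mon 0 2 2"
    unfolding a_def b_def c_def using row_expansion(5) [OF assms] by blast
  \<comment> \<open>The coefficient of \<open>x y z^2\<close> after a rotation. It changes sign under a quarter turn.\<close>
  let ?f = "\<lambda>x y. b * (x^2 - y^2) + 2 * (c - a) * y * x"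
  have "continuous_on {0..pi/2} (\<lambda>t. ?f (cos t) (sin t))"
    by (intro continuous_intros)
  then obtain t where "?f (cos t) (sin t) = 0"
    by (rule zero_of_sign_change) auto
  then obtain x y where xy: "x\<^sup>2 + y\<^sup>2 = 1" "?f x y = 0"
    using sin_cos_squared_add2 by blast
  define q where "q = pullback (plane_rotation 1 2 x y) p"
  have q: "crit q" "mm q = row_beta Alpha_xyzz" "orbit q = orbit p"
    unfolding q_def by (rule rotated_critical_point [OF assms]; simp add: vector_3 xy)+
  define a' c' where "a' = coeff q (2,0,2)" and "c' = coeff q (0,2,2)"
  have qe: "eval q u = (a' * (u$1)^2 + coeff q (1,1,2) * u$1 * u$2 + c' * (u$2)^2) * (u$3)^2" for u
    by (subst row_expansion(5) [OF q(1,2) refl]) (simp add: eval_mon_4 a'_def c'_def algebra_simps)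
  have "coeff q (1,1,2) = eval q (vector [1, 1, 1]) - eval q (vector [1, 0, 1]) - eval q (vector [0, 1, 1])"
    unfolding qe by (simp add: vector_3)
  also have "\<dots> = ?f x y"
    unfolding q_def eval_pullback p
    by (simp add: eval_mon_4 rotation_12 vector_3 power2_eq_square algebra_simps)
  finally have "coeff q (1,1,2) = 0"
    using xy by simp
  then have qf: "q = a' *\<^sub>R mon 2 0 2 + c' *\<^sub>R mon 0 2 2"
    using row_expansion(5) [OF q(1,2)] by (simp add: a'_def c'_def)
  have "q \<noteq> 0"
    using q by (simp add: crit_def)
  then have "a'\<^sup>2 = c'\<^sup>2"
    using mm_equations(1,2) [OF \<open>q \<noteq> 0\<close> q(2) [unfolded row_beta_eq]]
    by (simp add: qf coeff_mon expos_def vector_3)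
  then have "c' = a' \<or> c' = - a'"
    unfolding power2_eq_iff by auto
  then have "a' \<noteq> 0"
    using qf \<open>q \<noteq> 0\<close> by auto
  have scale: "orbit ((1 / \<bar>a'\<bar>) *\<^sub>R q) = orbit p"
    using orbit_scale_row [OF q(1,2), of "1 / \<bar>a'\<bar>"] \<open>a' \<noteq> 0\<close> q(3) by simp
  have "pullback swap_xy (mon 2 0 2 - mon 0 2 2) = - mon 2 0 2 + mon 0 2 2"
    by (rule quartic_eq_evalI) (simp add: eval_mon_4 eval_moves)
  then have swap: "orbit (- mon 2 0 2 + mon 0 2 2) = orbit (mon 2 0 2 - mon 0 2 2)"
    using pullback_in_orbit [OF det_moves(1)] orbit_eqI by metis
  have "(1 / \<bar>a'\<bar>) *\<^sub>R q = (a' / \<bar>a'\<bar>) *\<^sub>R mon 2 0 2 + (c' / \<bar>a'\<bar>) *\<^sub>R mon 0 2 2"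
    by (simp add: qf scaleR_add_right)
  moreover have "a' / \<bar>a'\<bar> = 1 \<or> a' / \<bar>a'\<bar> = - 1"
    using \<open>a' \<noteq> 0\<close> by (auto simp: abs_if)
  moreover have "c' / \<bar>a'\<bar> = a' / \<bar>a'\<bar> \<or> c' / \<bar>a'\<bar> = - (a' / \<bar>a'\<bar>)"
    using \<open>c' = a' \<or> c' = - a'\<close> by auto
  ultimately have "(1 / \<bar>a'\<bar>) *\<^sub>R q = mon 2 0 2 + mon 0 2 2 \<or> (1 / \<bar>a'\<bar>) *\<^sub>R q = - (mon 2 0 2 + mon 0 2 2)
      \<or> (1 / \<bar>a'\<bar>) *\<^sub>R q = mon 2 0 2 - mon 0 2 2 \<or> (1 / \<bar>a'\<bar>) *\<^sub>R q = - mon 2 0 2 + mon 0 2 2"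
    by (elim disjE) simp_all
  then have "orbit p = orbit (mon 2 0 2 + mon 0 2 2) \<or> orbit p = orbit (- (mon 2 0 2 + mon 0 2 2))
      \<or> orbit p = orbit (mon 2 0 2 - mon 0 2 2)"
    unfolding scale [symmetric] using swap by (elim disjE) (simp_all only: simp_thms)
  then show ?thesis
    unfolding row_entries.simps by blast
qed

section \<open>Normal forms of binary quartics\<close>

lemma yyzz_pullback_turn:
  "pullback turn_yz (a *\<^sub>R mon 0 4 0 + b *\<^sub>R mon 0 2 2 + a *\<^sub>R mon 0 0 4)
    = (2 * a + b) *\<^sub>R mon 0 4 0 + (12 * a - 2 * b) *\<^sub>R mon 0 2 2 + (2 * a + b) *\<^sub>R mon 0 0 4"
  by (rule quartic_eq_evalI)
    (simp add: eval_mon_4 eval_moves power4_eq_xxxx power2_eq_square algebra_simps)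

lemma yyzz_pullback_swap:
  "pullback swap_yz (a *\<^sub>R mon 0 4 0 + b *\<^sub>R mon 0 2 2 + c *\<^sub>R mon 0 0 4)
    = c *\<^sub>R mon 0 4 0 + b *\<^sub>R mon 0 2 2 + a *\<^sub>R mon 0 0 4"
  by (rule quartic_eq_evalI) (simp add: eval_mon_4 eval_moves)

lemma yyzz_entries:
  "mon 0 4 0 + (2 * t) *\<^sub>R mon 0 2 2 + mon 0 0 4 \<in> \<Union> (row_entries Alpha_yyzz)"
  "- 1 \<le> t \<Longrightarrow> - (mon 0 4 0 + (2 * t) *\<^sub>R mon 0 2 2 + mon 0 0 4) \<in> \<Union> (row_entries Alpha_yyzz)"
  "mon 0 4 0 + (2 * t) *\<^sub>R mon 0 2 2 - mon 0 0 4 \<in> \<Union> (row_entries Alpha_yyzz)"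
  unfolding row_entries.simps by blast+

text \<open>After scaling, the extreme coefficients are \<open>\<plusminus>1\<close>. Exchanging \<open>y\<close> and \<open>z\<close> identifies the two cases of
  opposite signs. For two negative signs and a middle coefficient \<open>2 t\<close> with \<open>t > 1\<close>, the form is positive at
  \<open>(1, 1)\<close>, and \<open>turn_yz\<close> turns it into a form of the first family.\<close>

lemma yyzz_even_orbit:
  assumes "a \<noteq> 0" "c = a \<or> c = - a"
  shows "\<exists>e\<in>\<Union> (row_entries Alpha_yyzz).
    orbit (a *\<^sub>R mon 0 4 0 + b *\<^sub>R mon 0 2 2 + c *\<^sub>R mon 0 0 4) = orbit e"
proof -
  let ?p = "\<lambda>a b c. a *\<^sub>R mon 0 4 0 + b *\<^sub>R mon 0 2 2 + c *\<^sub>R mon 0 0 4"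
  have scale: "orbit (?p (k * a) (k * b) (k * c)) = orbit (?p a b c)"
    if "k > 0" "a \<noteq> 0" "a\<^sup>2 = c\<^sup>2" for k a b c
  proof -
    have "k *\<^sub>R ?p a b c = ?p (k * a) (k * b) (k * c)"
      by (simp add: scaleR_add_right)
    then show ?thesis
      using orbit_scale_row [of "?p a b c" Alpha_yyzz k] listed_Alpha_yyzz [OF that(2,3) refl] that(1)
      by simp
  qed
  have turn: "orbit (?p (2 * a + b) (12 * a - 2 * b) (2 * a + b)) = orbit (?p a b a)" for a b
    using orbit_eqI [OF pullback_in_orbit [OF det_moves(3), of "?p a b a"]]
    by (simp only: yyzz_pullback_turn)
  have swap: "orbit (?p c b a) = orbit (?p a b c)" for a b c
    using orbit_eqI [OF pullback_in_orbit [OF det_moves(2), of "?p a b c"]]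
    by (simp only: yyzz_pullback_swap)
  define t where "t = b / (2 * \<bar>a\<bar>)"
  define x z where "x = a / \<bar>a\<bar>" and "z = c / \<bar>a\<bar>"
  have x: "x = 1 \<or> x = - 1"
    using assms(1) by (cases "a > 0") (simp_all add: x_def)
  have "z = x \<or> z = - x"
    using assms(2) by (auto simp: x_def z_def)
  with x have z: "z = 1 \<or> z = - 1"
    by auto
  have "a\<^sup>2 = c\<^sup>2"
    using assms(2) by auto
  have norm: "orbit (?p a b c) = orbit (?p x (2 * t) z)"
  proof -
    have "x = 1 / \<bar>a\<bar> * a" "2 * t = 1 / \<bar>a\<bar> * b" "z = 1 / \<bar>a\<bar> * c"
      by (simp_all add: x_def z_def t_def)
    then show ?thesis
      using scale [OF _ assms(1) \<open>a\<^sup>2 = c\<^sup>2\<close>, of "1 / \<bar>a\<bar>" b] assms(1) by (simp only:) simp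
  qed
  consider "x = 1" "z = 1" | "x = 1" "z = - 1" | "x = - 1" "z = 1" | "x = - 1" "z = - 1"
    using x z by blast
  then show ?thesis
  proof cases
    case 1
    have "orbit (?p a b c) = orbit (mon 0 4 0 + (2 * t) *\<^sub>R mon 0 2 2 + mon 0 0 4)"
      unfolding norm 1 by simp
    then show ?thesis
      using yyzz_entries(1) by blast
  next
    case 2
    have "orbit (?p a b c) = orbit (mon 0 4 0 + (2 * t) *\<^sub>R mon 0 2 2 - mon 0 0 4)"
      unfolding norm 2 by simp
    then show ?thesis
      using yyzz_entries(3) by blast
  next
    case 3
    have "orbit (?p a b c) = orbit (?p 1 (2 * t) (- 1))"
      unfolding norm 3 by (rule swap)
    also have "?p 1 (2 * t) (- 1) = mon 0 4 0 + (2 * t) *\<^sub>R mon 0 2 2 - mon 0 0 4"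
      by simp
    finally show ?thesis
      using yyzz_entries(3) by blast
  next
    case 4
    show ?thesis
    proof (cases "t \<le> 1")
      case True
      have "?p (- 1) (2 * t) (- 1) = - (mon 0 4 0 + (2 * (- t)) *\<^sub>R mon 0 2 2 + mon 0 0 4)"
        by simp
      moreover have "- (mon 0 4 0 + (2 * (- t)) *\<^sub>R mon 0 2 2 + mon 0 0 4) \<in> \<Union> (row_entries Alpha_yyzz)"
        using True by (intro yyzz_entries(2)) simp
      ultimately show ?thesis
        unfolding norm 4 by metis
    next
      case False
      have "\<exists>u. d * (2 * u) = x" if "d \<noteq> 0" for d x :: real
        by (rule exI [of _ "x / (2 * d)"]) (use that in simp)
      moreover have "2 * t - 2 \<noteq> 0"
        using False by simp
      ultimately obtain u where u: "(2 * t - 2) * (2 * u) = 12 * (- 1) - 2 * (2 * t)"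
        by blast
      have "2 * (- 1) + 2 * t = (2 * t - 2) * 1"
        by simp
      then have "orbit (?p (- 1) (2 * t) (- 1)) = orbit (?p ((2 * t - 2) * 1) ((2 * t - 2) * (2 * u)) ((2 * t - 2) * 1))"
        using turn [of "- 1" "2 * t"] unfolding u by (simp only:)
      also have "\<dots> = orbit (?p 1 (2 * u) 1)"
        using False by (intro scale) auto
      also have "?p 1 (2 * u) 1 = mon 0 4 0 + (2 * u) *\<^sub>R mon 0 2 2 + mon 0 0 4"
        by simp
      finally show ?thesis
        unfolding norm 4 using yyzz_entries(1) by blast
    qed
  qed
qed

text \<open>With \<open>a\<^sub>i\<close> the coefficient of \<open>y^(4-i) z^i\<close>, the odd coefficients must be rotated away. The
  moment equations only relate the coefficients, so the rotation is found in two steps: one by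
  continuity that gives \<open>a\<^sub>3 = - a\<^sub>1\<close>, after which the moment equations yield \<open>a\<^sub>0 = a\<^sub>4\<close> unless \<open>a\<^sub>1 = 0\<close>. For
  \<open>a\<^sub>1 \<noteq> 0\<close> the form is then \<open>\<alpha> (y^2 + z^2)^2\<close> plus a harmonic form of degree 4, and a rotation by a
  quarter of its phase makes the harmonic part a multiple of \<open>Re (y + i z)^4\<close>.\<close>

lemma normal_form_Alpha_yyzz:
  assumes "crit p" "mm p = row_beta Alpha_yyzz"
  shows "\<exists>e\<in>\<Union> (row_entries Alpha_yyzz). orbit p = orbit e"
proof -
  have bal: "8 * (coeff q (0,4,0))\<^sup>2 + (coeff q (0,3,1))\<^sup>2 = 8 * (coeff q (0,0,4))\<^sup>2 + (coeff q (0,1,3))\<^sup>2"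
    "2 * coeff q (0,4,0) * coeff q (0,3,1) + coeff q (0,3,1) * coeff q (0,2,2)
      + coeff q (0,2,2) * coeff q (0,1,3) + 2 * coeff q (0,1,3) * coeff q (0,0,4) = 0"
    if "crit q" "mm q = row_beta Alpha_yyzz" for q
  proof -
    define a0 a1 a2 a3 a4 where "a0 = coeff q (0,4,0)" and "a1 = coeff q (0,3,1)" and "a2 = coeff q (0,2,2)"
      and "a3 = coeff q (0,1,3)" and "a4 = coeff q (0,0,4)"
    have q: "q = a0 *\<^sub>R mon 0 4 0 + a1 *\<^sub>R mon 0 3 1 + a2 *\<^sub>R mon 0 2 2 + a3 *\<^sub>R mon 0 1 3 + a4 *\<^sub>R mon 0 0 4"
      unfolding a0_def a1_def a2_def a3_def a4_def using row_expansion(9) [OF that] by blast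
    have "q \<noteq> 0"
      using that by (simp add: crit_def)
    note mom = mm_equations [OF this that(2) [unfolded row_beta_eq]]
    let ?n = "24 * a0\<^sup>2 + 6 * a1\<^sup>2 + 4 * a2\<^sup>2 + 6 * a3\<^sup>2 + 24 * a4\<^sup>2"
    have "96 * a0\<^sup>2 + 18 * a1\<^sup>2 + 8 * a2\<^sup>2 + 6 * a3\<^sup>2 = 2 * ?n"
      using mom(2) by (simp add: q coeff_mon expos_def vector_3 algebra_simps)
    moreover have "6 * a1\<^sup>2 + 8 * a2\<^sup>2 + 18 * a3\<^sup>2 + 96 * a4\<^sup>2 = 2 * ?n"
      using mom(3) by (simp add: q coeff_mon expos_def vector_3 algebra_simps)
    ultimately have "8 * a0\<^sup>2 + a1\<^sup>2 = 8 * a4\<^sup>2 + a3\<^sup>2"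
      by linarith
    moreover have "24 * (a0 * a1) + 12 * (a1 * a2) + 12 * (a2 * a3) + 24 * (a3 * a4) = 0"
      using mom(4) by (simp add: q coeff_mon expos_def algebra_simps)
    then have "2 * a0 * a1 + a1 * a2 + a2 * a3 + 2 * a3 * a4 = 0"
      by linarith
    ultimately show "8 * (coeff q (0,4,0))\<^sup>2 + (coeff q (0,3,1))\<^sup>2 = 8 * (coeff q (0,0,4))\<^sup>2 + (coeff q (0,1,3))\<^sup>2"
    "2 * coeff q (0,4,0) * coeff q (0,3,1) + coeff q (0,3,1) * coeff q (0,2,2)
      + coeff q (0,2,2) * coeff q (0,1,3) + 2 * coeff q (0,1,3) * coeff q (0,0,4) = 0"
      by (simp_all add: a0_def a1_def a2_def a3_def a4_def)
  qed
  have ev: "eval q u = coeff q (0,4,0) * (u$2)^4 + coeff q (0,3,1) * (u$2)^3 * u$3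
      + coeff q (0,2,2) * (u$2)^2 * (u$3)^2 + coeff q (0,1,3) * u$2 * (u$3)^3 + coeff q (0,0,4) * (u$3)^4"
    if "crit q" "mm q = row_beta Alpha_yyzz" for q u
    by (subst row_expansion(9) [OF that refl]) (simp add: eval_mon_4)
  have even: "\<exists>e\<in>\<Union> (row_entries Alpha_yyzz). orbit q = orbit e"
    if q: "crit q" "mm q = row_beta Alpha_yyzz" "coeff q (0,3,1) = 0" "coeff q (0,1,3) = 0" for q
  proof -
    define a b c where "a = coeff q (0,4,0)" and "b = coeff q (0,2,2)" and "c = coeff q (0,0,4)"
    have qf: "q = a *\<^sub>R mon 0 4 0 + b *\<^sub>R mon 0 2 2 + c *\<^sub>R mon 0 0 4"
      unfolding a_def b_def c_def using row_expansion(9) [OF q(1,2) refl] q(3,4) by simp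
    have "a\<^sup>2 = c\<^sup>2"
      using bal(1) [OF q(1,2)] q(3,4) by (simp add: a_def c_def)
    then have ca: "c = a \<or> c = - a"
      unfolding power2_eq_iff by auto
    show ?thesis
    proof (cases "a = 0")
      case True
      then have "b \<noteq> 0"
        using q(1) qf ca by (auto simp: crit_def)
      have "pullback turn_yz q = b *\<^sub>R mon 0 4 0 + (- 2 * b) *\<^sub>R mon 0 2 2 + b *\<^sub>R mon 0 0 4"
        using yyzz_pullback_turn [of 0 b] True ca by (simp add: qf)
      then have "orbit q = orbit (b *\<^sub>R mon 0 4 0 + (- 2 * b) *\<^sub>R mon 0 2 2 + b *\<^sub>R mon 0 0 4)"
        using orbit_eqI [OF pullback_in_orbit [OF det_moves(3)]] by metis
      then show ?thesis
        using yyzz_even_orbit [OF \<open>b \<noteq> 0\<close>, of b "- 2 * b"] by simp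
    next
      case False
      then show ?thesis
        using yyzz_even_orbit [OF False ca] by (simp add: qf)
    qed
  qed
  \<comment> \<open>For \<open>a\<^sub>3 = - a\<^sub>1\<close> the values at \<open>(1, 1)\<close> and \<open>(1, -1)\<close> must agree; a quarter turn exchanges
      these two points up to sign.\<close>
  define P where "P = (\<lambda>y z. coeff p (0,4,0) * y^4 + coeff p (0,3,1) * y^3 * z
      + coeff p (0,2,2) * y^2 * z^2 + coeff p (0,1,3) * y * z^3 + coeff p (0,0,4) * z^4)"
  let ?f = "\<lambda>t. P (cos t - sin t) (sin t + cos t) - P (cos t + sin t) (sin t - cos t)"
  have "continuous_on {0..pi/2} ?f"
    unfolding P_def by (intro continuous_intros)
  then obtain t where t: "?f t = 0"
    by (rule zero_of_sign_change) (auto simp: P_def)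
  define q where "q = pullback (plane_rotation 2 3 (cos t) (sin t)) p"
  have q: "crit q" "mm q = row_beta Alpha_yyzz" "orbit q = orbit p"
    unfolding q_def by (rule rotated_critical_point [OF assms]; simp add: vector_3)+
  have "2 * (coeff q (0,3,1) + coeff q (0,1,3)) = eval q (vector [0, 1, 1]) - eval q (vector [0, 1, - 1])"
    by (simp add: ev [OF q(1,2)] vector_3)
  also have "\<dots> = ?f t"
    unfolding q_def eval_pullback ev [OF assms] P_def rotation_23 by (simp add: vector_3)
  finally have a3: "coeff q (0,1,3) = - coeff q (0,3,1)"
    using t by simp
  show ?thesis
  proof (cases "coeff q (0,3,1) = 0")
    case True
    then show ?thesis
      using even [OF q(1,2)] a3 q(3) by simp
  next
    case False
    define a0 a1 a2 where "a0 = coeff q (0,4,0)" and "a1 = coeff q (0,3,1)" and "a2 = coeff q (0,2,2)"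
    have "2 * a1 * (a0 - coeff q (0,0,4)) = 0"
      using bal(2) [OF q(1,2)] a3 by (simp add: a0_def a1_def algebra_simps)
    then have a4: "coeff q (0,0,4) = a0"
      using False by (simp add: a1_def)
    have q_ev: "eval q u = a0 * ((u$2)^4 + (u$3)^4) + a2 * (u$2)^2 * (u$3)^2 + a1 * ((u$2)^3 * u$3 - u$2 * (u$3)^3)" for u
      unfolding ev [OF q(1,2)] a4 a3 a0_def a1_def a2_def by (simp add: algebra_simps)
    \<comment> \<open>The form is \<open>\<alpha> (y^2 + z^2)^2 + \<beta> Re (y + i z)^4 + \<gamma> Im (y + i z)^4\<close>.\<close>
    define \<alpha> \<beta> \<gamma> where "\<alpha> = (6 * a0 + a2) / 8" and "\<beta> = (2 * a0 - a2) / 8" and "\<gamma> = a1 / 4"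
    have a0: "a0 = \<alpha> + \<beta>" and a2: "a2 = 2 * \<alpha> - 6 * \<beta>" and a1: "a1 = 4 * \<gamma>"
      by (simp_all add: \<alpha>_def \<beta>_def \<gamma>_def field_simps)
    \<comment> \<open>Modulus and phase of the harmonic part; \<open>C\<close> and \<open>S\<close> below are its cosine and sine,
        expressed in those of a quarter of the angle.\<close>
    define \<rho> where "\<rho> = sqrt (\<beta>\<^sup>2 + \<gamma>\<^sup>2)"
    have "\<gamma> \<noteq> 0"
      using False by (simp add: \<gamma>_def a1_def)
    then have \<rho>: "\<rho> > 0"
      by (simp add: \<rho>_def add_nonneg_pos)
    have \<rho>2: "\<beta>\<^sup>2 + \<gamma>\<^sup>2 = \<rho>\<^sup>2"
      by (simp add: \<rho>_def)
    have "(\<beta> / \<rho>)\<^sup>2 + (\<gamma> / \<rho>)\<^sup>2 = (\<beta>\<^sup>2 + \<gamma>\<^sup>2) / \<rho>\<^sup>2"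
      by (simp add: power_divide add_divide_distrib)
    then have "(\<beta> / \<rho>)\<^sup>2 + (\<gamma> / \<rho>)\<^sup>2 = 1"
      unfolding \<rho>2 using \<rho> by simp
    then obtain \<theta> where \<theta>: "\<beta> / \<rho> = cos \<theta>" "\<gamma> / \<rho> = sin \<theta>"
      using sincos_total_2pi by metis
    define c s where "c = cos (\<theta> / 4)" and "s = sin (\<theta> / 4)"
    have cs: "c\<^sup>2 + s\<^sup>2 = 1"
      by (simp add: c_def s_def)
    define C S where "C = c^4 - 6 * c^2 * s^2 + s^4" and "S = 4 * (c^3 * s - c * s^3)"
    have half: "cos (2 * (\<theta> / 4)) = c^2 - s^2" "sin (2 * (\<theta> / 4)) = 2 * s * c"
      unfolding cos_double sin_double c_def s_def by simp_all
    have full: "cos \<theta> = (cos (2 * (\<theta> / 4)))^2 - (sin (2 * (\<theta> / 4)))^2"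
      "sin \<theta> = 2 * sin (2 * (\<theta> / 4)) * cos (2 * (\<theta> / 4))"
      using cos_double [of "2 * (\<theta> / 4)"] sin_double [of "2 * (\<theta> / 4)"] by simp_all
    have "(c^2 - s^2)^2 - (2 * s * c)^2 = C" "2 * (2 * s * c) * (c^2 - s^2) = S"
      unfolding C_def S_def
      by (simp_all add: power4_eq_xxxx power3_eq_cube power2_eq_square algebra_simps)
    then have "cos \<theta> = C" "sin \<theta> = S"
      by (simp_all only: half full)
    then have bg: "\<beta> = \<rho> * C" "\<gamma> = \<rho> * S"
      using \<theta> \<rho> by (simp_all add: field_simps)
    have CS: "C^2 + S^2 = 1"
      using \<open>cos \<theta> = C\<close> \<open>sin \<theta> = S\<close> sin_cos_squared_add2 [of \<theta>] by simp
    define Re Im :: "real \<Rightarrow> real \<Rightarrow> real" where "Re = (\<lambda>y z. y^4 - 6 * y^2 * z^2 + z^4)"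
      and "Im = (\<lambda>y z. 4 * (y^3 * z - y * z^3))"
    have rotRe: "Re (c * y - s * z) (s * y + c * z) = C * Re y z - S * Im y z"
      and rotIm: "Im (c * y - s * z) (s * y + c * z) = C * Im y z + S * Re y z" for y z
      unfolding Re_def Im_def C_def S_def
      by (simp_all add: power4_eq_xxxx power3_eq_cube power2_eq_square algebra_simps)
    have rotN: "(c * y - s * z)^2 + (s * y + c * z)^2 = y^2 + z^2" for y z
    proof -
      have "(c * y - s * z)^2 + (s * y + c * z)^2 = (c^2 + s^2) * (y^2 + z^2)"
        by (simp add: power2_eq_square algebra_simps)
      then show ?thesis
        by (simp add: cs)
    qed
    have q_harm: "eval q u = \<alpha> * ((u$2)^2 + (u$3)^2)^2 + \<beta> * Re (u$2) (u$3) + \<gamma> * Im (u$2) (u$3)" for u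
      unfolding q_ev a0 a1 a2 Re_def Im_def
      by (simp add: power4_eq_xxxx power3_eq_cube power2_eq_square algebra_simps)
    define r where "r = pullback (plane_rotation 2 3 c s) q"
    have r: "crit r" "mm r = row_beta Alpha_yyzz" "orbit r = orbit q"
      unfolding r_def by (rule rotated_critical_point [OF q(1,2)]; simp add: vector_3 cs)+
    have "r = (\<alpha> + \<rho>) *\<^sub>R mon 0 4 0 + (2 * \<alpha> - 6 * \<rho>) *\<^sub>R mon 0 2 2 + (\<alpha> + \<rho>) *\<^sub>R mon 0 0 4"
    proof (rule quartic_eq_evalI)
      fix u :: "real^3"
      have "eval r u = \<alpha> * ((u$2)^2 + (u$3)^2)^2
          + \<rho> * C * (C * Re (u$2) (u$3) - S * Im (u$2) (u$3)) + \<rho> * S * (C * Im (u$2) (u$3) + S * Re (u$2) (u$3))"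
        unfolding r_def eval_pullback q_harm rotation_23 bg rotRe rotIm rotN by simp
      also have "\<dots> = \<alpha> * ((u$2)^2 + (u$3)^2)^2 + \<rho> * (C^2 + S^2) * Re (u$2) (u$3)"
        by (simp add: power2_eq_square algebra_simps)
      also have "\<dots> = \<alpha> * ((u$2)^2 + (u$3)^2)^2 + \<rho> * ((u$2)^4 - 6 * (u$2)^2 * (u$3)^2 + (u$3)^4)"
        by (simp add: CS Re_def)
      also have "\<dots> = eval ((\<alpha> + \<rho>) *\<^sub>R mon 0 4 0 + (2 * \<alpha> - 6 * \<rho>) *\<^sub>R mon 0 2 2 + (\<alpha> + \<rho>) *\<^sub>R mon 0 0 4) u"
        by (simp add: eval_mon_4 power4_eq_xxxx power2_eq_square algebra_simps)
      finally show "eval r u = eval ((\<alpha> + \<rho>) *\<^sub>R mon 0 4 0 + (2 * \<alpha> - 6 * \<rho>) *\<^sub>R mon 0 2 2 + (\<alpha> + \<rho>) *\<^sub>R mon 0 0 4) u" .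
    qed
    then have "coeff r (0,3,1) = 0" "coeff r (0,1,3) = 0"
      by (simp_all add: coeff_mon)
    then show ?thesis
      using even [OF r(1,2)] r(3) q(3) by simp
  qed
qed

text \<open>Positive scaling does not leave the orbit, so \<open>p\<close> may be assumed to have norm 1.\<close>

theorem normal_form:
  assumes "crit p" "mm p = row_beta r" "r \<noteq> Beta0"
  shows "\<exists>e\<in>\<Union> (row_entries r). orbit p = orbit e"
proof -
  have "p \<noteq> 0"
    using assms by (simp add: crit_def)
  define q where "q = (1 / norm p) *\<^sub>R p"
  have q: "crit q" "mm q = row_beta r" "norm q = 1" "orbit q = orbit p"
    using \<open>p \<noteq> 0\<close> assms orbit_scale_row [of p r "1 / norm p"] by (simp_all add: q_def crit_scaleR)
  have "\<exists>e\<in>\<Union> (row_entries r). orbit q = orbit e"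
  proof (cases r)
    case Beta0
    then show ?thesis
      using assms by simp
  next
    case Beta1
    show ?thesis
      unfolding Beta1 by (rule normal_form_Beta1 [OF q(1) q(2) [unfolded Beta1] q(3)])
  next
    case Beta3
    show ?thesis
      unfolding Beta3 by (rule normal_form_Beta3 [OF q(1) q(2) [unfolded Beta3] q(3)])
  next
    case Beta4
    show ?thesis
      unfolding Beta4 by (rule normal_form_Beta4 [OF q(1) q(2) [unfolded Beta4] q(3)])
  next
    case Beta5
    show ?thesis
      unfolding Beta5 by (rule normal_form_Beta5 [OF q(1) q(2) [unfolded Beta5] q(3)])
  next
    case Beta6
    show ?thesis
      unfolding Beta6 by (rule normal_form_Beta6 [OF q(1) q(2) [unfolded Beta6] q(3)])
  next
    case Beta7
    show ?thesis
      unfolding Beta7 by (rule normal_form_Beta7 [OF q(1) q(2) [unfolded Beta7] q(3)])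
  next
    case Alpha_yzzz
    show ?thesis
      unfolding Alpha_yzzz by (rule normal_form_Alpha_yzzz [OF q(1) q(2) [unfolded Alpha_yzzz] q(3)])
  next
    case Alpha_zzzz
    show ?thesis
      unfolding Alpha_zzzz by (rule normal_form_Alpha_zzzz [OF q(1) q(2) [unfolded Alpha_zzzz] q(3)])
  next
    case Beta2
    show ?thesis
      unfolding Beta2 by (rule normal_form_Beta2 [OF q(1) q(2) [unfolded Beta2]])
  next
    case Alpha_xyzz
    show ?thesis
      unfolding Alpha_xyzz by (rule normal_form_Alpha_xyzz [OF q(1) q(2) [unfolded Alpha_xyzz]])
  next
    case Alpha_yyzz
    show ?thesis
      unfolding Alpha_yyzz by (rule normal_form_Alpha_yyzz [OF q(1) q(2) [unfolded Alpha_yyzz]])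
  next
    case Beta8
    then show ?thesis
      using no_critical_point_Beta8 q by blast
  qed
  then show ?thesis
    using q by simp
qed

section \<open>The minimal row\<close>

lemma diagonal_representative:
  assumes "crit q"
  obtains p b where "orbit p = orbit q" "crit p" "mm p = - dg b" "b$1 \<le> b$2" "b$2 \<le> b$3"
proof -
  have "transpose (- mm q) = - mm q"
    using transpose_mm [of q] by (simp add: transpose_def vec_eq_iff)
  then obtain k b where k: "orthogonal_matrix k" "transpose k ** (- mm q) ** k = dg b" "b$1 \<le> b$2" "b$2 \<le> b$3"
    by (rule sorted_spectral)
  have "mm (pullback k q) = - dg b"
    unfolding mm_pullback [OF k(1)] k(2) [symmetric] by (simp add: matrix_mult_uminus)
  then show thesis
    using that [OF orbit_eqI [OF orbit_pullback_orthogonal [OF k(1)]] crit_pullback [OF k(1) assms]] k(3,4)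
    by blast
qed

lemma row_beta_Beta0: "row_beta Beta0 = - (4/3) *\<^sub>R mat 1"
  by (simp add: row_beta_def vec_eq_iff mat_def forall_3 vector_3)

lemma crit_if_mm_Beta0:
  assumes "p \<noteq> 0" "mm p = row_beta Beta0"
  shows "crit p"
proof -
  have "lie (mm p) p = - (4/3) *\<^sub>R (4 *\<^sub>R p)"
    unfolding assms(2) row_beta_Beta0 lie_linear_simps lie_mat_1 ..
  moreover have "mm p \<bullet> mm p = 16/3"
    by (simp add: assms(2) row_beta_Beta0 inner_mat_1)
  ultimately show ?thesis
    using assms(1) by (simp add: crit_def)
qed

text \<open>A quartic at which the lower bound \<open>16/3\<close> for \<open>|mm p|^2\<close> is attained.\<close>

lemma Fermat_quartic: "mm (mon 4 0 0 + mon 0 4 0 + mon 0 0 4) = row_beta Beta0" "mon 4 0 0 + mon 0 4 0 + mon 0 0 4 \<noteq> 0"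
proof -
  let ?p = "mon 4 0 0 + mon 0 4 0 + mon 0 0 4"
  show "?p \<noteq> 0"
  proof
    assume "?p = 0"
    then have "coeff ?p (4,0,0) = 0"
      by simp
    then show False
      by (simp add: coeff_mon expos_def)
  qed
  then show "mm ?p = row_beta Beta0"
    unfolding row_beta_eq mm_eq_iff [OF \<open>?p \<noteq> 0\<close>] norm_sq_eq_mass by (simp add: listed_simps)
qed

text \<open>As the trace is constant, \<open>|mm q|^2\<close> is \<open>16/3\<close> plus the squared distance of \<open>mm q\<close> from the scalar matrix
  \<open>- 4/3\<close>.\<close>

lemma global_minimum_iff: "global_minimum sym_gl p \<longleftrightarrow> p \<noteq> 0 \<and> mm p = row_beta Beta0"
proof -
  have excess: "mm q \<bullet> mm q = 16/3 + (norm (mm q - row_beta Beta0))\<^sup>2" if "q \<noteq> 0" for q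
    using inner_mm_mat_1 [OF that]
    by (simp add: row_beta_Beta0 power2_norm_eq_inner inner_add_left inner_add_right
        inner_commute [of "mat 1" "mm q"] inner_mat_1)
  show ?thesis
  proof
    assume min: "global_minimum sym_gl p"
    then have p: "p \<noteq> 0"
      by (simp add: global_minimum_def)
    have "mm p \<bullet> mm p \<le> mm (mon 4 0 0 + mon 0 4 0 + mon 0 0 4) \<bullet> mm (mon 4 0 0 + mon 0 4 0 + mon 0 0 4)"
      using min Fermat_quartic(2) unfolding global_minimum_def moment_norm_gl by blast
    then have "(norm (mm p - row_beta Beta0))\<^sup>2 \<le> 0"
      unfolding excess [OF p] excess [OF Fermat_quartic(2)] by (simp add: Fermat_quartic(1))
    then show "p \<noteq> 0 \<and> mm p = row_beta Beta0"
      using p by simp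
  next
    assume p: "p \<noteq> 0 \<and> mm p = row_beta Beta0"
    have "mm p \<bullet> mm p \<le> mm q \<bullet> mm q" if "q \<noteq> 0" for q
      unfolding excess [OF that] excess [OF conjunct1 [OF p]] using p by simp
    then show "global_minimum sym_gl p"
      using p unfolding global_minimum_def moment_norm_gl by blast
  qed
qed

lemma minimal_row: "p \<in> stratum (row_beta Beta0) \<and> crit p \<longleftrightarrow> global_minimum sym_gl p"
proof -
  have "k ** row_beta Beta0 ** transpose k = row_beta Beta0" if "orthogonal_matrix k" for k
    unfolding row_beta_Beta0
    by (simp add: matrix_scalar_ac scalar_matrix_assoc [symmetric] matrix_mult_uminus orthogonal_matrixD [OF that])
  then show ?thesis
    unfolding global_minimum_iff using critical_in_stratum_iff [of p "row_beta Beta0"] crit_if_mm_Beta0 [of p]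
      orthogonal_matrix_id by (metis crit_def)
qed

section \<open>Critical representatives of the entries\<close>

lemma listed_critical:
  assumes "r \<noteq> Beta2" "E \<in> row_entries r" "p \<in> E"
  shows "crit p \<and> mm p = row_beta r"
proof (cases r)
  case Beta1
  then show ?thesis
    using assms listed_Beta1 [of "sqrt (1/7)" "sqrt (1/14)" p] listed_Beta1 [of "- sqrt (1/7)" "sqrt (1/14)" p] by auto
next
  case Beta3
  then show ?thesis
    using assms listed_Beta3 [of "sqrt (3/7)" "sqrt (1/168)" p] listed_Beta3 [of "sqrt (3/7)" "- sqrt (1/168)" p] by auto
next
  case Beta4
  then show ?thesis
    using assms listed_Beta4 [of "sqrt (5/12)" "sqrt (1/36)" p] by auto
next
  case Beta5
  then show ?thesis
    using assms listed_Beta5 [of "sqrt (4/39)" "sqrt (5/312)" p] listed_Beta5 [of "sqrt (4/39)" "- sqrt (5/312)" p] by auto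
next
  case Beta6
  then show ?thesis
    using assms listed_Beta6 [of "sqrt (1/12)" "sqrt (1/12)" p] by auto
next
  case Beta7
  then show ?thesis
    using assms listed_Beta7 [of "sqrt (1/18)" "sqrt (1/6)" p] listed_Beta7 [of "sqrt (1/18)" "- sqrt (1/6)" p] by auto
next
  case Alpha_xyzz
  then show ?thesis
    using assms listed_Alpha_xyzz [of 1 1 p] listed_Alpha_xyzz [of "- 1" "- 1" p] listed_Alpha_xyzz [of 1 "- 1" p] by auto
next
  case Alpha_yyzz
  then consider t where "p = 1 *\<^sub>R mon 0 4 0 + (2 * t) *\<^sub>R mon 0 2 2 + 1 *\<^sub>R mon 0 0 4"
    | t where "p = (- 1) *\<^sub>R mon 0 4 0 + (- 2 * t) *\<^sub>R mon 0 2 2 + (- 1) *\<^sub>R mon 0 0 4"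
    | t where "p = 1 *\<^sub>R mon 0 4 0 + (2 * t) *\<^sub>R mon 0 2 2 + (- 1) *\<^sub>R mon 0 0 4"
    using assms by auto
  then show ?thesis
    unfolding Alpha_yyzz
  proof cases
    case 1
    then show "crit p \<and> mm p = row_beta Alpha_yyzz"
      by (rule listed_Alpha_yyzz [rotated 2]) simp_all
  next
    case 2
    then show "crit p \<and> mm p = row_beta Alpha_yyzz"
      by (rule listed_Alpha_yyzz [rotated 2]) simp_all
  next
    case 3
    then show "crit p \<and> mm p = row_beta Alpha_yyzz"
      by (rule listed_Alpha_yyzz [rotated 2]) simp_all
  qed
next
  case Alpha_yzzz
  then show ?thesis
    using assms listed_Alpha_yzzz [of "sqrt (1/6)" p] by auto
next
  case Alpha_zzzz
  then show ?thesis
    using assms listed_Alpha_zzzz [of "sqrt (1/24)" p] listed_Alpha_zzzz [of "- sqrt (1/24)" p] by auto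
qed (use assms in auto)

lemma Beta2_representative:
  assumes "E \<in> row_entries Beta2" "p \<in> E"
  shows "\<exists>q\<in>orbit p. crit q \<and> mm q = row_beta Beta2"
proof -
  obtain e :: real where e: "e = 1 \<or> e = - 1" "p = mon 1 3 0 + e *\<^sub>R mon 1 1 2"
  proof -
    have "p = mon 1 3 0 + 1 *\<^sub>R mon 1 1 2 \<or> p = mon 1 3 0 + (- 1) *\<^sub>R mon 1 1 2"
      using assms by auto
    then show thesis
      using that by blast
  qed
  let ?q = "1 *\<^sub>R mon 1 3 0 + (3 * e * 1) *\<^sub>R mon 1 1 2"
  have "(3 * e * 1)\<^sup>2 = 9 * 1\<^sup>2"
    using e(1) by auto
  then have "crit ?q \<and> mm ?q = row_beta Beta2"
    by (intro listed_Beta2 [of 1 "3 * e * 1"]) auto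
  moreover have "?q \<in> orbit p"
    unfolding orbit_eq_iff [symmetric] e(2) using Beta2_cubic [of 1 e] e(1) by simp
  ultimately show ?thesis
    by blast
qed

lemma critical_representative:
  assumes "E \<in> row_entries r" "e \<in> E"
  obtains q where "crit q" "mm q = row_beta r" "orbit q = orbit e"
proof (cases "r = Beta2")
  case True
  then show ?thesis
    using Beta2_representative assms that orbit_eqI by blast
next
  case False
  then show ?thesis
    using listed_critical [OF False assms] that by blast
qed

section \<open>Different entries have different orbits\<close>

lemma row_type_sorted: "row_type r $ 1 \<le> row_type r $ 2" "row_type r $ 2 \<le> row_type r $ 3"
  by (cases r; simp add: vector_3)+

lemma row_norms:
  "row_type Beta0 \<bullet> row_type Beta0 = 16/3" "row_type Beta1 \<bullet> row_type Beta1 = 38/7"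
  "row_type Beta2 \<bullet> row_type Beta2 = 11/2" "row_type Beta3 \<bullet> row_type Beta3 = 40/7"
  "row_type Beta4 \<bullet> row_type Beta4 = 35/6" "row_type Alpha_xyzz \<bullet> row_type Alpha_xyzz = 6"
  "row_type Beta5 \<bullet> row_type Beta5 = 80/13" "row_type Beta6 \<bullet> row_type Beta6 = 13/2"
  "row_type Beta7 \<bullet> row_type Beta7 = 22/3" "row_type Alpha_yyzz \<bullet> row_type Alpha_yyzz = 8"
  "row_type Beta8 \<bullet> row_type Beta8 = 19/2" "row_type Alpha_yzzz \<bullet> row_type Alpha_yzzz = 10"
  "row_type Alpha_zzzz \<bullet> row_type Alpha_zzzz = 16"
  by (simp_all add: inner_vec_def sum_3 vector_3)

lemma row_norm_inject: "row_type r \<bullet> row_type r = row_type s \<bullet> row_type s \<Longrightarrow> r = s"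
  by (cases r; cases s; simp only: row_norms; simp)

text \<open>The norms of the types in the table are pairwise different.\<close>

lemma row_eq_if_same_orbit:
  assumes "crit p" "mm p = row_beta r" "crit q" "mm q = row_beta s" "orbit p = orbit q"
  shows "r = s"
  by (rule row_norm_inject, rule same_orbit_moment_norm [of p _ q])
    (use assms row_type_sorted in \<open>auto simp: row_beta_eq\<close>)

lemma orbit_eq_pullbackD:
  assumes "orbit p = orbit q"
  shows "\<exists>A. det A = 1 \<and> q = pullback A p"
proof -
  have "q \<in> orbit p"
    unfolding assms by (rule orbit_self)
  then show ?thesis
    by (auto simp: orbit_eq_pullback)
qed

lemma orbit_uminus:
  assumes "orbit p = orbit q"
  shows "orbit (- p) = orbit (- q)"
proof -
  obtain A where A: "det A = 1" "q = pullback A p"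
    using orbit_eq_pullbackD [OF assms] by blast
  then have "- q = pullback A (- p)"
    by (simp add: linear_neg [OF linear_pullback])
  then show ?thesis
    using orbit_eqI [OF pullback_in_orbit [OF A(1)], of "- p"] by simp
qed

lemma orbit_neq_by_sign:
  assumes "\<And>u. eval p u \<ge> 0" "eval q u < 0"
  shows "orbit p \<noteq> orbit q"
  using assms orbit_eq_pullbackD [of p q] eval_pullback by (metis not_less)

text \<open>If \<open>q\<close> were a substitution of \<open>p\<close>, its zeros would lie in two planes, and a line with three of them
  would be contained in one of the planes, contrary to \<open>eval q u \<noteq> 0\<close>.\<close>

lemma orbit_neq_by_lines:
  assumes zero: "\<And>u. eval p u = 0 \<longleftrightarrow> f \<bullet> u = 0 \<or> g \<bullet> u = 0"
    and roots: "eval q (u + a *\<^sub>R v) = 0" "eval q (u + b *\<^sub>R v) = 0" "eval q (u + c *\<^sub>R v) = 0"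
    and distinct: "a \<noteq> b" "a \<noteq> c" "b \<noteq> c" and "eval q u \<noteq> 0"
  shows "orbit p \<noteq> orbit q"
proof
  assume "orbit p = orbit q"
  then obtain A where "q = pullback A p"
    using orbit_eq_pullbackD by blast
  then have A: "eval q u = eval p (A *v u)" for u
    by simp
  have root: "f \<bullet> (A *v u) + s * (f \<bullet> (A *v v)) = 0 \<or> g \<bullet> (A *v u) + s * (g \<bullet> (A *v v)) = 0"
    if "eval q (u + s *\<^sub>R v) = 0" for s
    using that unfolding A zero
    by (simp add: matrix_vector_right_distrib matrix_vector_mult_scaleR inner_add_right)
  have twice: "x = 0" if "x + s * y = 0" "x + t * y = 0" "s \<noteq> t" for x y s t :: real
  proof -
    have "(s - t) * y = (x + s * y) - (x + t * y)"
      by (simp add: algebra_simps)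
    then have "(s - t) * y = 0"
      using that by simp
    then show ?thesis
      using that by simp
  qed
  have "f \<bullet> (A *v u) = 0 \<or> g \<bullet> (A *v u) = 0"
    using root [OF roots(1)] root [OF roots(2)] root [OF roots(3)] twice distinct by metis
  then show False
    using \<open>eval q u \<noteq> 0\<close> unfolding A zero by blast
qed

lemma orbit_neq_by_even_coeff:
  assumes p: "crit p" "mm p = row_beta r" and q: "crit q" "mm q = row_beta r"
    and r: "row_type r $ 1 < row_type r $ 2" "row_type r $ 2 < row_type r $ 3"
    and "even i" "even j" "even k" "coeff p (i,j,k) * coeff q (i,j,k) < 0"
  shows "orbit p \<noteq> orbit q"
proof
  assume "orbit p = orbit q"
  moreover have "even (expo (i,j,k) a)" for a
    using assms by simp
  ultimately have "coeff p (i,j,k) * coeff q (i,j,k) \<ge> 0"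
    using same_orbit_even_sign [of p "row_type r" q "(i,j,k)"] assms unfolding row_beta_eq by blast
  then show False
    using assms by simp
qed

text \<open>The roots are \<open>\<plusminus>\<surd>(- t \<plusminus> \<surd>(t^2 - 1))\<close>.\<close>

lemma yyzz_line_roots:
  assumes "t < - 1"
  obtains a b c where "a \<noteq> b" "a \<noteq> c" "b \<noteq> c" "a^4 + 2 * t * a^2 + 1 = (0::real)"
    "b^4 + 2 * t * b^2 + 1 = 0" "c^4 + 2 * t * c^2 + 1 = 0"
proof -
  define m where "m = sqrt (t\<^sup>2 - 1)"
  have "(- t) * (- t) > 1 * 1"
    using assms by (intro mult_strict_mono) auto
  then have "t\<^sup>2 > 1"
    by (simp add: power2_eq_square)
  then have m: "m > 0" "m\<^sup>2 = t\<^sup>2 - 1"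
    by (simp_all add: m_def)
  then have "m\<^sup>2 < (- t)\<^sup>2"
    by simp
  then have "m < - t"
    by (rule power2_less_imp_less) (use assms in simp)
  have root: "x^4 + 2 * t * x^2 + 1 = 0" if "x\<^sup>2 = - t + m \<or> x\<^sup>2 = - t - m" for x
  proof -
    have "x^4 + 2 * t * x^2 + 1 = (x\<^sup>2 + t)\<^sup>2 - (t\<^sup>2 - 1)"
      by (simp add: power4_eq_xxxx power2_eq_square algebra_simps)
    then show ?thesis
      using that m(2) by auto
  qed
  have sq: "(sqrt (- t + m))\<^sup>2 = - t + m" "(- sqrt (- t + m))\<^sup>2 = - t + m" "(sqrt (- t - m))\<^sup>2 = - t - m"
    using m(1) \<open>m < - t\<close> by simp_all
  show thesis
  proof (rule that [of "sqrt (- t + m)" "- sqrt (- t + m)" "sqrt (- t - m)"])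
    show "sqrt (- t + m) \<noteq> - sqrt (- t + m)" "sqrt (- t + m) \<noteq> sqrt (- t - m)"
      "- sqrt (- t + m) \<noteq> sqrt (- t - m)"
      using m(1) \<open>m < - t\<close> assms by (simp_all add: real_sqrt_eq_iff) (smt (verit) real_sqrt_gt_zero)+
  qed (rule root, simp only: sq simp_thms)+
qed

text \<open>As a quadratic in \<open>y^2\<close> the form has one positive and one negative root for \<open>z = 1\<close>.\<close>

lemma yyzz_two_lines:
  obtains \<rho> :: real where "\<And>y z. y^4 + 2 * t * y^2 * z^2 - z^4 = 0 \<longleftrightarrow> y - \<rho> * z = 0 \<or> y + \<rho> * z = 0"
proof -
  define m where "m = sqrt (t\<^sup>2 + 1)"
  have m2: "m\<^sup>2 = t\<^sup>2 + 1"
    by (simp add: m_def add_nonneg_nonneg)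
  have "\<bar>t\<bar> < m"
    unfolding m_def by (rule real_less_rsqrt) simp
  then have pos: "m - t > 0" "m + t > 0"
    by linarith+
  define \<rho> where "\<rho> = sqrt (m - t)"
  have \<rho>: "\<rho>\<^sup>2 = m - t"
    using pos by (simp add: \<rho>_def)
  have "y^4 + 2 * t * y^2 * z^2 - z^4 = 0 \<longleftrightarrow> y - \<rho> * z = 0 \<or> y + \<rho> * z = 0" for y z
  proof -
    have mt: "(m - t) * (m + t) = 1"
      using m2 by (simp add: power2_eq_square algebra_simps)
    have "y^4 + 2 * t * y^2 * z^2 - z^4 = (y\<^sup>2 - (m - t) * z\<^sup>2) * (y\<^sup>2 + (m + t) * z\<^sup>2) + ((m - t) * (m + t) - 1) * z^4"
      by (simp add: power4_eq_xxxx power2_eq_square algebra_simps)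
    also have "\<dots> = ((y - \<rho> * z) * (y + \<rho> * z)) * (y\<^sup>2 + (m + t) * z\<^sup>2)"
    proof -
      have "(y - \<rho> * z) * (y + \<rho> * z) = y\<^sup>2 - \<rho>\<^sup>2 * z\<^sup>2"
        by (simp add: power2_eq_square algebra_simps)
      then show ?thesis
        unfolding mt \<rho> by simp
    qed
    finally have fac: "y^4 + 2 * t * y^2 * z^2 - z^4 = ((y - \<rho> * z) * (y + \<rho> * z)) * (y\<^sup>2 + (m + t) * z\<^sup>2)" .
    have "y = 0 \<and> z = 0" if "y\<^sup>2 + (m + t) * z\<^sup>2 = 0"
      using that pos(2) by (simp add: add_nonneg_eq_0_iff)
    then show ?thesis
      unfolding fac by auto
  qed
  then show thesis
    by (rule that)
qed

text \<open>The form \<open>y^4 + 2 t y^2 z^2 + z^4\<close> is nonnegative for \<open>t \<ge> -1\<close> and has at least three zeros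
  on the line \<open>z = 1\<close> for \<open>t < -1\<close>, whereas \<open>y^4 + 2 t y^2 z^2 - z^4\<close> takes both signs and vanishes only on
  two planes in space.\<close>

lemma yyzz_families_distinct:
  fixes s t :: real
  defines "P \<equiv> \<lambda>t. mon 0 4 0 + (2 * t) *\<^sub>R mon 0 2 2 + mon 0 0 4"
    and "Q \<equiv> \<lambda>t. mon 0 4 0 + (2 * t) *\<^sub>R mon 0 2 2 - mon 0 0 4"
  shows "- 1 \<le> t \<Longrightarrow> orbit (P s) \<noteq> orbit (- P t)" "- 1 \<le> t \<Longrightarrow> orbit (Q s) \<noteq> orbit (- P t)"
    and "orbit (P s) \<noteq> orbit (Q t)"
proof -
  have P: "eval (P t) u = (u$2)^4 + 2 * t * (u$2)^2 * (u$3)^2 + (u$3)^4"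
    and Q: "eval (Q t) u = (u$2)^4 + 2 * t * (u$2)^2 * (u$3)^2 - (u$3)^4" for t u
    by (simp_all add: P_def Q_def eval_mon_4)
  have nonneg: "eval (P t) u \<ge> 0" if "- 1 \<le> t" for t u
  proof -
    have "eval (P t) u = ((u$2)\<^sup>2 - (u$3)\<^sup>2)\<^sup>2 + 2 * (t + 1) * ((u$2)\<^sup>2 * (u$3)\<^sup>2)"
      unfolding P by (simp add: power4_eq_xxxx power2_eq_square algebra_simps)
    then show ?thesis
      using that by simp
  qed
  show "orbit (P s) \<noteq> orbit (- P t)" if "- 1 \<le> t"
    using orbit_neq_by_sign [of "P t" "- P s" "vector [0, 1, 0]"] nonneg [OF that] orbit_uminus [of "P s" "- P t"]
    by (auto simp: P vector_3)
  show "orbit (Q s) \<noteq> orbit (- P t)" if "- 1 \<le> t"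
    using orbit_neq_by_sign [of "P t" "- Q s" "vector [0, 1, 0]"] nonneg [OF that] orbit_uminus [of "Q s" "- P t"]
    by (auto simp: Q vector_3)
  show "orbit (P s) \<noteq> orbit (Q t)"
  proof (cases "- 1 \<le> s")
    case True
    then show ?thesis
      using orbit_neq_by_sign [of "P s" "Q t" "vector [0, 0, 1]"] nonneg by (simp add: Q vector_3)
  next
    case False
    then obtain a b c where abc: "a \<noteq> b" "a \<noteq> c" "b \<noteq> c" "a^4 + 2 * s * a^2 + 1 = 0"
      "b^4 + 2 * s * b^2 + 1 = 0" "c^4 + 2 * s * c^2 + 1 = 0"
      using yyzz_line_roots [of s] by (metis not_le)
    obtain \<rho> where \<rho>: "\<And>y z. y^4 + 2 * t * y^2 * z^2 - z^4 = 0 \<longleftrightarrow> y - \<rho> * z = 0 \<or> y + \<rho> * z = 0"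
      by (rule yyzz_two_lines [of t]) blast
    have "orbit (Q t) \<noteq> orbit (P s)"
    proof (rule orbit_neq_by_lines [where f = "vector [0, 1, - \<rho>]" and g = "vector [0, 1, \<rho>]"
          and u = "vector [0, 0, 1]" and v = "vector [0, 1, 0]" and a = a and b = b and c = c])
      show "eval (Q t) u = 0 \<longleftrightarrow> vector [0, 1, - \<rho>] \<bullet> u = 0 \<or> vector [0, 1, \<rho>] \<bullet> u = 0" for u
        unfolding Q \<rho> by (simp add: inner_vec_def sum_3 vector_3)
    qed (use abc in \<open>simp_all add: P vector_3\<close>)
    then show ?thesis
      by metis
  qed
qed

text \<open>The zeros of \<open>x y (y^2 + z^2)\<close> lie on two planes, those of \<open>x y (y^2 - z^2)\<close> on four. The
  line through \<open>(-5, 1, 0)\<close> in direction \<open>(1, 0, 1)\<close> meets three of the latter, but does not lie in any of them.\<close>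

lemma cubic_entries_distinct: "orbit (mon 1 3 0 + mon 1 1 2) \<noteq> orbit (mon 1 3 0 - mon 1 1 2)"
proof (rule orbit_neq_by_lines [where f = "vector [1, 0, 0]" and g = "vector [0, 1, 0]"
      and u = "vector [- 5, 1, 0]" and v = "vector [1, 0, 1]" and a = 5 and b = 1 and c = "- 1"])
  fix u :: "real^3"
  have "eval (mon 1 3 0 + mon 1 1 2) u = u$1 * (u$2 * ((u$2)\<^sup>2 + (u$3)\<^sup>2))"
    by (simp add: eval_mon_4 power2_eq_square power3_eq_cube algebra_simps)
  then show "eval (mon 1 3 0 + mon 1 1 2) u = 0 \<longleftrightarrow> vector [1, 0, 0] \<bullet> u = 0 \<or> vector [0, 1, 0] \<bullet> u = 0"
    by (auto simp: inner_vec_def sum_3 vector_3 add_nonneg_eq_0_iff)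
qed (simp_all add: eval_mon_4 vector_3)

text \<open>Rows with a type of distinct entries are settled by the sign of a coefficient with even
  exponents; the others by values or zero sets.\<close>

lemma entries_distinct:
  assumes "E \<in> row_entries r" "e \<in> E" "E' \<in> row_entries r" "e' \<in> E'" "orbit e = orbit e'"
  shows "E = E'"
proof -
  have pair: "E = E'" if "row_entries r = {{x}, {y}}" "orbit x \<noteq> orbit y" for x y
    using assms that by auto
  have strict: "orbit x \<noteq> orbit y"
    if "row_entries r = {{x}, {y}}" "r \<noteq> Beta2" "row_type r $ 1 < row_type r $ 2" "row_type r $ 2 < row_type r $ 3"
      "even i" "even j" "even k" "coeff x (i,j,k) * coeff y (i,j,k) < 0" for x y i j k
    using orbit_neq_by_even_coeff [of x r y i j k] listed_critical [OF that(2), of "{x}" x]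
      listed_critical [OF that(2), of "{y}" y] that by simp
  show ?thesis
  proof (cases r)
    case Beta1
    have "orbit (sqrt (1/7) *\<^sub>R mon 2 0 2 + sqrt (1/14) *\<^sub>R mon 0 3 1) \<noteq> orbit (- sqrt (1/7) *\<^sub>R mon 2 0 2 + sqrt (1/14) *\<^sub>R mon 0 3 1)"
      by (rule strict [where i = 2 and j = 0 and k = 2]) (simp_all add: Beta1 coeff_mon expos_def vector_3)
    then show ?thesis
      by (rule pair [rotated]) (simp add: Beta1)
  next
    case Beta2
    show ?thesis
      by (rule pair [OF _ cubic_entries_distinct]) (simp add: Beta2)
  next
    case Beta3
    have "orbit (sqrt (3/7) *\<^sub>R mon 1 1 2 + sqrt (1/168) *\<^sub>R mon 0 4 0) \<noteq> orbit (sqrt (3/7) *\<^sub>R mon 1 1 2 - sqrt (1/168) *\<^sub>R mon 0 4 0)"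
      by (rule strict [where i = 0 and j = 4 and k = 0]) (simp_all add: Beta3 coeff_mon expos_def vector_3)
    then show ?thesis
      by (rule pair [rotated]) (simp add: Beta3)
  next
    case Beta5
    have "orbit (sqrt (4/39) *\<^sub>R mon 1 0 3 + sqrt (5/312) *\<^sub>R mon 0 4 0) \<noteq> orbit (sqrt (4/39) *\<^sub>R mon 1 0 3 - sqrt (5/312) *\<^sub>R mon 0 4 0)"
      by (rule strict [where i = 0 and j = 4 and k = 0]) (simp_all add: Beta5 coeff_mon expos_def vector_3)
    then show ?thesis
      by (rule pair [rotated]) (simp add: Beta5)
  next
    case Beta7
    have "orbit (sqrt (1/18) *\<^sub>R mon 1 0 3 + sqrt (1/6) *\<^sub>R mon 0 2 2) \<noteq> orbit (sqrt (1/18) *\<^sub>R mon 1 0 3 - sqrt (1/6) *\<^sub>R mon 0 2 2)"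
      by (rule strict [where i = 0 and j = 2 and k = 2]) (simp_all add: Beta7 coeff_mon expos_def vector_3)
    then show ?thesis
      by (rule pair [rotated]) (simp add: Beta7)
  next
    case Alpha_zzzz
    have "orbit (sqrt (1/24) *\<^sub>R mon 0 0 4) \<noteq> orbit (- sqrt (1/24) *\<^sub>R mon 0 0 4)"
      by (rule orbit_neq_by_sign [of _ _ "vector [0, 0, 1]"]) (simp_all add: eval_mon_4 vector_3)
    then show ?thesis
      by (intro pair) (simp_all add: Alpha_zzzz)
  next
    case Alpha_xyzz
    let ?A = "mon 2 0 2 + mon 0 2 2" and ?B = "- (mon 2 0 2 + mon 0 2 2)" and ?C = "mon 2 0 2 - mon 0 2 2"
    have "orbit ?A \<noteq> orbit ?B" "orbit ?A \<noteq> orbit ?C"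
      by (rule orbit_neq_by_sign [of _ _ "vector [0, 1, 1]"]; simp add: eval_mon_4 vector_3)+
    moreover have "orbit ?A \<noteq> orbit (- ?C)"
      by (rule orbit_neq_by_sign [of _ _ "vector [1, 0, 1]"]; simp add: eval_mon_4 vector_3)
    then have "orbit ?C \<noteq> orbit ?B"
      using orbit_uminus [of ?C ?B] unfolding minus_minus by metis
    ultimately show ?thesis
      using assms unfolding Alpha_xyzz row_entries.simps by auto
  next
    case Alpha_yyzz
    define P Q where "P = (\<lambda>t. mon 0 4 0 + (2 * t) *\<^sub>R mon 0 2 2 + mon 0 0 4)"
      and "Q = (\<lambda>t. mon 0 4 0 + (2 * t) *\<^sub>R mon 0 2 2 - mon 0 0 4)"
    define F1 F2 F3 where "F1 = {P t |t. True}" and "F2 = {- P t |t. - 1 \<le> t}" and "F3 = {Q t |t. True}"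
    have "row_entries r = {F1, F2, F3}"
      unfolding Alpha_yyzz row_entries.simps F1_def F2_def F3_def P_def Q_def ..
    moreover have "orbit x \<noteq> orbit y" if "x \<in> F1 \<and> y \<in> F2 \<or> x \<in> F3 \<and> y \<in> F2 \<or> x \<in> F1 \<and> y \<in> F3" for x y
      using that yyzz_families_distinct unfolding F1_def F2_def F3_def P_def Q_def by blast
    ultimately show ?thesis
      using assms by (metis empty_iff insert_iff)
  qed (use assms in auto)
qed

section \<open>The classification\<close>

theorem theorem5p6:
  shows
    \<comment> \<open>the form of the critical points of each type\<close>
    "(\<forall>r p. critical_point sym_gl p \<and> moment_map sym_gl p = row_beta r \<longrightarrow> p \<in> row_form r)
   \<and> \<comment> \<open>the minimal row\<close>
     (\<forall>p. p \<in> stratum (row_beta Beta0) \<and> critical_point sym_gl p \<longleftrightarrow> global_minimum sym_gl p)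
   \<and> (\<forall>p. global_minimum sym_gl p \<longrightarrow> p \<notin> null_cone)
   \<and> \<comment> \<open>the listed points are critical points of the given type; the two listed in row Beta2
         only represent orbits of such points\<close>
     (\<forall>r E p. r \<noteq> Beta2 \<and> E \<in> row_entries r \<and> p \<in> E \<longrightarrow>
        critical_point sym_gl p \<and> moment_map sym_gl p = row_beta r)
   \<and> (\<forall>E p. E \<in> row_entries Beta2 \<and> p \<in> E \<longrightarrow>
        (\<exists>q\<in>orbit p. critical_point sym_gl q \<and> moment_map sym_gl q = row_beta Beta2))
   \<and> \<comment> \<open>up to the action, the critical points in each stratum are those listed\<close>
     (\<forall>r. r \<noteq> Beta0 \<longrightarrow>
        orbit ` {p \<in> stratum (row_beta r). critical_point sym_gl p} = orbit ` \<Union>(row_entries r))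
   \<and> \<comment> \<open>the table exhausts the distinguished orbits in the null cone\<close>
     {S. distinguished S \<and> S \<subseteq> null_cone} = (\<Union>r\<in>- {Beta0}. orbit ` \<Union>(row_entries r))
   \<and> \<comment> \<open>different entries have no orbit in common\<close>
     (\<forall>r E p r' E' p'. E \<in> row_entries r \<and> p \<in> E \<and> E' \<in> row_entries r' \<and> p' \<in> E' \<and>
        orbit p = orbit p' \<longrightarrow> r = r' \<and> E = E')"
proof (intro conjI)
  show "\<forall>r p. critical_point sym_gl p \<and> moment_map sym_gl p = row_beta r \<longrightarrow> p \<in> row_form r"
    by (simp add: critical_point_gl moment_map_gl crit_in_row_form)
  show "\<forall>p. p \<in> stratum (row_beta Beta0) \<and> critical_point sym_gl p \<longleftrightarrow> global_minimum sym_gl p"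
    unfolding critical_point_gl using minimal_row by blast
  show "\<forall>p. global_minimum sym_gl p \<longrightarrow> p \<notin> null_cone"
    unfolding global_minimum_iff row_beta_Beta0 using minimal_not_in_null_cone by blast
  show "\<forall>r E p. r \<noteq> Beta2 \<and> E \<in> row_entries r \<and> p \<in> E \<longrightarrow>
      critical_point sym_gl p \<and> moment_map sym_gl p = row_beta r"
    unfolding critical_point_gl moment_map_gl using listed_critical by blast
  show "\<forall>E p. E \<in> row_entries Beta2 \<and> p \<in> E \<longrightarrow>
      (\<exists>q\<in>orbit p. critical_point sym_gl q \<and> moment_map sym_gl q = row_beta Beta2)"
    unfolding critical_point_gl moment_map_gl using Beta2_representative by blast
  show "\<forall>r. r \<noteq> Beta0 \<longrightarrow>
      orbit ` {p \<in> stratum (row_beta r). critical_point sym_gl p} = orbit ` \<Union> (row_entries r)"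
  proof (intro allI impI equalityI subsetI)
    fix r S assume r: "r \<noteq> Beta0" and "S \<in> orbit ` {p \<in> stratum (row_beta r). critical_point sym_gl p}"
    then obtain p k where p: "crit p" "S = orbit p" and k: "orthogonal_matrix k"
      and mmp: "mm p = k ** row_beta r ** transpose k"
      using critical_in_stratum_iff by (auto simp: critical_point_gl)
    have "mm (pullback k p) = (transpose k ** k) ** row_beta r ** (transpose k ** k)"
      unfolding mm_pullback [OF k] mmp by (simp only: matrix_mul_assoc)
    then have "mm (pullback k p) = row_beta r"
      by (simp add: orthogonal_matrixD [OF k])
    then show "S \<in> orbit ` \<Union> (row_entries r)"
      using normal_form [OF crit_pullback [OF k p(1)] _ r] orbit_eqI [OF orbit_pullback_orthogonal [OF k], of p]
      unfolding p(2) by blast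
  next
    fix r S assume "S \<in> orbit ` \<Union> (row_entries r)"
    then obtain E e where "E \<in> row_entries r" "e \<in> E" "S = orbit e"
      by blast
    then obtain q where q: "crit q" "mm q = row_beta r" "orbit q = S"
      using critical_representative by blast
    have "mm q = mat 1 ** row_beta r ** transpose (mat 1)"
      by (simp add: q(2) transpose_mat)
    then have "q \<in> stratum (row_beta r)"
      using critical_in_stratum_iff [OF q(1)] orthogonal_matrix_id by blast
    then show "S \<in> orbit ` {p \<in> stratum (row_beta r). critical_point sym_gl p}"
      using q by (auto simp: critical_point_gl)
  qed
  show "{S. distinguished S \<and> S \<subseteq> null_cone} = (\<Union>r\<in>- {Beta0}. orbit ` \<Union> (row_entries r))"
  proof (intro equalityI subsetI)
    fix S assume "S \<in> {S. distinguished S \<and> S \<subseteq> null_cone}"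
    then obtain q where q: "S = orbit q" "crit q" "orbit q \<subseteq> null_cone"
      unfolding distinguished_def critical_point_sl using orbit_eqI by blast
    obtain p b where p: "orbit p = orbit q" "crit p" "mm p = - dg b" and b: "b$1 \<le> b$2" "b$2 \<le> b$3"
      by (rule diagonal_representative [OF q(2)])
    obtain r where r: "b = row_type r"
      by (rule type_in_table [OF p(2,3) b])
    have mmp: "mm p = row_beta r"
      by (simp add: p(3) r row_beta_eq)
    have "p \<in> null_cone"
      using q(3) orbit_self [of p] p(1) by blast
    then have "r \<noteq> Beta0"
      using minimal_not_in_null_cone [of p] mmp p(2) by (auto simp: crit_def row_beta_Beta0)
    then show "S \<in> (\<Union>r\<in>- {Beta0}. orbit ` \<Union> (row_entries r))"
      using normal_form [OF p(2) mmp] p(1) q(1) by blast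
  next
    fix S assume "S \<in> (\<Union>r\<in>- {Beta0}. orbit ` \<Union> (row_entries r))"
    then obtain r E e where r: "r \<noteq> Beta0" and "E \<in> row_entries r" "e \<in> E" "S = orbit e"
      by blast
    then obtain q where q: "crit q" "mm q = row_beta r" "S = orbit q"
      using critical_representative by metis
    then have "q \<in> null_cone"
      using in_null_cone [OF q(2) [unfolded row_beta_eq] q(1) row_norm_gt [OF r]] by blast
    then have "S \<subseteq> null_cone"
      unfolding q(3) using null_cone_orbit by blast
    moreover have "distinguished S"
      unfolding distinguished_def critical_point_sl q(3) using q(1) orbit_self [of q] by (auto simp: crit_def)
    ultimately show "S \<in> {S. distinguished S \<and> S \<subseteq> null_cone}"
      by blast
  qed
  show "\<forall>r E p r' E' p'. E \<in> row_entries r \<and> p \<in> E \<and> E' \<in> row_entries r' \<and> p' \<in> E' \<and>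
        orbit p = orbit p' \<longrightarrow> r = r' \<and> E = E'"
  proof (intro allI impI)
    fix r E p r' E' p'
    assume *: "E \<in> row_entries r \<and> p \<in> E \<and> E' \<in> row_entries r' \<and> p' \<in> E' \<and> orbit p = orbit p'"
    obtain q where q: "crit q" "mm q = row_beta r" "orbit q = orbit p"
      using critical_representative * by blast
    obtain q' where q': "crit q'" "mm q' = row_beta r'" "orbit q' = orbit p'"
      using critical_representative * by blast
    have "r = r'"
      using row_eq_if_same_orbit [OF q(1,2) q'(1,2)] q(3) q'(3) * by simp
    then show "r = r' \<and> E = E'"
      using entries_distinct * by blast
  qed
qed

end
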